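(* Let $1<p<\infty$, $0<\gamma<\infty$, $0\le\beta<\infty$, $\omega\in\widehat{\mathcal D}$ and $\mu\in M^+([0,1))$. Then the following statements hold: (i) $C_{\mu,\omega}:X_\beta\to H^p$ is bounded if and only if $$\int_0^1\left(\frac{\widehat\mu(r)}{\widehat\omega(r)(1-r)^{\beta+1}}\right)^p dr+\widehat\mu(0)^p<\infty.$$ (ii) $C_{\mu,\omega}:X_\beta\to X_\gamma$ is bounded if and only if $$\sup_{n\in\mathbb N_0}\frac{\mu_n}{\omega_n(n+1)^{\gamma-\beta-1}}<\infty.$$ (iii) $C_{\mu,\omega}:X_\beta\to H^p_\gamma$ is bounded if and only if $$\sup_{n\in\mathbb N_0}\frac{\mu_n}{\omega_n(n+1)^{\gamma-\beta+\frac1p-1}}<\infty.$$ Moreover, the operator norm in each situation is comparable to the corresponding characterizing quantity (in (i), to its $p$-th root).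
   Context: $\mathcal H(\mathbb D)$ is the space of analytic functions in the unit disc $\mathbb D$. A weight is an integrable function $\omega:\mathbb D\to[0,\infty)$; it is radial if $\omega(z)=\omega(|z|)$. For a radial weight, $\widehat\omega(r)=\int_r^1\omega(s)\,ds$ and $\omega_x=\int_0^1 r^x\omega(r)\,dr$. $\omega\in\widehat{\mathcal D}$ means: $\omega$ is a radial weight, not a.e. zero, and there is $C>1$ with $\widehat\omega(r)\le C\,\widehat\omega\left(\frac{1+r}2\right)$ for all $0\le r<1$. $M^+([0,1))$ is the set of finite positive Borel measures on $[0,1)$; $\widehat\mu(r)=\mu([r,1))$, $\mu_x=\int_{[0,1)}r^x\,d\mu(r)$ (with $0^0=1$). Kernel: $B^\omega_t(z)=\sum_{n=0}^\infty\frac{(tz)^n}{2\omega_{2n+1}}$, $0\le t<1$, $z\in\mathbb D$. Operator: $C_{\mu,\omega}(f)(z)=\int_0^1 f(tz)B^\omega_t(z)\,d\mu(t)$ for $f\in\mathcal H(\mathbb D)$. $M_p^p(r,f)=\frac1{2\pi}\int_0^{2\pi}|f(re^{i\theta})|^p d\theta$, $M_\infty(r,f)=\max_{|z|=r}|f(z)|$. The spaces consist of $f\in\mathcal H(\mathbb D)$ with finite norm: $\|f\|_{H^p}=\sup_{0\le r<1}M_p(r,f)$; $\|f\|_{X_\beta}=\sup_{0\le r<1}(1-r)^\beta M_\infty(r,f)$ (so $X_0=H^\infty$); $\|f\|_{H^p_\gamma}=\sup_{0\le r<1}(1-r)^\gamma M_p(r,f)$. Bounded $X\to Y$ means $\|C_{\mu,\omega}f\|_Y\le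 C\|f\|_X$ for all $f\in X$; the operator norm is the least such $C$. Comparable means equal up to multiplicative constants independent of $\mu$ (they may depend on $p,\gamma,\beta,\omega$). *)

theory Defs
  imports "HOL-Complex_Analysis.Complex_Analysis"
begin

definition weight :: "(complex \<Rightarrow> real) \<Rightarrow> bool" where
  "weight \<omega> \<longleftrightarrow> (\<forall>z\<in>ball 0 1. 0 \<le> \<omega> z) \<and> set_integrable lebesgue (ball 0 1) \<omega>"

definition radial_weight :: "(complex \<Rightarrow> real) \<Rightarrow> bool" where
  "radial_weight \<omega> \<longleftrightarrow> weight \<omega> \<and> (\<forall>z\<in>ball 0 1. \<omega> z = \<omega> (of_real (cmod z)))"

definition weight_tail :: "(complex \<Rightarrow> real) \<Rightarrow> real \<Rightarrow> real" where
  "weight_tail \<omega> r = (LINT s:{r..<1}|lebesgue. \<omega> (of_real s))"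

text \<open>Only moments of integer order are needed; note that \<open>0 ^ 0 = 1\<close>, whereas \<open>0 powr 0 = 0\<close>.\<close>

definition weight_moment :: "(complex \<Rightarrow> real) \<Rightarrow> nat \<Rightarrow> real" where
  "weight_moment \<omega> n = (LINT s:{0..<1}|lebesgue. s ^ n * \<omega> (of_real s))"

text \<open>
  Integrability on the disc means that \<open>s * \<omega> s\<close> is integrable on \<open>[0,1)\<close>, so the tail at \<open>0\<close>
  may still be infinite. The doubling inequality at \<open>r = 0\<close> rules this out when tails take
  extended values. A divergent Bochner integral is \<open>0\<close>, so this finiteness is stated
  explicitly.
\<close>

definition Dhat :: "(complex \<Rightarrow> real) set" where
  "Dhat = {\<omega>. radial_weight \<omega>
     \<and> \<not> (AE z in lebesgue_on (ball 0 1). \<omega> z = 0)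
     \<and> set_integrable lebesgue {0..<1} (\<lambda>s. \<omega> (of_real s))
     \<and> (\<exists>C>1. \<forall>r\<in>{0..<1}. weight_tail \<omega> r \<le> C * weight_tail \<omega> ((1 + r) / 2))}"

definition Mplus :: "real measure set" where
  "Mplus = {\<mu>. finite_measure \<mu> \<and> sets \<mu> = sets (restrict_space borel {0..<1})}"

definition measure_tail :: "real measure \<Rightarrow> real \<Rightarrow> real" where
  "measure_tail \<mu> r = measure \<mu> {r..<1}"

definition measure_moment :: "real measure \<Rightarrow> nat \<Rightarrow> real" where
  "measure_moment \<mu> n = (LINT t|\<mu>. t ^ n)"

definition kernel :: "(complex \<Rightarrow> real) \<Rightarrow> real \<Rightarrow> complex \<Rightarrow> complex" where
  "kernel \<omega> t z = (\<Sum>n. (of_real t * z) ^ n / of_real (2 * weight_moment \<omega> (2 * n + 1)))"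

definition Cop :: "real measure \<Rightarrow> (complex \<Rightarrow> real) \<Rightarrow> (complex \<Rightarrow> complex) \<Rightarrow> complex \<Rightarrow> complex" where
  "Cop \<mu> \<omega> f z = (LINT t|\<mu>. f (of_real t * z) * kernel \<omega> t z)"

definition Mp :: "real \<Rightarrow> real \<Rightarrow> (complex \<Rightarrow> complex) \<Rightarrow> real" where
  "Mp p r f = (1 / (2 * pi) * (LINT \<theta>:{0..2*pi}|lborel. cmod (f (rcis r \<theta>)) powr p)) powr (1 / p)"

definition Minfty :: "real \<Rightarrow> (complex \<Rightarrow> complex) \<Rightarrow> real" where
  "Minfty r f = (SUP z\<in>sphere 0 r. cmod (f z))"

definition Hp_norm :: "real \<Rightarrow> (complex \<Rightarrow> complex) \<Rightarrow> ennreal" where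
  "Hp_norm p f = (SUP r\<in>{0..<1}. ennreal (Mp p r f))"

definition X_norm :: "real \<Rightarrow> (complex \<Rightarrow> complex) \<Rightarrow> ennreal" where
  "X_norm \<beta> f = (SUP r\<in>{0..<1}. ennreal ((1 - r) powr \<beta> * Minfty r f))"

definition Hp_weighted_norm :: "real \<Rightarrow> real \<Rightarrow> (complex \<Rightarrow> complex) \<Rightarrow> ennreal" where
  "Hp_weighted_norm p \<gamma> f = (SUP r\<in>{0..<1}. ennreal ((1 - r) powr \<gamma> * Mp p r f))"

text \<open>
  A space of analytic functions is represented by its extended-valued norm: it consists of the
  analytic functions of finite norm. In \<open>bounded_op NX NY T\<close> and \<open>op_norm NX NY T\<close>, the operator \<open>T\<close> maps the space of
  \<open>NX\<close> to that of \<open>NY\<close>.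
\<close>

definition analytic_space :: "((complex \<Rightarrow> complex) \<Rightarrow> ennreal) \<Rightarrow> (complex \<Rightarrow> complex) set" where
  "analytic_space N = {f. f holomorphic_on ball 0 1 \<and> N f < \<infinity>}"

definition op_bound :: "((complex \<Rightarrow> complex) \<Rightarrow> ennreal) \<Rightarrow> ((complex \<Rightarrow> complex) \<Rightarrow> ennreal)
    \<Rightarrow> ((complex \<Rightarrow> complex) \<Rightarrow> complex \<Rightarrow> complex) \<Rightarrow> real \<Rightarrow> bool" where
  "op_bound NX NY T C \<longleftrightarrow> 0 \<le> C \<and>
     (\<forall>f\<in>analytic_space NX. T f \<in> analytic_space NY \<and> NY (T f) \<le> ennreal C * NX f)"

definition bounded_op :: "((complex \<Rightarrow> complex) \<Rightarrow> ennreal) \<Rightarrow> ((complex \<Rightarrow> complex) \<Rightarrow> ennreal)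
    \<Rightarrow> ((complex \<Rightarrow> complex) \<Rightarrow> complex \<Rightarrow> complex) \<Rightarrow> bool" where
  "bounded_op NX NY T \<longleftrightarrow> (\<exists>C. op_bound NX NY T C)"

definition op_norm :: "((complex \<Rightarrow> complex) \<Rightarrow> ennreal) \<Rightarrow> ((complex \<Rightarrow> complex) \<Rightarrow> ennreal)
    \<Rightarrow> ((complex \<Rightarrow> complex) \<Rightarrow> complex \<Rightarrow> complex) \<Rightarrow> real" where
  "op_norm NX NY T = Inf {C. op_bound NX NY T C}"

definition comparable_on :: "'a set \<Rightarrow> ('a \<Rightarrow> real) \<Rightarrow> ('a \<Rightarrow> real) \<Rightarrow> bool" where
  "comparable_on A F G \<longleftrightarrow> (\<exists>c>0. \<exists>C>0. \<forall>x\<in>A. c * G x \<le> F x \<and> F x \<le> C * G x)"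

definition Hp_quantity :: "real \<Rightarrow> real \<Rightarrow> (complex \<Rightarrow> real) \<Rightarrow> real measure \<Rightarrow> ennreal" where
  "Hp_quantity p \<beta> \<omega> \<mu> =
     (\<integral>\<^sup>+ r\<in>{0..<1}. ennreal ((measure_tail \<mu> r / (weight_tail \<omega> r * (1 - r) powr (\<beta> + 1))) powr p) \<partial>lborel)
     + ennreal (measure_tail \<mu> 0 powr p)"

definition moment_ratio :: "real \<Rightarrow> (complex \<Rightarrow> real) \<Rightarrow> real measure \<Rightarrow> nat \<Rightarrow> real" where
  "moment_ratio \<alpha> \<omega> \<mu> n = measure_moment \<mu> n / (weight_moment \<omega> n * real (n + 1) powr \<alpha>)"

end

(*
  Doubling gives w_n ~ what(1 - 1/(n+1)), and summation by parts (the coefficients 1/(2 w_(2n+1))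
  increase) bounds the kernel K(w) = B_1(w) by a constant over what(|w|) |1 - w|, while
  K(x) ~ 1/(what(x) (1 - x)) on [0,1).

  Sufficiency. |C f(z)| is at most the integral of (1 - t|z|)^(-beta) |K(tz)| dmu(t). For X_gamma
  and H^p_gamma this integral is expanded into a power series whose coefficients contain mu_n/w_n,
  after Minkowski's inequality in the second case. For H^p the mass of mu at t is spread over the
  radii [2t - 1, t], which leaves a Hilbert-type operator with kernel 1/(1 - r + |theta|) applied to
  muhat(r) / (what(r) (1 - r)^(beta+1)); it is bounded on L^p by Schur's test.

  Necessity. The function (1 - z)^(-beta) has norm at most 1 and C maps it to a function F with
  F(x) >= c * int (1 - tx)^(-beta-1) / what(tx) dmu(t) for 0 <= x < 1. Cauchy's formula on a circle
  controls F on the radius: Hoelder gives the growth of F in H^p_gamma, and the same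
  Hilbert-type inequality gives int_0^1 F(r)^p dr <= C ||F||_p^p.
*)

theory Submission
  imports Defs
begin

section \<open>Radial weights\<close>

text \<open>The obstacle is that \<mu> is an arbitrary measure, possibly with atoms, so only its
  tails and moments may enter. This dictates the spreading over \<open>[2 * t - 1, t]\<close>: there
  \<open>1 - r\<close> and the tail of the weight change by bounded factors only, and after
  Tonelli's theorem the condition \<open>r \<le> t\<close> integrates to the tail of \<mu> at
  \<open>r\<close>. For circle means it is not enough to bound the kernel by its value on the
  radius: the angle would be lost, and integrating over it gains the power 1/p of the distance to
  the circle. Comparing moments with tails loses a power of \<open>(n + 1) * (1 - x)\<close>, whose
  exponent comes from the doubling constant; the factor \<open>x ^ n\<close> absorbs it. For
  necessity no boundary values of Hardy functions are used: Cauchy's formula on circles of radius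
  \<rho> < 1 yields values at \<open>\<rho> * r\<close>, the estimates are uniform in \<rho>, and
  monotone convergence removes it. Both Hilbert-type inequalities hold since the exponents 1/p and 1
  - 1/p lie strictly between 0 and 1. All constants are fixed before \<mu>.\<close>

lemma negligible_cmod_vimage:
  assumes "negligible (N :: real set)"
  shows "negligible {z :: complex. cmod z \<in> N}"
proof -
  have "N \<in> null_sets lebesgue"
    using assms by (simp add: negligible_iff_null_sets)
  \<comment> \<open>The product formula below needs a Borel set, so \<open>N\<close> is first
    enlarged to a Borel null set.\<close>
  then obtain N' where N': "N' \<in> null_sets lborel" "N \<subseteq> N'"
    by (auto simp: null_sets_completion_iff2)
  \<comment> \<open>Polar coordinates as a map between spaces of real dimension 2, so that its
    differentiability carries null sets to null sets.\<close>
  define g :: "real \<times> real \<Rightarrow> complex" where "g = (\<lambda>w. rcis (fst w) (snd w))"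
  have "emeasure (lborel \<Otimes>\<^sub>M lborel) (N' \<times> (UNIV :: real set)) = 0"
    using N' by (subst lborel.emeasure_pair_measure_Times) auto
  then have "N' \<times> (UNIV :: real set) \<in> null_sets (lborel :: (real \<times> real) measure)"
    using N' unfolding lborel_prod[symmetric] by (intro null_setsI) auto
  then have "negligible (N' \<times> (UNIV :: real set))"
    by (simp add: negligible_iff_null_sets null_sets_completionI)
  moreover have "g differentiable_on (N' \<times> UNIV)"
  proof -
    have "\<exists>g'. (g has_derivative g') (at w within N' \<times> UNIV)" for w
      unfolding g_def rcis_def
      by (intro exI) (rule has_derivative_mult has_derivative_of_real has_derivative_cis
          has_derivative_fst has_derivative_snd has_derivative_ident)+
    then show ?thesis
      unfolding differentiable_on_def differentiable_def by blast
  qed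
  ultimately have "negligible (g ` (N' \<times> UNIV))"
    by (intro negligible_differentiable_image_negligible) simp_all
  moreover have "{z. cmod z \<in> N} \<subseteq> g ` (N' \<times> UNIV)"
  proof
    fix z assume "z \<in> {z. cmod z \<in> N}"
    then have "(cmod z, Arg z) \<in> N' \<times> UNIV" "z = g (cmod z, Arg z)"
      using N' by (auto simp: g_def rcis_cmod_Arg)
    then show "z \<in> g ` (N' \<times> UNIV)" by blast
  qed
  ultimately show ?thesis
    using negligible_subset by blast
qed

locale Dhat_weight =
  fixes \<omega> :: "complex \<Rightarrow> real"
  assumes \<omega>: "\<omega> \<in> Dhat"
begin

abbreviation tail :: "real \<Rightarrow> real" where
  "tail \<equiv> weight_tail \<omega>"

abbreviation moment :: "nat \<Rightarrow> real" where
  "moment \<equiv> weight_moment \<omega>"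

lemma weight_integrable: "set_integrable lebesgue {0..<1} (\<lambda>s. \<omega> (of_real s))"
  and weight_nonneg: "0 \<le> s \<Longrightarrow> s < 1 \<Longrightarrow> 0 \<le> \<omega> (of_real s)"
proof -
  show "set_integrable lebesgue {0..<1} (\<lambda>s. \<omega> (of_real s))"
    using \<omega> unfolding Dhat_def by blast
  have "0 \<le> \<omega> z" if "z \<in> ball 0 1" for z
    using \<omega> that unfolding Dhat_def radial_weight_def weight_def by blast
  then show "0 \<le> s \<Longrightarrow> s < 1 \<Longrightarrow> 0 \<le> \<omega> (of_real s)"
    by simp
qed

lemma weight_tail_integrable:
  assumes "0 \<le> r"
  shows "set_integrable lebesgue {r..<1} (\<lambda>s. \<omega> (of_real s))"
  by (rule set_integrable_subset[OF weight_integrable]) (use assms in auto)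

lemma weight_moment_integrable:
  "set_integrable lebesgue {0..<1} (\<lambda>s. s ^ n * \<omega> (of_real s))"
proof -
  have m: "set_borel_measurable lebesgue {0..<1} (\<lambda>s. \<omega> (of_real s))"
    using weight_integrable by (simp add: set_integrable_def set_borel_measurable_def)
  have "(\<lambda>s. s ^ n * (indicat_real {0..<1} s *\<^sub>R \<omega> (of_real s))) \<in> borel_measurable lebesgue"
    using m unfolding set_borel_measurable_def
    by (intro borel_measurable_times) (auto intro: borel_measurable_if_D measurable_completion)
  then have m': "(\<lambda>s. indicat_real {0..<1} s *\<^sub>R (s ^ n * \<omega> (of_real s))) \<in> borel_measurable lebesgue"
    by (simp add: mult_ac)
  show ?thesis
    unfolding set_integrable_def
  proof (rule Bochner_Integration.integrable_bound[OF weight_integrable[unfolded set_integrable_def] m'])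
    show "AE s in lebesgue. norm (indicat_real {0..<1} s *\<^sub>R (s ^ n * \<omega> (of_real s)))
        \<le> norm (indicat_real {0..<1} s *\<^sub>R \<omega> (of_real s))"
      using weight_nonneg by (intro AE_I2) (auto simp: indicator_def power_le_one mult_left_le_one_le abs_mult)
  qed
qed

lemma weight_tail_antimono:
  assumes "0 \<le> r" "r \<le> t"
  shows "tail t \<le> tail r"
  unfolding weight_tail_def
  unfolding set_lebesgue_integral_def
  by (rule integral_mono[OF weight_tail_integrable[unfolded set_integrable_def]
        weight_tail_integrable[unfolded set_integrable_def]])
     (use assms weight_nonneg in \<open>auto simp: indicator_def\<close>)

lemma weight_tail_nonneg:
  assumes "0 \<le> r"
  shows "0 \<le> tail r"
  unfolding weight_tail_def set_lebesgue_integral_def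
  by (rule integral_nonneg_AE) (use assms weight_nonneg in \<open>auto simp: indicator_def\<close>)

lemma weight_tail_doubling:
  obtains D where "D > 1" "\<And>r. 0 \<le> r \<Longrightarrow> r < 1 \<Longrightarrow> tail r \<le> D * tail ((1 + r) / 2)"
proof -
  have "\<exists>C>1. \<forall>r\<in>{0..<1}. tail r \<le> C * tail ((1 + r) / 2)"
    using \<omega> unfolding Dhat_def by blast
  then show ?thesis
    using that by auto
qed

text \<open>\<open>Dhat\<close> excludes weights that vanish a.e. in the plane, whereas the tail is
  an integral over the line. If the tail at 0 were 0, the radii where \<omega> is nonzero would form
  a null set of the line, the union of their circles a null set of the plane, and by radial symmetry
  \<omega> would vanish a.e. in the disc.\<close>

lemma weight_tail_0_pos: "0 < tail 0"
proof (rule ccontr)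
  assume "\<not> ?thesis"
  then have "tail 0 = 0" using weight_tail_nonneg[of 0] by simp
  then have "AE s in lebesgue. indicat_real {0..<1} s *\<^sub>R \<omega> (of_real s) = 0"
    using weight_integrable weight_nonneg
    unfolding weight_tail_def set_lebesgue_integral_def set_integrable_def
    by (subst (asm) integral_nonneg_eq_0_iff_AE) (auto simp: indicator_def)
  then obtain N where "N \<in> null_sets lebesgue"
      "{s. \<not> (indicat_real {0..<1} s *\<^sub>R \<omega> (of_real s) = 0)} \<subseteq> N"
    by (auto simp: eventually_ae_filter)
  then have "negligible {s. \<not> (indicat_real {0..<1} s *\<^sub>R \<omega> (of_real s) = 0)}"
    by (simp add: negligible_iff_null_sets[symmetric] negligible_subset)
  from negligible_cmod_vimage[OF this]
  have "negligible {z :: complex. cmod z < 1 \<and> \<omega> (of_real (cmod z)) \<noteq> 0}"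
    by (rule negligible_subset) (auto simp: indicator_def)
  then have "AE z in lebesgue. \<not> (cmod z < 1 \<and> \<omega> (of_real (cmod z)) \<noteq> 0)"
    unfolding negligible_iff_null_sets by (intro AE_I') auto
  then have "AE z in lebesgue. z \<in> ball 0 1 \<longrightarrow> \<omega> z = 0"
  proof (rule eventually_mono)
    fix z assume z: "\<not> (cmod z < 1 \<and> \<omega> (of_real (cmod z)) \<noteq> 0)"
    have "z \<in> ball 0 1 \<Longrightarrow> \<omega> z = \<omega> (of_real (cmod z))"
      using \<omega> unfolding Dhat_def radial_weight_def by blast
    with z show "z \<in> ball 0 1 \<longrightarrow> \<omega> z = 0" by auto
  qed
  then have "AE z in lebesgue_on (ball 0 1). \<omega> z = 0"
    by (subst AE_restrict_space_iff) auto
  then show False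
    using \<omega> unfolding Dhat_def by blast
qed

text \<open>Iterated doubling: each step halves the distance to 1 and costs a factor
  \<open>D\<close>, so passing from \<open>1 - r\<close> to \<open>1 - t\<close> takes about log2 of
  their quotient many steps. With \<open>b = log 2 D\<close> the total cost is a power of that
  quotient.\<close>

lemma weight_tail_power_doubling:
  obtains D b where "D \<ge> 1" "b \<ge> 0"
    "\<And>r t. 0 \<le> r \<Longrightarrow> r \<le> t \<Longrightarrow> t < 1 \<Longrightarrow>
       tail r \<le> D * ((1 - r) / (1 - t)) powr b * tail t"
proof -
  obtain D where D: "D > 1" "\<And>r. 0 \<le> r \<Longrightarrow> r < 1 \<Longrightarrow> tail r \<le> D * tail ((1 + r) / 2)"
    using weight_tail_doubling by blast
  have iter: "tail r \<le> D ^ k * tail (1 - (1 - r) / 2 ^ k)" if "0 \<le> r" "r < 1" for r k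
  proof (induction k)
    case (Suc k)
    let ?q = "1 - (1 - r) / 2 ^ k"
    have "(1 - r) / 2 ^ k \<le> 1 - r" "0 < (1 - r) / 2 ^ k"
      using that by (simp_all add: divide_le_eq mult_left_le)
    then have "0 \<le> ?q" "?q < 1" using that by linarith+
    from D(2)[OF this] have "tail ?q \<le> D * tail ((1 + ?q) / 2)" .
    also have "(1 + ?q) / 2 = 1 - (1 - r) / 2 ^ Suc k" by (simp add: field_simps)
    finally have "D ^ k * tail ?q \<le> D ^ k * (D * tail (1 - (1 - r) / 2 ^ Suc k))"
      using D by (intro mult_left_mono) auto
    with Suc show ?case by (simp add: mult_ac)
  qed simp
  define b where "b = log 2 D"
  have b: "b \<ge> 0" "2 powr b = D" using D by (auto simp: b_def)
  show ?thesis
  proof (rule that[of D b])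
    fix r t :: real assume rt: "0 \<le> r" "r \<le> t" "t < 1"
    define q where "q = (1 - r) / (1 - t)"
    have q: "q \<ge> 1" using rt by (simp add: q_def)
    \<comment> \<open>Then \<open>q\<close> lies between \<open>2 ^ k\<close> and
      \<open>2 ^ Suc k\<close>: \<open>Suc k\<close> halvings pass beyond \<open>t\<close>, while
      \<open>D ^ k\<close> is at most \<open>q powr b\<close>. The one extra factor is the constant
      \<open>D\<close> of the statement.\<close>
    define k where "k = nat \<lfloor>log 2 q\<rfloor>"
    have "0 \<le> log 2 q" using q by simp
    then have k: "real k \<le> log 2 q" "log 2 q < real (Suc k)"
      by (simp_all add: k_def) linarith+
    have "2 ^ k \<le> q" using k(1) q by (subst (asm) le_log_iff) (auto simp: powr_realpow)
    have "q < 2 ^ Suc k" using k(2) q by (subst (asm) log_less_iff) (auto simp: powr_add powr_realpow)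
    have "tail r \<le> D ^ Suc k * tail (1 - (1 - r) / 2 ^ Suc k)"
      using iter[of r "Suc k"] rt by simp
    also have "\<dots> \<le> D ^ Suc k * tail t"
    proof (intro mult_left_mono weight_tail_antimono)
      show "t \<le> 1 - (1 - r) / 2 ^ Suc k"
        using \<open>q < 2 ^ Suc k\<close> rt by (simp add: q_def field_simps)
    qed (use D rt in auto)
    also have "D ^ k = (2 ^ k) powr b"
      by (simp add: b(2)[symmetric] powr_powr mult.commute flip: powr_realpow)
    then have "D ^ Suc k * tail t \<le> D * q powr b * tail t"
      using D b weight_tail_nonneg[of t] rt \<open>2 ^ k \<le> q\<close> by (auto intro!: mult_right_mono mult_left_mono powr_mono2)
    finally show "tail r \<le> D * ((1 - r) / (1 - t)) powr b * tail t"
      by (simp add: q_def)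
  qed (use D b in auto)
qed

end

text \<open>The radius that belongs to the moment of order \<open>n\<close>: beyond it
  \<open>r ^ n\<close> stays bounded below. The shift to \<open>Suc n\<close> makes
  \<open>node 0 = 0\<close> and lets \<open>node (2 ^ j - 1)\<close> be the dyadic radius
  \<open>1 - 1 / 2 ^ j\<close>.\<close>

definition node :: "nat \<Rightarrow> real" where
  "node n = 1 - 1 / real (Suc n)"

text \<open>With \<open>\<alpha> = 0\<close> this is the size of the kernel on the radius; in general it is that size
  times the factor \<open>(1 - x) powr - \<alpha>\<close>.\<close>

definition kernel_size :: "(complex \<Rightarrow> real) \<Rightarrow> real \<Rightarrow> real \<Rightarrow> real" where
  "kernel_size \<omega> \<alpha> x = (1 - x) powr (- \<alpha> - 1) / weight_tail \<omega> x"

lemma node_bounds: "0 \<le> node n" "node n < 1"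
  by (auto simp: node_def)

lemma one_minus_node: "1 - node n = 1 / real (Suc n)"
  by (simp add: node_def)

lemma node_power_ge: "1 / 3 \<le> node n ^ n"
proof (cases "n = 0")
  case False
  then have n: "real n > 0" by simp
  have "(1 + 1 / real n) ^ n \<le> exp 1"
    using False by (intro exp_ge_one_plus_x_over_n_power_n) auto
  then have le: "(1 + 1 / real n) ^ n \<le> 3"
    using exp_le by linarith
  have "node n = 1 / (1 + 1 / real n)"
    using n by (simp add: node_def field_simps)
  then have "node n ^ n = 1 / (1 + 1 / real n) ^ n"
    by (simp add: power_divide)
  also have "\<dots> \<ge> 1 / 3"
    using le n by (intro divide_left_mono mult_pos_pos zero_less_power) (auto simp: add_pos_pos)
  finally show ?thesis .
qed simp

text \<open>With \<open>u = (n + 1) * (1 - x)\<close> the factor \<open>x ^ n\<close> is at most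
  \<open>exp (1 - u)\<close>, which beats every power of \<open>u\<close>. This is how polynomial
  losses from doubling are absorbed.\<close>

lemma powr_power_bound:
  fixes b :: real
  assumes "b \<ge> 0"
  obtains C where "C > 0"
    "\<And>x n. 0 \<le> x \<Longrightarrow> x \<le> 1 \<Longrightarrow> (real (Suc n) * (1 - x)) powr b * x ^ n \<le> C"
proof (rule that[of "(b + 1) powr b * exp 1"])
  fix x :: real and n :: nat
  assume x: "0 \<le> x" "x \<le> 1"
  define u where "u = real (Suc n) * (1 - x)"
  have u: "u \<ge> 0" using x by (simp add: u_def)
  have "x \<le> exp (x - 1)" using exp_ge_add_one_self[of "x - 1"] by simp
  then have "x ^ n \<le> exp (x - 1) ^ n" using x by (intro power_mono)
  also have "\<dots> = exp (1 - x - u)"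
    by (simp add: exp_of_nat_mult[symmetric] u_def algebra_simps)
  also have "\<dots> \<le> exp (1 - u)" using x by simp
  finally have 1: "x ^ n \<le> exp (1 - u)" .
  \<comment> \<open>Dividing by \<open>b + 1\<close> instead of \<open>b\<close> covers
    \<open>b = 0\<close> as well and leaves \<open>exp (u * (b / (b + 1)))\<close>, which is at most
    \<open>exp u\<close>.\<close>
  have "u / (b + 1) \<le> exp (u / (b + 1))"
    using exp_ge_add_one_self[of "u / (b + 1)"] by linarith
  then have "u \<le> (b + 1) * exp (u / (b + 1))"
    using assms by (simp add: field_simps)
  then have "u powr b \<le> ((b + 1) * exp (u / (b + 1))) powr b"
    using assms u by (intro powr_mono2) auto
  also have "\<dots> = (b + 1) powr b * exp (u * (b / (b + 1)))"
    using assms by (simp add: powr_mult exp_powr_real)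
  also have "\<dots> \<le> (b + 1) powr b * exp (u * 1)"
    using assms u by (intro mult_left_mono iffD2[OF exp_le_cancel_iff]) auto
  finally have "u powr b \<le> (b + 1) powr b * exp u" by simp
  then have "u powr b * x ^ n \<le> ((b + 1) powr b * exp u) * exp (1 - u)"
    using 1 x by (intro mult_mono) auto
  also have "\<dots> = (b + 1) powr b * exp 1"
    by (simp add: mult.assoc flip: exp_add)
  finally show "(real (Suc n) * (1 - x)) powr b * x ^ n \<le> (b + 1) powr b * exp 1"
    by (simp add: u_def)
qed (use assms in auto)

section \<open>Moments compared with tails at the nodes\<close>

context Dhat_weight
begin

abbreviation Phi :: "real \<Rightarrow> real \<Rightarrow> real"  ("\<Phi>") where
  "\<Phi> \<equiv> kernel_size \<omega>"

text \<open>By power doubling, a zero of the tail before 1 would propagate back to 0.\<close>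

lemma weight_tail_pos:
  assumes "0 \<le> r" "r < 1"
  shows "0 < tail r"
proof -
  obtain D b where "D \<ge> 1" and D:
    "\<And>r t. 0 \<le> r \<Longrightarrow> r \<le> t \<Longrightarrow> t < 1 \<Longrightarrow>
       tail r \<le> D * ((1 - r) / (1 - t)) powr b * tail t"
    using weight_tail_power_doubling by metis
  have "0 < D * ((1 - 0) / (1 - r)) powr b * tail r"
    using D[of 0 r] assms weight_tail_0_pos by linarith
  then have "tail r \<noteq> 0" by auto
  with weight_tail_nonneg[OF assms(1)] show ?thesis by simp
qed

lemma kernel_size_pos: "0 \<le> x \<Longrightarrow> x < 1 \<Longrightarrow> 0 < \<Phi> \<alpha> x"
  using weight_tail_pos by (simp add: kernel_size_def)

lemma weight_moment_antimono:
  assumes "m \<le> n"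
  shows "moment n \<le> moment m"
  unfolding weight_moment_def set_lebesgue_integral_def
  by (rule integral_mono[OF weight_moment_integrable[unfolded set_integrable_def]
        weight_moment_integrable[unfolded set_integrable_def]])
     (use assms weight_nonneg in \<open>auto simp: indicator_def power_decreasing mult_right_mono\<close>)

text \<open>The integral is cut at \<open>s\<close>: below \<open>s\<close> the extra factor
  \<open>t ^ q\<close> is at most \<open>s ^ q\<close>, above \<open>s\<close> the whole power is at
  most 1. The first part is a small multiple of a lower moment, which allows induction on the
  order.\<close>

lemma weight_moment_add_le:
  assumes "0 \<le> s" "s \<le> 1"
  shows "moment (n + q) \<le> s ^ q * moment n + tail s"
proof -
  note int = weight_moment_integrable[unfolded set_integrable_def]
  note intt = weight_tail_integrable[OF assms(1), unfolded set_integrable_def]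
  have "moment (n + q) \<le> (LINT t|lebesgue. s ^ q * (indicat_real {0..<1} t *\<^sub>R (t ^ n * \<omega> (of_real t)))
      + indicat_real {s..<1} t *\<^sub>R \<omega> (of_real t))"
    unfolding weight_moment_def set_lebesgue_integral_def
  proof (rule integral_mono[OF int])
    show "integrable lebesgue (\<lambda>t. s ^ q * (indicat_real {0..<1} t *\<^sub>R (t ^ n * \<omega> (of_real t)))
      + indicat_real {s..<1} t *\<^sub>R \<omega> (of_real t))"
      by (intro Bochner_Integration.integrable_add integrable_mult_right int intt)
    fix t :: real
    show "indicat_real {0..<1} t *\<^sub>R (t ^ (n + q) * \<omega> (of_real t))
      \<le> s ^ q * (indicat_real {0..<1} t *\<^sub>R (t ^ n * \<omega> (of_real t)))
      + indicat_real {s..<1} t *\<^sub>R \<omega> (of_real t)"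
    proof (cases "0 \<le> t \<and> t < 1")
      case True
      have nn: "0 \<le> \<omega> (of_real t)" using True weight_nonneg by simp
      show ?thesis
      proof (cases "t < s")
        case lt: True
        have "t ^ q \<le> s ^ q" using True lt by (intro power_mono) auto
        then have "t ^ q * (t ^ n * \<omega> (of_real t)) \<le> s ^ q * (t ^ n * \<omega> (of_real t))"
          using True nn by (intro mult_right_mono) auto
        then show ?thesis using True lt by (simp add: power_add mult_ac)
      next
        case False
        have "t ^ (n + q) * \<omega> (of_real t) \<le> 1 * \<omega> (of_real t)"
          using True nn by (intro mult_right_mono power_le_one) auto
        moreover have "0 \<le> s ^ q * (t ^ n * \<omega> (of_real t))"
          using True nn assms by simp
        ultimately show ?thesis using True False by simp
      qed
    qed (use assms in \<open>auto simp: indicator_def\<close>)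
  qed
  also have "\<dots> = s ^ q * moment n + tail s"
    unfolding weight_moment_def weight_tail_def set_lebesgue_integral_def
    by (subst Bochner_Integration.integral_add[OF integrable_mult_right[OF int] intt]) simp
  finally show ?thesis .
qed

text \<open>The easy half of the comparison: beyond \<open>node n\<close> the factor
  \<open>t ^ n\<close> is at least 1/3.\<close>

lemma weight_tail_le_moment: "tail (node n) \<le> 3 * moment n"
proof -
  note int = weight_moment_integrable[unfolded set_integrable_def]
  have "tail (node n) \<le> (LINT t|lebesgue. 3 * (indicat_real {0..<1} t *\<^sub>R (t ^ n * \<omega> (of_real t))))"
    unfolding weight_tail_def set_lebesgue_integral_def
  proof (rule integral_mono[OF weight_tail_integrable[OF node_bounds(1), unfolded set_integrable_def]])
    show "integrable lebesgue (\<lambda>t. 3 * (indicat_real {0..<1} t *\<^sub>R (t ^ n * \<omega> (of_real t))))"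
      by (intro integrable_mult_right int)
    fix t :: real
    show "indicat_real {node n..<1} t *\<^sub>R \<omega> (of_real t)
      \<le> 3 * (indicat_real {0..<1} t *\<^sub>R (t ^ n * \<omega> (of_real t)))"
    proof (cases "0 \<le> t \<and> t < 1")
      case True
      have nn: "0 \<le> \<omega> (of_real t)" using True weight_nonneg by simp
      show ?thesis
      proof (cases "t < node n")
        case False
        have "node n ^ n \<le> t ^ n" using True False node_bounds by (intro power_mono) auto
        then have "1 \<le> 3 * t ^ n" using node_power_ge[of n] by linarith
        then have "1 * \<omega> (of_real t) \<le> (3 * t ^ n) * \<omega> (of_real t)"
          using nn by (intro mult_right_mono)
        then show ?thesis using True False by simp
      qed (use True nn in auto)
    qed (use node_bounds[of n] in \<open>auto simp: indicator_def\<close>)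
  qed
  then show ?thesis
    unfolding weight_moment_def set_lebesgue_integral_def by simp
qed

lemma weight_moment_pos: "0 < moment n"
  using weight_tail_le_moment[of n] weight_tail_pos[OF node_bounds, of n] by linarith

lemma weight_moment_0: "moment 0 = tail 0"
  by (simp add: weight_moment_def weight_tail_def)

text \<open>The half of the comparison that rests on doubling: the mass far from the boundary, where
  \<open>t ^ n\<close> is small, must be dominated by the tail at \<open>node n\<close>. Only the
  orders \<open>2 ^ j - 1\<close> are treated by induction; monotonicity and one more doubling fill
  the gaps.\<close>

lemma weight_moment_le_tail:
  obtains C where "C \<ge> 1" "\<And>n. moment n \<le> C * tail (node n)"
proof -
  obtain D where D: "D > 1" "\<And>r. 0 \<le> r \<Longrightarrow> r < 1 \<Longrightarrow> tail r \<le> D * tail ((1 + r) / 2)"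
    using weight_tail_doubling by blast
  define T where "T j = tail (1 - 1 / 2 ^ j)" for j :: nat
  have Tnn: "0 \<le> T j" for j
    unfolding T_def by (rule weight_tail_nonneg) simp
  have T1: "T j \<le> D * T (Suc j)" for j
  proof -
    have "(1 + (1 - 1 / 2 ^ j)) / 2 = 1 - 1 / (2::real) ^ Suc j" by (simp add: field_simps)
    moreover have "T j \<le> D * tail ((1 + (1 - 1 / 2 ^ j)) / 2)"
      unfolding T_def by (rule D(2)) auto
    ultimately show ?thesis by (simp only: T_def)
  qed
  have Tk: "T j \<le> D ^ k * T (j + k)" for j k
  proof (induction k)
    case (Suc k)
    have "D ^ k * T (j + k) \<le> D ^ k * (D * T (Suc (j + k)))"
      using D by (intro mult_left_mono T1) auto
    with Suc show ?case by (simp add: mult_ac)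
  qed simp
  \<comment> \<open>Induction on \<open>j\<close>: cutting the integral at \<open>1 - 2 ^ k / 2 ^ j\<close> contracts the previous bound by
    \<open>exp (- (2 ^ k))\<close>, which beats the doubling constant once \<open>k\<close> is large.\<close>
  define k where "k = nat \<lceil>2 * D\<rceil>"
  define \<epsilon> where "\<epsilon> = exp (- (2 ^ k :: real))"
  have "2 * D \<le> real k" unfolding k_def by linarith
  also have "\<dots> \<le> 2 ^ k" using of_nat_less_two_power[of k, where 'a = real] by simp
  also have "\<dots> \<le> exp (2 ^ k)" using exp_ge_add_one_self[of "2 ^ k"] by linarith
  finally have \<epsilon>: "\<epsilon> * D \<le> 1 / 2"
    by (simp add: \<epsilon>_def exp_minus field_simps)
  \<comment> \<open>Half of \<open>B\<close> pays for the tail at the cut, which lies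
    \<open>Suc k\<close> doublings before the target; the other half pays for the contracted
    previous bound, since \<open>\<epsilon> * D \<le> 1 / 2\<close>.\<close>
  define B where "B = 2 * D ^ Suc k"
  have "1 \<le> D ^ Suc k" using D by (intro one_le_power) auto
  then have B: "B \<ge> 1" by (simp add: B_def)
  have dyadic: "moment (2 ^ j - 1) \<le> B * T j" for j
  proof (induction j)
    case (Suc j)
    show ?case
    proof (cases "Suc j \<le> k")
      \<comment> \<open>In the first \<open>k\<close> steps the cut point would be negative; the
        total mass and at most \<open>k\<close> doublings suffice.\<close>
      case True
      have "moment (2 ^ Suc j - 1) \<le> T 0"
        using weight_moment_antimono[of 0] by (simp add: T_def weight_moment_0)
      also have "\<dots> \<le> D ^ Suc j * T (Suc j)" using Tk[of 0 "Suc j"] by simp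
      also have "\<dots> \<le> B * T (Suc j)"
      proof (intro mult_right_mono Tnn)
        have "D ^ Suc j \<le> D ^ Suc k" using True D by (intro power_increasing) auto
        also have "\<dots> \<le> B" using D by (simp add: B_def)
        finally show "D ^ Suc j \<le> B" .
      qed
      finally show ?thesis .
    next
      case False
      then have jk: "k \<le> j" by simp
      define s :: real where "s = 1 - 1 / 2 ^ (j - k)"
      have s: "0 \<le> s" "s \<le> 1" by (auto simp: s_def)
      have "s \<le> exp (- 1 / 2 ^ (j - k))"
        using exp_ge_add_one_self[of "- 1 / 2 ^ (j - k)"] by (simp add: s_def)
      then have "s ^ 2 ^ j \<le> exp (- 1 / 2 ^ (j - k)) ^ 2 ^ j"
        using s by (intro power_mono) auto
      also have "\<dots> = exp (- ((2 ^ j) / 2 ^ (j - k)))"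
        by (simp add: exp_of_nat_mult[symmetric])
      also have "\<dots> = \<epsilon>"
        using jk by (simp add: \<epsilon>_def power_diff)
      finally have s\<epsilon>: "s ^ 2 ^ j \<le> \<epsilon>" .
      have m: "2 ^ Suc j - 1 = (2 ^ j - 1) + (2 ^ j :: nat)"
        using one_le_power[of "2::nat" j] by simp
      have "moment (2 ^ Suc j - 1) \<le> s ^ 2 ^ j * moment (2 ^ j - 1) + tail s"
        unfolding m by (rule weight_moment_add_le[OF s])
      also have "\<dots> \<le> \<epsilon> * (B * T j) + T (j - k)"
        using s\<epsilon> Suc less_imp_le[OF weight_moment_pos]
        by (intro add_mono mult_mono) (auto simp: s_def T_def \<epsilon>_def)
      also have "\<dots> \<le> \<epsilon> * (B * (D * T (Suc j))) + D ^ Suc k * T (Suc j)"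
        using T1[of j] Tk[of "j - k" "Suc k"] jk B
        by (intro add_mono mult_left_mono) (auto simp: \<epsilon>_def Suc_diff_le)
      also have "\<dots> = (\<epsilon> * D) * (B * T (Suc j)) + D ^ Suc k * T (Suc j)"
        by simp
      also have "\<dots> \<le> (1 / 2) * (B * T (Suc j)) + D ^ Suc k * T (Suc j)"
        using \<epsilon> B Tnn[of "Suc j"] by (intro add_mono mult_right_mono) auto
      also have "\<dots> = B * T (Suc j)" by (simp add: B_def)
      finally show ?thesis .
    qed
  next
    case 0
    have "1 * T 0 \<le> B * T 0" using B Tnn by (intro mult_right_mono)
    then show ?case by (simp add: T_def weight_moment_0)
  qed
  show ?thesis
  proof (rule that[of "B * D"])
    show "1 \<le> B * D" using B D by (metis less_imp_le mult_mono' mult_1 zero_le_one)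
    fix n :: nat
    \<comment> \<open>\<open>2 ^ j - 1\<close> is the largest dyadic order not above
      \<open>n\<close>. Then \<open>node n\<close> lies below the next dyadic radius, which costs
      one more doubling.\<close>
    obtain j where j: "2 ^ j \<le> Suc n" "Suc n < 2 ^ Suc j"
      using ex_power_ivl1[of 2 "Suc n"] by auto
    have "moment n \<le> moment (2 ^ j - 1)"
      using j by (intro weight_moment_antimono) auto
    also have "\<dots> \<le> B * T j" by (rule dyadic)
    also have "\<dots> \<le> B * (D * T (Suc j))" using T1 B by (intro mult_left_mono) auto
    also have "T (Suc j) \<le> tail (node n)"
      unfolding T_def
    proof (rule weight_tail_antimono[OF node_bounds(1)])
      have "real (Suc n) < 2 ^ Suc j" using j(2) by (metis of_nat_less_iff of_nat_numeral of_nat_power)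
      then show "node n \<le> 1 - 1 / 2 ^ Suc j"
        unfolding node_def by (intro diff_mono divide_left_mono) auto
    qed
    then have "B * (D * T (Suc j)) \<le> B * D * tail (node n)" using B D by simp
    finally show "moment n \<le> B * D * tail (node n)" .
  qed
qed

end

section \<open>Power series\<close>

text \<open>These are the coefficients of \<open>1 - w\<close> times the power series with
  coefficients \<open>b\<close>; the entry before the first counts as 0.\<close>

definition backward_diff :: "(nat \<Rightarrow> real) \<Rightarrow> nat \<Rightarrow> real" where
  "backward_diff b n = b n - (if n = 0 then 0 else b (n - 1))"

text \<open>Multiplication by \<open>1 - w\<close> subtracts the shifted series. The field is left
  general because the identity is applied both at a complex point and at its modulus.\<close>

lemma abel_sums:
  fixes w :: "'a :: {real_normed_field, banach}"
  assumes "summable (\<lambda>n. of_real (b n) * w ^ n)"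
  shows "(\<lambda>n. of_real (backward_diff b n) * w ^ n) sums ((1 - w) * (\<Sum>n. of_real (b n) * w ^ n))"
proof -
  define a where "a n = of_real (b n) * w ^ n" for n
  have a: "a sums suminf a" using assms by (simp add: a_def[abs_def] summable_sums)
  define a' where "a' n = (if n = 0 then 0 else w * a (n - 1))" for n
  have "(\<lambda>n. a' (Suc n)) sums (w * suminf a)"
    using sums_mult[OF a, of w] by (simp add: a'_def)
  then have "a' sums (w * suminf a)"
    by (subst (asm) sums_Suc_iff) (simp add: a'_def)
  from sums_diff[OF a this]
  have "(\<lambda>n. a n - a' n) sums ((1 - w) * suminf a)" by (simp add: algebra_simps)
  moreover have "a n - a' n = of_real (backward_diff b n) * w ^ n" for n
    by (cases n) (simp_all add: a_def a'_def backward_diff_def algebra_simps)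
  ultimately show ?thesis by (simp add: a_def[abs_def])
qed

text \<open>The differences of a nonnegative increasing sequence are nonnegative, so the triangle
  inequality turns the differenced series at \<open>w\<close> into the one at \<open>cmod w\<close>,
  and the identity read backwards there produces the factor \<open>1 - cmod w\<close>.\<close>

lemma abel_norm_le:
  fixes w :: complex and b :: "nat \<Rightarrow> real"
  assumes "incseq b" "0 \<le> b 0" and sm: "summable (\<lambda>n. b n * cmod w ^ n)"
  shows "cmod (1 - w) * cmod (\<Sum>n. of_real (b n) * w ^ n) \<le> (1 - cmod w) * (\<Sum>n. b n * cmod w ^ n)"
proof -
  have nn: "0 \<le> b n" for n using assms(1,2) by (meson incseqD le0 order_trans)
  have nd: "0 \<le> backward_diff b n" for n
    using assms(1,2) by (auto simp: backward_diff_def dest: incseqD[of b "n - 1" n])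
  have "summable (\<lambda>n. of_real (b n) * w ^ n)"
    by (rule summable_norm_cancel) (use sm nn in \<open>simp add: norm_mult norm_power\<close>)
  note 1 = abel_sums[OF this]
  have "summable (\<lambda>n. of_real (b n) * (cmod w) ^ n)" using sm by simp
  note 2 = abel_sums[OF this]
  have "cmod ((1 - w) * (\<Sum>n. of_real (b n) * w ^ n)) = cmod (\<Sum>n. of_real (backward_diff b n) * w ^ n)"
    using sums_unique[OF 1] by simp
  also have "\<dots> \<le> (\<Sum>n. backward_diff b n * cmod w ^ n)"
    using sums_summable[OF 2] by (intro norm_suminf_le) (auto simp: norm_mult norm_power nd)
  also have "\<dots> = (1 - cmod w) * (\<Sum>n. b n * cmod w ^ n)"
    using sums_unique[OF 2] by simp
  finally show ?thesis by (simp add: norm_mult)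
qed

section \<open>Power series with coefficients \<open>(n + 1) powr \<gamma>\<close>\<close>

lemma divide_powr_minus:
  fixes y c e :: real
  assumes "0 \<le> y" "0 < c"
  shows "(y / c) powr (- e - 1) = c powr (e + 1) * y powr (- e - 1)"
    "(y / c) powr (- e) = c powr e * y powr (- e)"
proof -
  have "(y / c) powr (- d) = c powr d * y powr (- d)" for d
    using assms by (simp add: powr_divide powr_minus field_simps)
  from this[of e] this[of "e + 1"]
  show "(y / c) powr (- e - 1) = c powr (e + 1) * y powr (- e - 1)"
    "(y / c) powr (- e) = c powr e * y powr (- e)" by simp_all
qed

text \<open>Series at \<open>x\<close> are estimated through \<open>x ^ n = y ^ n * y ^ n\<close>
  with \<open>y = sqrt x\<close>: one factor controls the coefficient, the other is summed as a
  geometric series. The price is only the passage from \<open>1 - y\<close> to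
  \<open>1 - x\<close>.\<close>

lemma one_minus_sqrt_ge:
  assumes "0 \<le> x" "x < 1"
  shows "(1 - x) / 2 \<le> 1 - sqrt x" "sqrt x < 1"
proof -
  show 1: "sqrt x < 1" using assms by simp
  have "1 - x = (1 - sqrt x) * (1 + sqrt x)" using assms by (simp add: algebra_simps)
  also have "\<dots> \<le> (1 - sqrt x) * 2" using assms 1 by (intro mult_left_mono) auto
  finally show "(1 - x) / 2 \<le> 1 - sqrt x" by simp
qed

text \<open>By the mean value theorem the difference is \<gamma> times an intermediate value of
  \<open>s powr (\<gamma> - 1)\<close>. The constant collects three cases: 1 for
  \<open>n = 0\<close>, where the difference is 1, \<open>1 / \<gamma>\<close> if this power
  decreases in \<open>s\<close>, and \<open>2 powr (\<gamma> - 1) / \<gamma>\<close> if it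
  increases.\<close>

lemma powr_diff_bound:
  fixes \<gamma> :: real
  assumes "0 < \<gamma>"
  obtains C where "C > 0"
    "\<And>n. real (Suc n) powr (\<gamma> - 1) \<le> C * backward_diff (\<lambda>n. real (Suc n) powr \<gamma>) n"
proof (rule that[of "1 + 1 / \<gamma> + 2 powr (\<gamma> - 1) / \<gamma>"])
  let ?C = "1 + 1 / \<gamma> + 2 powr (\<gamma> - 1) / \<gamma>"
  show "0 < ?C" using assms by (simp add: add_pos_nonneg)
  fix n :: nat
  show "real (Suc n) powr (\<gamma> - 1) \<le> ?C * backward_diff (\<lambda>n. real (Suc n) powr \<gamma>) n"
  proof (cases "n = 0")
    case True
    then show ?thesis using assms by (simp add: backward_diff_def)
  next
    case False
    then have n: "real n \<ge> 1" by simp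
    have "\<exists>\<xi>. real n < \<xi> \<and> \<xi> < real (Suc n) \<and>
      real (Suc n) powr \<gamma> - real n powr \<gamma> = (real (Suc n) - real n) * (\<gamma> * \<xi> powr (\<gamma> - 1))"
      by (rule MVT2) (use n in \<open>auto intro!: derivative_eq_intros\<close>)
    then obtain \<xi> where \<xi>: "real n < \<xi>" "\<xi> < real (Suc n)"
      "real (Suc n) powr \<gamma> - real n powr \<gamma> = \<gamma> * \<xi> powr (\<gamma> - 1)" by auto
    have "real (Suc n) powr (\<gamma> - 1) \<le> (1 + 2 powr (\<gamma> - 1)) * \<xi> powr (\<gamma> - 1)"
    proof (cases "\<gamma> \<ge> 1")
      case True
      have "real (Suc n) powr (\<gamma> - 1) \<le> (2 * \<xi>) powr (\<gamma> - 1)"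
        using True n \<xi> by (intro powr_mono2) auto
      also have "\<dots> = 2 powr (\<gamma> - 1) * \<xi> powr (\<gamma> - 1)" using \<xi> n by (simp add: powr_mult)
      also have "\<dots> \<le> (1 + 2 powr (\<gamma> - 1)) * \<xi> powr (\<gamma> - 1)" by (intro mult_right_mono) auto
      finally show ?thesis .
    next
      case False
      have "real (Suc n) powr (\<gamma> - 1) \<le> \<xi> powr (\<gamma> - 1)"
        using False n \<xi> by (intro powr_mono2') auto
      also have "1 * \<xi> powr (\<gamma> - 1) \<le> (1 + 2 powr (\<gamma> - 1)) * \<xi> powr (\<gamma> - 1)"
        by (intro mult_right_mono) auto
      finally show ?thesis by simp
    qed
    also have "\<dots> \<le> (\<gamma> * ?C) * \<xi> powr (\<gamma> - 1)"
      using assms by (intro mult_right_mono) (auto simp: field_simps)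
    also have "\<dots> = ?C * backward_diff (\<lambda>n. real (Suc n) powr \<gamma>) n"
      using \<xi>(3) False by (simp add: backward_diff_def)
    finally show ?thesis .
  qed
qed

text \<open>One factor \<open>y ^ n\<close>, \<open>y = sqrt r\<close>, turns
  \<open>(n + 1) powr \<gamma>\<close> into \<open>(1 - y) powr (- \<gamma>)\<close> by
  \<open>powr_power_bound\<close>; summing the other contributes the remaining exponent -1.\<close>

lemma powr_weighted_geometric:
  fixes \<gamma> :: real
  assumes "0 \<le> \<gamma>"
  obtains C where "C > 0"
    "\<And>r. 0 \<le> r \<Longrightarrow> r < 1 \<Longrightarrow> summable (\<lambda>n. real (Suc n) powr \<gamma> * r ^ n)"
    "\<And>r. 0 \<le> r \<Longrightarrow> r < 1 \<Longrightarrow> (\<Sum>n. real (Suc n) powr \<gamma> * r ^ n) \<le> C * (1 - r) powr (- \<gamma> - 1)"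
proof -
  obtain C where C: "C > 0"
    "\<And>x n. 0 \<le> x \<Longrightarrow> x \<le> 1 \<Longrightarrow> (real (Suc n) * (1 - x)) powr \<gamma> * x ^ n \<le> C"
    using powr_power_bound[OF assms] by blast
  have main: "summable (\<lambda>n. real (Suc n) powr \<gamma> * r ^ n) \<and>
      (\<Sum>n. real (Suc n) powr \<gamma> * r ^ n) \<le> C * 2 powr (\<gamma> + 1) * (1 - r) powr (- \<gamma> - 1)"
    if r: "0 \<le> r" "r < 1" for r
  proof -
    define y where "y = sqrt r"
    have y: "0 \<le> y" "y < 1" "(1 - r) / 2 \<le> 1 - y" "r = y ^ 2"
      using r one_minus_sqrt_ge[OF r] by (auto simp: y_def)
    have term_le: "real (Suc n) powr \<gamma> * r ^ n \<le> C * (1 - y) powr (- \<gamma>) * y ^ n" for n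
    proof -
      have "(real (Suc n) powr \<gamma> * (1 - y) powr \<gamma>) * y ^ n \<le> C"
        using C(2)[of y n] y by (simp add: powr_mult)
      then have "(real (Suc n) powr \<gamma> * (1 - y) powr \<gamma>) * y ^ n * ((1 - y) powr (- \<gamma>) * y ^ n)
          \<le> C * ((1 - y) powr (- \<gamma>) * y ^ n)"
        using y by (intro mult_right_mono) auto
      moreover have 1: "(1 - y) powr \<gamma> * (1 - y) powr (- \<gamma>) = 1"
        using y by (simp flip: powr_add)
      have "(real (Suc n) powr \<gamma> * (1 - y) powr \<gamma>) * y ^ n * ((1 - y) powr (- \<gamma>) * y ^ n)
          = real (Suc n) powr \<gamma> * ((1 - y) powr \<gamma> * (1 - y) powr (- \<gamma>)) * (y ^ n * y ^ n)"
        by (simp only: mult_ac)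
      also have "\<dots> = real (Suc n) powr \<gamma> * r ^ n"
        unfolding 1 by (simp add: y(4) power2_eq_square power_mult_distrib)
      ultimately show ?thesis by (simp only: mult_ac)
    qed
    have geo: "summable (\<lambda>n. C * (1 - y) powr (- \<gamma>) * y ^ n)"
      using y by (intro summable_mult) (simp add: summable_geometric)
    have sm: "summable (\<lambda>n. real (Suc n) powr \<gamma> * r ^ n)"
      by (rule summable_comparison_test'[OF geo, of 0]) (use term_le r in auto)
    have "(\<Sum>n. real (Suc n) powr \<gamma> * r ^ n) \<le> (\<Sum>n. C * (1 - y) powr (- \<gamma>) * y ^ n)"
      by (rule suminf_le[OF term_le sm geo])
    also have "\<dots> = C * (1 - y) powr (- \<gamma>) * (1 / (1 - y))"
      using y by (subst suminf_mult) (auto simp: summable_geometric suminf_geometric)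
    also have "\<dots> = C * (1 - y) powr (- \<gamma> - 1)"
      using y by (simp add: powr_diff)
    also have "\<dots> \<le> C * ((1 - r) / 2) powr (- \<gamma> - 1)"
      using C y r assms by (intro mult_left_mono powr_mono2') auto
    also have "((1 - r) / 2) powr (- \<gamma> - 1) = 2 powr (\<gamma> + 1) * (1 - r) powr (- \<gamma> - 1)"
      using r by (intro divide_powr_minus) auto
    finally show ?thesis using sm by (simp only: mult.assoc)
  qed
  show ?thesis
    by (rule that[of "C * 2 powr (\<gamma> + 1)"]) (use C main in auto)
qed

text \<open>Summation by parts reduces the exponent \<open>\<gamma> - 1\<close>, possibly negative, to the positive
  exponent \<open>\<gamma>\<close>.\<close>

lemma powr_geometric_bound:
  fixes \<gamma> :: real
  assumes "0 < \<gamma>"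
  obtains C where "C > 0"
    "\<And>r. 0 \<le> r \<Longrightarrow> r < 1 \<Longrightarrow> summable (\<lambda>n. real (Suc n) powr (\<gamma> - 1) * r ^ n)"
    "\<And>r. 0 \<le> r \<Longrightarrow> r < 1 \<Longrightarrow> (\<Sum>n. real (Suc n) powr (\<gamma> - 1) * r ^ n) \<le> C * (1 - r) powr (- \<gamma>)"
proof -
  obtain C0 where C0: "C0 > 0"
    "\<And>n. real (Suc n) powr (\<gamma> - 1) \<le> C0 * backward_diff (\<lambda>n. real (Suc n) powr \<gamma>) n"
    using powr_diff_bound[OF assms] by blast
  obtain C1 where C1: "C1 > 0"
    "\<And>r. 0 \<le> r \<Longrightarrow> r < 1 \<Longrightarrow> summable (\<lambda>n. real (Suc n) powr \<gamma> * r ^ n)"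
    "\<And>r. 0 \<le> r \<Longrightarrow> r < 1 \<Longrightarrow> (\<Sum>n. real (Suc n) powr \<gamma> * r ^ n) \<le> C1 * (1 - r) powr (- \<gamma> - 1)"
    using powr_weighted_geometric[OF less_imp_le[OF assms]] by blast
  have main: "summable (\<lambda>n. real (Suc n) powr (\<gamma> - 1) * r ^ n) \<and>
      (\<Sum>n. real (Suc n) powr (\<gamma> - 1) * r ^ n) \<le> C0 * C1 * (1 - r) powr (- \<gamma>)"
    if r: "0 \<le> r" "r < 1" for r
  proof -
    let ?d = "backward_diff (\<lambda>n. real (Suc n) powr \<gamma>)"
    have S: "(\<lambda>n. ?d n * r ^ n) sums ((1 - r) * (\<Sum>n. real (Suc n) powr \<gamma> * r ^ n))"
      using abel_sums[of "\<lambda>n. real (Suc n) powr \<gamma>" r] C1(2)[OF r] by simp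
    then have S0: "(\<lambda>n. C0 * ?d n * r ^ n) sums (C0 * ((1 - r) * (\<Sum>n. real (Suc n) powr \<gamma> * r ^ n)))"
      using sums_mult[OF S, of C0] by (simp add: mult.assoc)
    have le: "real (Suc n) powr (\<gamma> - 1) * r ^ n \<le> C0 * ?d n * r ^ n" for n
      using C0(2)[of n] r by (intro mult_right_mono) auto
    have sm: "summable (\<lambda>n. real (Suc n) powr (\<gamma> - 1) * r ^ n)"
      by (rule summable_comparison_test'[OF sums_summable[OF S0], of 0]) (use le r in auto)
    have "(\<Sum>n. real (Suc n) powr (\<gamma> - 1) * r ^ n) \<le> C0 * ((1 - r) * (\<Sum>n. real (Suc n) powr \<gamma> * r ^ n))"
      using suminf_le[OF le sm sums_summable[OF S0]] sums_unique[OF S0] by simp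
    also have "\<dots> \<le> C0 * ((1 - r) * (C1 * (1 - r) powr (- \<gamma> - 1)))"
      using C0 r C1(3)[OF r] by (intro mult_left_mono) auto
    also have "\<dots> = C0 * C1 * ((1 - r) powr 1 * (1 - r) powr (- \<gamma> - 1))"
      using r by simp
    also have "(1 - r) powr 1 * (1 - r) powr (- \<gamma> - 1) = (1 - r) powr (- \<gamma>)"
      by (simp only: powr_add[symmetric]) simp
    finally show ?thesis using sm by simp
  qed
  show ?thesis
    by (rule that[of "C0 * C1"]) (use C0 C1 main in auto)
qed

section \<open>Kernel estimates\<close>

definition real_kernel :: "(complex \<Rightarrow> real) \<Rightarrow> real \<Rightarrow> real" where
  "real_kernel \<omega> x = (\<Sum>n. x ^ n / (2 * weight_moment \<omega> (2 * n + 1)))"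

text \<open>Only the product of \<open>t\<close> and \<open>z\<close> matters. The parameter value 1
  does not occur in the integrals; it merely names the kernel as a function of one complex
  variable.\<close>

lemma kernel_eq: "kernel \<omega> t z = kernel \<omega> 1 (of_real t * z)"
  by (simp add: kernel_def)

context Dhat_weight
begin

text \<open>The kernel has moments of order \<open>2 * n + 1\<close>, and the midpoint between
  \<open>node n\<close> and 1 is exactly \<open>node (2 * n + 1)\<close>, so one doubling compares
  them with moments of order \<open>n\<close>.\<close>

lemma weight_moment_doubling:
  obtains C where "C \<ge> 1" "\<And>n. moment n \<le> C * moment (2 * n + 1)"
proof -
  obtain D where D: "D > 1" "\<And>r. 0 \<le> r \<Longrightarrow> r < 1 \<Longrightarrow> tail r \<le> D * tail ((1 + r) / 2)"
    using weight_tail_doubling by blast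
  obtain B where B: "B \<ge> 1" "\<And>n. moment n \<le> B * tail (node n)"
    using weight_moment_le_tail by blast
  show ?thesis
  proof (rule that[of "B * (D * 3)"])
    have "1 * (1 * 1) \<le> B * (D * 3)" using B D by (intro mult_mono) auto
    then show "1 \<le> B * (D * 3)" by simp
    fix n
    have "(1 + node n) / 2 = node (2 * n + 1)" by (simp add: node_def field_simps)
    then have "tail (node n) \<le> D * tail (node (2 * n + 1))"
      using D(2)[of "node n"] node_bounds[of n] by simp
    also have "\<dots> \<le> D * (3 * moment (2 * n + 1))"
      using D weight_tail_le_moment by (intro mult_left_mono) auto
    finally have "B * tail (node n) \<le> B * (D * (3 * moment (2 * n + 1)))"
      using B by (intro mult_left_mono) auto
    with B(2)[of n] show "moment n \<le> B * (D * 3) * moment (2 * n + 1)"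
      by (simp add: mult.assoc)
  qed
qed

text \<open>If \<open>node n \<le> x\<close>, both factors are monotone in the right direction.
  Otherwise the tail at \<open>x\<close> exceeds the one at \<open>node n\<close> by at most a power
  of \<open>u = (n + 1) * (1 - x)\<close>, and \<open>x ^ n\<close> absorbs it. The case \<alpha> =
  -1 serves the upper kernel bound, the case \<alpha> = \<beta> the necessity of the moment
  conditions.\<close>

lemma power_le_kernel_size:
  assumes "\<alpha> \<ge> -1"
  obtains C where "C > 0"
    "\<And>x n. 0 \<le> x \<Longrightarrow> x < 1 \<Longrightarrow>
       x ^ n * real (Suc n) powr (\<alpha> + 1) / moment n \<le> C * \<Phi> \<alpha> x"
proof -
  obtain D b where D: "D \<ge> 1" "b \<ge> 0"
    "\<And>r t. 0 \<le> r \<Longrightarrow> r \<le> t \<Longrightarrow> t < 1 \<Longrightarrow>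
       tail r \<le> D * ((1 - r) / (1 - t)) powr b * tail t"
    using weight_tail_power_doubling by blast
  \<comment> \<open>The exponent adds up both powers of \<open>u\<close>:
    \<open>\<alpha> + 1\<close> from \<open>real (Suc n) powr (\<alpha> + 1)\<close> and
    \<open>b\<close> from the tails.\<close>
  obtain E where E: "E > 0"
    "\<And>x n. 0 \<le> x \<Longrightarrow> x \<le> 1 \<Longrightarrow> (real (Suc n) * (1 - x)) powr (\<alpha> + 1 + b) * x ^ n \<le> E"
    using powr_power_bound[of "\<alpha> + 1 + b"] D(2) assms by auto
  show ?thesis
  proof (rule that[of "3 + 3 * (D * E)"])
    show "0 < 3 + 3 * (D * E)" using D E by (simp add: add_pos_pos)
    fix x :: real and n :: nat
    assume x: "0 \<le> x" "x < 1"
    define N where "N = real (Suc n)"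
    have N: "N \<ge> 1" by (simp add: N_def)
    note tp = weight_tail_pos[OF x]
    note mp = weight_moment_pos[of n]
    note ml = weight_tail_le_moment[of n]
    have e: "- \<alpha> - 1 = - (\<alpha> + 1)" by simp
    show "x ^ n * real (Suc n) powr (\<alpha> + 1) / moment n \<le> (3 + 3 * (D * E)) * \<Phi> \<alpha> x"
    proof (cases "node n \<le> x")
      case True
      have "tail x \<le> tail (node n)"
        by (rule weight_tail_antimono[OF node_bounds(1) True])
      also note ml
      finally have 1: "1 / moment n \<le> 3 / tail x"
        using tp mp by (simp add: field_simps)
      have "1 - x \<le> 1 / N" using True one_minus_node[of n] by (simp add: N_def)
      then have "(1 / N) powr (- \<alpha> - 1) \<le> (1 - x) powr (- \<alpha> - 1)"
        using assms x N by (intro powr_mono2') auto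
      then have 2: "N powr (\<alpha> + 1) \<le> (1 - x) powr (- \<alpha> - 1)"
      proof -
        have "(1 / N) powr (- e) = N powr e" for e
          using N by (simp add: powr_divide powr_minus)
        from this[of "\<alpha> + 1"] \<open>(1 / N) powr (- \<alpha> - 1) \<le> (1 - x) powr (- \<alpha> - 1)\<close> show ?thesis
          by simp
      qed
      have "x ^ n * N powr (\<alpha> + 1) * (1 / moment n)
          \<le> 1 * (1 - x) powr (- \<alpha> - 1) * (3 / tail x)"
        using x 1 2 mp by (intro mult_mono power_le_one) auto
      also have "\<dots> = 3 * \<Phi> \<alpha> x" by (simp add: kernel_size_def)
      also have "\<dots> \<le> (3 + 3 * (D * E)) * \<Phi> \<alpha> x"
        using D E kernel_size_pos[OF x] by (intro mult_right_mono) (auto simp: less_imp_le)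
      finally show ?thesis by (simp add: N_def)
    next
      case False
      define u where "u = N * (1 - x)"
      have u: "u > 0" using N x by (simp add: u_def)
      have "tail x \<le> D * ((1 - x) / (1 - node n)) powr b * tail (node n)"
        using False x node_bounds by (intro D(3)) auto
      also have "(1 - x) / (1 - node n) = u" by (simp add: one_minus_node u_def N_def)
      also have "D * u powr b * tail (node n) \<le> D * u powr b * (3 * moment n)"
        using D by (intro mult_left_mono ml) auto
      finally have "1 / moment n \<le> 3 * D * u powr b / tail x"
        using tp mp by (simp add: field_simps)
      then have "x ^ n * N powr (\<alpha> + 1) * (1 / moment n)
          \<le> x ^ n * N powr (\<alpha> + 1) * (3 * D * u powr b / tail x)"
        using x by (intro mult_left_mono) auto
      also have Npow: "N powr (\<alpha> + 1) = u powr (\<alpha> + 1) * (1 - x) powr (- \<alpha> - 1)"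
      proof -
        have "(1 - x) powr (\<alpha> + 1) * (1 - x) powr (- \<alpha> - 1) = 1"
          using x by (simp flip: powr_add)
        then show ?thesis using x N by (simp add: u_def powr_mult)
      qed
      also have "x ^ n * (u powr (\<alpha> + 1) * (1 - x) powr (- \<alpha> - 1)) * (3 * D * u powr b / tail x)
          = 3 * D * ((u powr (\<alpha> + 1) * u powr b) * x ^ n) * \<Phi> \<alpha> x"
        by (simp add: kernel_size_def mult_ac)
      also have "u powr (\<alpha> + 1) * u powr b = u powr (\<alpha> + 1 + b)"
        by (simp flip: powr_add)
      also have "3 * D * (u powr (\<alpha> + 1 + b) * x ^ n) * \<Phi> \<alpha> x \<le> 3 * D * E * \<Phi> \<alpha> x"
        using D E(2)[of x n] x kernel_size_pos[OF x]
        by (intro mult_right_mono mult_left_mono) (auto simp: u_def N_def less_imp_le)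
      also have "\<dots> \<le> (3 + 3 * (D * E)) * \<Phi> \<alpha> x"
        using kernel_size_pos[OF x] by (intro mult_right_mono) (auto simp: less_imp_le)
      finally show ?thesis unfolding N_def[symmetric] Npow by simp
    qed
  qed
qed

lemma ex_node_between:
  assumes "0 \<le> x" "x < 1"
  obtains n where "node n \<le> x" "1 / real (n + 2) \<le> 1 - x"
proof -
  define m where "m = nat \<lfloor>1 / (1 - x)\<rfloor>"
  have "1 \<le> 1 / (1 - x)" using assms by simp
  then have m: "1 \<le> m" "real m \<le> 1 / (1 - x)" "1 / (1 - x) < real m + 1"
    unfolding m_def by linarith+
  define n where "n = m - 1"
  have n: "m = Suc n" using m by (simp add: n_def)
  have "1 - x \<le> 1 / real m" using m assms by (simp add: field_simps)
  moreover have "1 / (real m + 1) \<le> 1 - x" using m assms by (simp add: field_simps)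
  ultimately show ?thesis
    by (intro that[of n]) (auto simp: node_def n add_ac)
qed

text \<open>A block of \<open>n + 1\<close> consecutive terms, of orders \<open>n\<close> to
  \<open>2 * n\<close> with \<open>1 - x\<close> about \<open>1 / (n + 1)\<close>, already has the
  right size. Partial sums keep convergence out of the statement.\<close>

lemma kernel_size_le_sum:
  assumes "\<alpha> > -1"
  obtains C where "C > 0"
    "\<And>x. 0 \<le> x \<Longrightarrow> x < 1 \<Longrightarrow>
       \<exists>M. \<Phi> \<alpha> x \<le> C * (\<Sum>n<M. x ^ n * real (Suc n) powr \<alpha> / moment n)"
proof -
  obtain D where D: "D > 1" "\<And>r. 0 \<le> r \<Longrightarrow> r < 1 \<Longrightarrow> tail r \<le> D * tail ((1 + r) / 2)"
    using weight_tail_doubling by blast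
  obtain B where B: "B \<ge> 1" "\<And>n. moment n \<le> B * tail (node n)"
    using weight_moment_le_tail by blast
  \<comment> \<open>For the orders \<open>k\<close> of the block the quotient of
    \<open>k + 1\<close> and \<open>n + 1\<close> lies between 1 and 2, so its power \<alpha> is at
    least \<open>c\<close> for either sign of \<alpha>.\<close>
  define c where "c = min 1 (2 powr \<alpha>)"
  have c: "0 < c" "c \<le> 1" "c \<le> 2 powr \<alpha>" by (auto simp: c_def)
  define C where "C = 2 powr (\<alpha> + 1) * (B * D) * (9 / c)"
  have Cpos: "C > 0" using B D c by (simp add: C_def)
  show ?thesis
  proof (rule that[OF Cpos])
    fix x :: real assume x: "0 \<le> x" "x < 1"
    obtain n where n: "node n \<le> x" "1 / real (n + 2) \<le> 1 - x"
      using ex_node_between[OF x] by blast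
    define N where "N = real (Suc n)"
    have N: "N \<ge> 1" by (simp add: N_def)
    note mp = weight_moment_pos
    have term_ge: "c / 9 * (N powr \<alpha> / moment n) \<le> x ^ k * real (Suc k) powr \<alpha> / moment k"
      if k: "n \<le> k" "k \<le> 2 * n" for k
    proof -
      have "(1 / 3) * (1 / 3) \<le> node n ^ n * node n ^ n"
        using node_power_ge[of n] by (intro mult_mono) auto
      also have "\<dots> = node n ^ (2 * n)" by (simp add: mult_2 power_add)
      also have "\<dots> \<le> node n ^ k" using k node_bounds[of n] by (intro power_decreasing) auto
      also have "\<dots> \<le> x ^ k" using n node_bounds by (intro power_mono) auto
      finally have 1: "1 / 9 \<le> x ^ k" by simp
      have 2: "c * N powr \<alpha> \<le> real (Suc k) powr \<alpha>"
      proof (cases "\<alpha> \<ge> 0")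
        case True
        have "c * N powr \<alpha> \<le> 1 * N powr \<alpha>" using c by (intro mult_right_mono) auto
        also have "\<dots> \<le> real (Suc k) powr \<alpha>"
          unfolding N_def using True k by (simp add: powr_mono2)
        finally show ?thesis .
      next
        case False
        have "c * N powr \<alpha> \<le> 2 powr \<alpha> * N powr \<alpha>" using c by (intro mult_right_mono) auto
        also have "\<dots> = (2 * N) powr \<alpha>" using N by (simp add: powr_mult)
        also have "\<dots> \<le> real (Suc k) powr \<alpha>"
          unfolding N_def using False k by (intro powr_mono2') auto
        finally show ?thesis .
      qed
      have 3: "1 / moment n \<le> 1 / moment k"
        using mp weight_moment_antimono[OF k(1)] by (intro divide_left_mono) auto
      have "(1 / 9) * (c * N powr \<alpha>) * (1 / moment n)
          \<le> x ^ k * real (Suc k) powr \<alpha> * (1 / moment k)"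
        using 1 2 3 c mp[of n] x by (intro mult_mono) auto
      then show ?thesis by (simp add: mult_ac)
    qed
    have "N * (c / 9 * (N powr \<alpha> / moment n))
        = (\<Sum>k\<in>{n..2 * n}. c / 9 * (N powr \<alpha> / moment n))"
      by (simp add: N_def)
    also have "\<dots> \<le> (\<Sum>k\<in>{n..2 * n}. x ^ k * real (Suc k) powr \<alpha> / moment k)"
      by (intro sum_mono term_ge) auto
    also have "\<dots> \<le> (\<Sum>k<2 * n + 1. x ^ k * real (Suc k) powr \<alpha> / moment k)"
      using x mp by (intro sum_mono2) (auto simp: less_imp_le)
    finally have sum_ge: "N * (c / 9 * (N powr \<alpha> / moment n)) \<le> \<dots>" .
    have "moment n \<le> B * tail (node n)" by (rule B)
    \<comment> \<open>The midpoint between \<open>node n\<close> and 1 already lies at or beyond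
      \<open>x\<close>, so one doubling suffices.\<close>
    also have "\<dots> \<le> B * (D * tail ((1 + node n) / 2))"
      using B node_bounds by (intro mult_left_mono D) auto
    also have "\<dots> \<le> B * (D * tail x)"
    proof (intro mult_left_mono weight_tail_antimono[OF x(1)])
      have "1 / (2 * N) \<le> 1 / real (n + 2)" unfolding N_def by (intro divide_left_mono) auto
      moreover have "(1 + node n) / 2 = 1 - 1 / (2 * N)"
        by (simp add: node_def N_def field_simps)
      ultimately show "x \<le> (1 + node n) / 2" using n(2) by linarith
    qed (use B D in auto)
    finally have "1 / tail x \<le> B * D * (1 / moment n)"
      using mp[of n] weight_tail_pos[OF x] by (simp add: field_simps)
    moreover have "(1 - x) powr (- \<alpha> - 1) \<le> 2 powr (\<alpha> + 1) * (N * N powr \<alpha>)"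
    proof -
      have "1 / (2 * N) \<le> 1 / real (n + 2)" unfolding N_def by (intro divide_left_mono) auto
      then have "(1 - x) powr (- \<alpha> - 1) \<le> (1 / (2 * N)) powr (- \<alpha> - 1)"
        using n(2) assms N by (intro powr_mono2') auto
      also have "\<dots> = (2 * N) powr (\<alpha> + 1)"
      proof -
        have "(1 / (2 * N)) powr (- e) = (2 * N) powr e" for e
          using N by (simp add: powr_divide powr_minus)
        from this[of "\<alpha> + 1"] show ?thesis by simp
      qed
      also have "\<dots> = 2 powr (\<alpha> + 1) * (N * N powr \<alpha>)" using N by (simp add: powr_mult powr_add)
      finally show ?thesis .
    qed
    ultimately have "(1 - x) powr (- \<alpha> - 1) * (1 / tail x)
        \<le> (2 powr (\<alpha> + 1) * (N * N powr \<alpha>)) * (B * D * (1 / moment n))"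
      using N weight_tail_pos[OF x] by (intro mult_mono) auto
    also have "\<dots> = C * (N * (c / 9 * (N powr \<alpha> / moment n)))"
      using c by (simp add: C_def)
    also have "\<dots> \<le> C * (\<Sum>k<2 * n + 1. x ^ k * real (Suc k) powr \<alpha> / moment k)"
      using Cpos sum_ge by (intro mult_left_mono) auto
    finally have "\<Phi> \<alpha> x \<le> C * (\<Sum>k<2 * n + 1. x ^ k * real (Suc k) powr \<alpha> / moment k)"
      unfolding kernel_size_def by simp
    then show "\<exists>M. \<Phi> \<alpha> x \<le> C * (\<Sum>n<M. x ^ n * real (Suc n) powr \<alpha> / moment n)" ..
  qed
qed

text \<open>With \<open>y = sqrt x\<close>, the term bound for \<alpha> = -1 makes
  \<open>y ^ n / moment n\<close> at most a constant over the tail at \<open>y\<close>; the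
  remaining powers \<open>y ^ n\<close> sum to \<open>1 / (1 - y)\<close>. One doubling returns from
  \<open>y\<close> to \<open>x\<close>, because \<open>y \<le> (1 + x) / 2\<close>.\<close>

lemma real_kernel_upper:
  obtains C where "C > 0"
    "\<And>x. 0 \<le> x \<Longrightarrow> x < 1 \<Longrightarrow> summable (\<lambda>n. x ^ n / (2 * moment (2 * n + 1)))"
    "\<And>x. 0 \<le> x \<Longrightarrow> x < 1 \<Longrightarrow> real_kernel \<omega> x \<le> C * \<Phi> 0 x"
proof -
  obtain A where A: "A \<ge> 1" "\<And>n. moment n \<le> A * moment (2 * n + 1)"
    using weight_moment_doubling by blast
  obtain E where E: "E > 0"
    "\<And>x n. 0 \<le> x \<Longrightarrow> x < 1 \<Longrightarrow>
       x ^ n * real (Suc n) powr (-1 + 1) / moment n \<le> E * \<Phi> (-1) x"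
    using power_le_kernel_size[of "-1"] by auto
  obtain D where D: "D > 1" "\<And>r. 0 \<le> r \<Longrightarrow> r < 1 \<Longrightarrow> tail r \<le> D * tail ((1 + r) / 2)"
    using weight_tail_doubling by blast
  have main: "summable (\<lambda>n. x ^ n / (2 * moment (2 * n + 1))) \<and>
      real_kernel \<omega> x \<le> A * E * D * \<Phi> 0 x" if x: "0 \<le> x" "x < 1" for x
  proof -
    define y where "y = sqrt x"
    have y: "0 \<le> y" "y < 1" "(1 - x) / 2 \<le> 1 - y" "x = y ^ 2"
      using x one_minus_sqrt_ge[OF x] by (auto simp: y_def)
    define q where "q = A * E / (2 * tail y)"
    have term_le: "x ^ n / (2 * moment (2 * n + 1)) \<le> q * y ^ n" for n
    proof -
      note mp = weight_moment_pos
      have "1 / moment (2 * n + 1) \<le> A * (1 / moment n)"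
        using A(2)[of n] mp[of n] mp[of "2 * n + 1"] by (simp add: field_simps)
      then have "y ^ n * (1 / moment (2 * n + 1)) \<le> y ^ n * (A * (1 / moment n))"
        using y by (intro mult_left_mono) auto
      also have "\<dots> = A * (y ^ n / moment n)" by simp
      also have "y ^ n / moment n \<le> E / tail y"
        using E(2)[OF y(1,2), of n] y by (simp add: kernel_size_def)
      finally have "y ^ n * (1 / moment (2 * n + 1)) \<le> A * (E / tail y)"
        using A by simp
      then have "y ^ n * (y ^ n * (1 / moment (2 * n + 1))) / 2 \<le> y ^ n * (A * (E / tail y)) / 2"
        using y by (intro divide_right_mono mult_left_mono) auto
      moreover have "x ^ n = y ^ n * y ^ n" by (simp add: y(4) power2_eq_square power_mult_distrib)
      ultimately show ?thesis by (simp add: q_def mult_ac)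
    qed
    have geo: "summable (\<lambda>n. q * y ^ n)"
      using y by (intro summable_mult) (simp add: summable_geometric)
    have nn: "0 \<le> x ^ n / (2 * moment (2 * n + 1))" for n
      using x weight_moment_pos by (simp add: less_imp_le)
    have sm: "summable (\<lambda>n. x ^ n / (2 * moment (2 * n + 1)))"
      by (rule summable_comparison_test'[OF geo, of 0]) (use term_le nn in \<open>simp only: real_norm_def abs_of_nonneg\<close>)
    have "real_kernel \<omega> x \<le> (\<Sum>n. q * y ^ n)"
      unfolding real_kernel_def by (rule suminf_le[OF term_le sm geo])
    also have "\<dots> = q * (1 / (1 - y))"
      using y by (subst suminf_mult) (auto simp: summable_geometric suminf_geometric)
    also have "\<dots> = A * E * ((1 / (2 * (1 - y))) * (1 / tail y))"
      by (simp add: q_def mult_ac)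
    also have "\<dots> \<le> A * E * ((1 / (1 - x)) * (D * (1 / tail x)))"
    proof (intro mult_left_mono mult_mono)
      show "1 / (2 * (1 - y)) \<le> 1 / (1 - x)" using y x by (intro divide_left_mono) auto
      have "tail x \<le> D * tail ((1 + x) / 2)" by (rule D(2)[OF x])
      also have "\<dots> \<le> D * tail y"
        using D y by (intro mult_left_mono weight_tail_antimono) auto
      finally show "1 / tail y \<le> D * (1 / tail x)"
        using weight_tail_pos[OF x] weight_tail_pos[OF y(1,2)] by (simp add: field_simps)
    qed (use A E x weight_tail_nonneg[OF y(1)] in auto)
    also have "\<dots> = A * E * D * \<Phi> 0 x"
      using x by (simp add: kernel_size_def powr_minus field_simps)
    finally show ?thesis using sm by simp
  qed
  show ?thesis
    by (rule that[of "A * E * D"]) (use A E D main in auto)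
qed

text \<open>Moments decrease with the order, so passing from order \<open>n\<close> to
  \<open>2 * n + 1\<close> only enlarges the terms of the block estimate for \<alpha> = 0.\<close>

lemma real_kernel_lower:
  obtains C where "C > 0"
    "\<And>x. 0 \<le> x \<Longrightarrow> x < 1 \<Longrightarrow> \<Phi> 0 x \<le> C * real_kernel \<omega> x"
proof -
  obtain C where C: "C > 0"
    "\<And>x. 0 \<le> x \<Longrightarrow> x < 1 \<Longrightarrow>
       \<exists>M. \<Phi> 0 x \<le> C * (\<Sum>n<M. x ^ n * real (Suc n) powr 0 / moment n)"
    using kernel_size_le_sum[of 0] by auto
  obtain U where U:
    "\<And>x. 0 \<le> x \<Longrightarrow> x < 1 \<Longrightarrow> summable (\<lambda>n. x ^ n / (2 * moment (2 * n + 1)))"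
    using real_kernel_upper by blast
  show ?thesis
  proof (rule that[of "C * 2"])
    fix x :: real assume x: "0 \<le> x" "x < 1"
    note mp = weight_moment_pos
    obtain M where M: "\<Phi> 0 x \<le> C * (\<Sum>n<M. x ^ n * real (Suc n) powr 0 / moment n)"
      using C(2)[OF x] by blast
    have "(\<Sum>n<M. x ^ n * real (Suc n) powr 0 / moment n)
        \<le> (\<Sum>n<M. 2 * (x ^ n / (2 * moment (2 * n + 1))))"
    proof (intro sum_mono)
      fix n
      have "x ^ n * (1 / moment n) \<le> x ^ n * (1 / moment (2 * n + 1))"
        using x mp[of n] mp[of "2 * n + 1"] weight_moment_antimono[of n "2 * n + 1"]
        by (intro mult_left_mono divide_left_mono) auto
      then show "x ^ n * real (Suc n) powr 0 / moment n
          \<le> 2 * (x ^ n / (2 * moment (2 * n + 1)))" by simp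
    qed
    also have "\<dots> = 2 * (\<Sum>n<M. x ^ n / (2 * moment (2 * n + 1)))"
      by (simp add: sum_distrib_left)
    also have "\<dots> \<le> 2 * real_kernel \<omega> x"
      unfolding real_kernel_def using x mp
      by (intro mult_left_mono sum_le_suminf U) (auto simp: less_imp_le)
    finally have "C * (\<Sum>n<M. x ^ n * real (Suc n) powr 0 / moment n) \<le> C * (2 * real_kernel \<omega> x)"
      using C(1) by (intro mult_left_mono) auto
    with M show "\<Phi> 0 x \<le> C * 2 * real_kernel \<omega> x"
      by (simp only: mult.assoc)
  qed (use C in auto)
qed

lemma kernel_of_real:
  assumes "0 \<le> x" "x < 1"
  shows "kernel \<omega> 1 (of_real x) = of_real (real_kernel \<omega> x)"
proof -
  obtain U where U:
    "\<And>x. 0 \<le> x \<Longrightarrow> x < 1 \<Longrightarrow> summable (\<lambda>n. x ^ n / (2 * moment (2 * n + 1)))"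
    using real_kernel_upper by blast
  show ?thesis
    unfolding kernel_def real_kernel_def
    by (subst suminf_of_real[OF U[OF assms]]) simp
qed

text \<open>Two bounds for two purposes: the first sees the modulus only and serves sup norms, the
  second keeps the angle and serves circle means.\<close>

lemma kernel_norm_bounds:
  obtains C where "C > 0"
    "\<And>w. cmod w < 1 \<Longrightarrow> cmod (kernel \<omega> 1 w) \<le> C * \<Phi> 0 (cmod w)"
    "\<And>w. cmod w < 1 \<Longrightarrow> cmod (kernel \<omega> 1 w) \<le> C / (tail (cmod w) * cmod (1 - w))"
proof -
  obtain U where U: "U > 0"
    "\<And>x. 0 \<le> x \<Longrightarrow> x < 1 \<Longrightarrow> summable (\<lambda>n. x ^ n / (2 * moment (2 * n + 1)))"
    "\<And>x. 0 \<le> x \<Longrightarrow> x < 1 \<Longrightarrow> real_kernel \<omega> x \<le> U * \<Phi> 0 x"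
    using real_kernel_upper by blast
  note mp = weight_moment_pos
  show ?thesis
  proof (rule that[OF U(1)])
    fix w :: complex assume w: "cmod w < 1"
    have w0: "0 \<le> cmod w" by simp
    define b where "b n = 1 / (2 * moment (2 * n + 1))" for n
    have b: "incseq b" "0 \<le> b 0"
      using mp by (auto simp: b_def less_imp_le intro!: incseq_SucI divide_left_mono weight_moment_antimono)
    have bnn: "0 \<le> b n" for n using mp by (simp add: b_def less_imp_le)
    have sm: "summable (\<lambda>n. b n * cmod w ^ n)"
      using U(2)[OF w0 w] by (simp add: b_def)
    have k: "kernel \<omega> 1 w = (\<Sum>n. of_real (b n) * w ^ n)"
      by (simp add: kernel_def b_def)
    have rk: "real_kernel \<omega> (cmod w) = (\<Sum>n. b n * cmod w ^ n)"
      by (simp add: real_kernel_def b_def)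
    have "cmod (kernel \<omega> 1 w) \<le> real_kernel \<omega> (cmod w)"
      unfolding k rk
      by (intro norm_suminf_le sm) (simp add: norm_mult norm_power abs_of_nonneg bnn)
    also note U(3)[OF w0 w]
    finally show "cmod (kernel \<omega> 1 w) \<le> U * \<Phi> 0 (cmod w)" .
    have "cmod (1 - w) * cmod (kernel \<omega> 1 w) \<le> (1 - cmod w) * real_kernel \<omega> (cmod w)"
      unfolding k rk by (rule abel_norm_le[OF b sm])
    also have "\<dots> \<le> (1 - cmod w) * (U * \<Phi> 0 (cmod w))"
      using U(3)[OF w0 w] w by (intro mult_left_mono) auto
    also have "\<dots> = U / tail (cmod w)"
      using w by (simp add: kernel_size_def powr_minus)
    finally have "cmod (1 - w) * cmod (kernel \<omega> 1 w) \<le> U / tail (cmod w)" .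
    moreover have "cmod (1 - w) > 0" using w by auto
    ultimately show "cmod (kernel \<omega> 1 w) \<le> U / (tail (cmod w) * cmod (1 - w))"
      using weight_tail_pos[OF w0 w] by (simp add: field_simps)
  qed
qed

lemma kernel_holomorphic: "kernel \<omega> 1 holomorphic_on ball 0 1"
proof (rule power_series_holomorphic)
  fix w :: complex assume "w \<in> ball 0 1"
  then have w: "cmod w < 1" by simp
  obtain U where U:
    "\<And>x. 0 \<le> x \<Longrightarrow> x < 1 \<Longrightarrow> summable (\<lambda>n. x ^ n / (2 * moment (2 * n + 1)))"
    using real_kernel_upper by blast
  have "summable (\<lambda>n. (1 / of_real (2 * moment (2 * n + 1))) * (w - 0) ^ n)"
    by (rule summable_norm_cancel)
       (use U[OF norm_ge_zero w] weight_moment_pos in \<open>simp add: norm_mult norm_divide norm_power abs_of_pos\<close>)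
  then show "(\<lambda>n. (1 / of_real (2 * moment (2 * n + 1))) * (w - 0) ^ n) sums kernel \<omega> 1 w"
    by (simp add: kernel_def summable_sums)
qed

end

section \<open>Integral inequalities\<close>

text \<open>Young's inequality for the factorisation of \<open>u\<close> into
  \<open>(u powr p * l powr (1 - p)) powr (1 / p)\<close> and \<open>l powr (1 - 1 / p)\<close>. The
  parameter \<open>l\<close> is free and is chosen once the inequality is integrated.\<close>

lemma young_powr:
  fixes u :: real
  assumes "p > 1" "0 \<le> u" "0 < l"
  shows "u \<le> l powr (1 - p) / p * u powr p + l * (1 - 1 / p)"
proof (cases "u = 0")
  case False
  with assms have u: "u > 0" by simp
  have "(u powr p * l powr (1 - p)) powr (1 / p) * l powr (1 - 1 / p)
      \<le> 1 / p * (u powr p * l powr (1 - p)) + (1 - 1 / p) * l"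
    using assms u by (intro Youngs_inequality_0) auto
  also have "(u powr p * l powr (1 - p)) powr (1 / p) * l powr (1 - 1 / p)
      = u * (l powr ((1 - p) / p) * l powr (1 - 1 / p))"
    using assms u by (simp add: powr_mult powr_powr)
  also have "l powr ((1 - p) / p) * l powr (1 - 1 / p) = 1"
  proof -
    have "(1 - p) / p + (1 - 1 / p) = 0" using assms by (simp add: field_simps)
    then show ?thesis using assms by (simp flip: powr_add)
  qed
  finally show ?thesis by (simp add: mult_ac)
qed (use assms in auto)

text \<open>Hoelder's inequality in the form of a power mean with weight \<open>w\<close>, which
  avoids a conjugate exponent. The integral of \<open>w * u\<close> enters through a finite lower
  bound \<open>G\<close>, so that a part of it can be subtracted although the integrals are
  extended-valued.\<close>

lemma nn_integral_power_mean:
  assumes [measurable]: "w \<in> borel_measurable M" "u \<in> borel_measurable M"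
    and p: "p > 1" and u: "\<And>x. x \<in> space M \<Longrightarrow> 0 \<le> u x" and G: "0 \<le> G" and W: "0 \<le> W"
    and Gle: "ennreal G \<le> (\<integral>\<^sup>+ x. w x * ennreal (u x) \<partial>M)"
    and Wle: "(\<integral>\<^sup>+ x. w x \<partial>M) \<le> ennreal W"
  shows "ennreal (G powr p) \<le> ennreal (W powr (p - 1)) * (\<integral>\<^sup>+ x. w x * ennreal (u x powr p) \<partial>M)"
proof -
  let ?I = "\<integral>\<^sup>+ x. w x * ennreal (u x powr p) \<partial>M"
  consider "G = 0" | "G > 0" "W = 0" | "G > 0" "W > 0" "?I = \<infinity>" | J where "G > 0" "W > 0" "0 \<le> J" "?I = ennreal J"
    using G W by (cases ?I) (auto simp: less_le)
  then show ?thesis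
  proof cases
    case 2
    then have "(\<integral>\<^sup>+ x. w x \<partial>M) = 0" using Wle by simp
    then have "AE x in M. w x = 0" by (subst (asm) nn_integral_0_iff_AE) auto
    then have "(\<integral>\<^sup>+ x. w x * ennreal (u x) \<partial>M) = 0"
      by (subst nn_integral_0_iff_AE) auto
    with Gle 2 show ?thesis by simp
  next
    case 3
    then show ?thesis by (simp add: ennreal_mult_top)
  next
    case 4
    \<comment> \<open>With this choice, the second part of the Young bound is \<open>G - G / p\<close> and can be absorbed.\<close>
    define l where "l = G / W"
    have l: "l > 0" using 4 by (simp add: l_def)
    define c where "c = l powr (1 - p) / p"
    define d where "d = l * (1 - 1 / p)"
    have cd: "0 \<le> c" "0 \<le> d" using p l by (auto simp: c_def d_def)
    have "ennreal G \<le> (\<integral>\<^sup>+ x. w x * ennreal (u x) \<partial>M)" by fact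
    also have "\<dots> \<le> (\<integral>\<^sup>+ x. ennreal c * (w x * ennreal (u x powr p)) + ennreal d * w x \<partial>M)"
    proof (intro nn_integral_mono)
      fix x assume x: "x \<in> space M"
      have "ennreal (u x) \<le> ennreal (c * u x powr p + d)"
        unfolding c_def d_def using young_powr[OF p u[OF x] l] by (intro ennreal_leI) auto
      also have "\<dots> = ennreal c * ennreal (u x powr p) + ennreal d"
        using cd by (simp add: ennreal_mult)
      finally have "w x * ennreal (u x) \<le> w x * (ennreal c * ennreal (u x powr p) + ennreal d)"
        by (intro mult_left_mono) auto
      then show "w x * ennreal (u x) \<le> ennreal c * (w x * ennreal (u x powr p)) + ennreal d * w x"
        by (simp add: distrib_left mult_ac)
    qed
    also have "\<dots> = ennreal c * ?I + ennreal d * (\<integral>\<^sup>+ x. w x \<partial>M)"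
      by (simp add: nn_integral_add nn_integral_cmult)
    also have "\<dots> \<le> ennreal c * ennreal J + ennreal d * ennreal W"
      using 4 Wle by (intro add_mono mult_left_mono) auto
    also have "\<dots> = ennreal (c * J + d * W)"
      using cd 4 W by (simp add: ennreal_mult ennreal_plus)
    finally have "G \<le> c * J + d * W"
      using cd 4 by (subst (asm) ennreal_le_iff) auto
    also have "d * W = G - G / p" using 4 by (simp add: d_def l_def algebra_simps)
    finally have "G \<le> l powr (1 - p) * J" using p by (simp add: c_def field_simps)
    then have "G * G powr (p - 1) \<le> (l powr (1 - p) * J) * G powr (p - 1)"
      by (intro mult_right_mono) auto
    also have "\<dots> = (l powr (1 - p) * G powr (p - 1)) * J" by simp
    also have "G powr (p - 1) = l powr (p - 1) * W powr (p - 1)"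
      using 4 l by (simp add: l_def powr_divide)
    also have "l powr (1 - p) * (l powr (p - 1) * W powr (p - 1)) = W powr (p - 1)"
      using l by (simp add: mult.assoc[symmetric] flip: powr_add)
    also have "G * (l powr (p - 1) * W powr (p - 1)) = G powr p"
    proof -
      have "G powr p = G powr (1 + (p - 1))" by simp
      also have "\<dots> = G * G powr (p - 1)" using 4 by (subst powr_add) simp
      also have "G powr (p - 1) = l powr (p - 1) * W powr (p - 1)"
        using 4 l by (simp add: l_def powr_divide)
      finally show ?thesis by simp
    qed
    finally show ?thesis using 4 by (simp add: ennreal_leI flip: ennreal_mult)
  qed (use p in simp)
qed

text \<open>Writing \<open>g = v * (g / v)\<close> and applying the power mean with weight
  \<open>k x y * v y\<close> uses the bound \<open>kv\<close> and produces
  \<open>u x powr (p - 1)\<close>; after Tonelli's theorem the bound \<open>ku\<close> integrates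
  exactly this factor. The power \<open>p - 1\<close> of the weights takes the place of the usual
  conjugate exponent.\<close>

lemma schur_test:
  assumes "sigma_finite_measure M" "sigma_finite_measure N"
    and [measurable]: "case_prod k \<in> borel_measurable (M \<Otimes>\<^sub>M N)"
      "u \<in> borel_measurable M" "v \<in> borel_measurable N" "g \<in> borel_measurable N"
    and p: "p > 1" and A: "0 \<le> A" and B: "0 \<le> B"
    and u: "\<And>x. x \<in> space M \<Longrightarrow> 0 < u x" and v: "\<And>y. y \<in> space N \<Longrightarrow> 0 < v y"
    and g: "\<And>y. y \<in> space N \<Longrightarrow> 0 \<le> g y" and G: "\<And>x. x \<in> space M \<Longrightarrow> 0 \<le> G x"
    and kv: "\<And>x. x \<in> space M \<Longrightarrow> (\<integral>\<^sup>+ y. k x y * ennreal (v y) \<partial>N) \<le> ennreal (A * u x)"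
    and ku: "\<And>y. y \<in> space N \<Longrightarrow> (\<integral>\<^sup>+ x. k x y * ennreal (u x powr (p - 1)) \<partial>M) \<le> ennreal (B * v y powr (p - 1))"
    and Gle: "\<And>x. x \<in> space M \<Longrightarrow> ennreal (G x) \<le> (\<integral>\<^sup>+ y. k x y * ennreal (g y) \<partial>N)"
  shows "(\<integral>\<^sup>+ x. ennreal (G x powr p) \<partial>M) \<le> ennreal (A powr (p - 1) * B) * (\<integral>\<^sup>+ y. ennreal (g y powr p) \<partial>N)"
proof -
  interpret pair_sigma_finite M N using assms(1,2) by (simp add: pair_sigma_finite_def)
  have "(\<integral>\<^sup>+ x. ennreal (G x powr p) \<partial>M) \<le>
      (\<integral>\<^sup>+ x. \<integral>\<^sup>+ y. ennreal (A powr (p - 1)) * (ennreal (u x powr (p - 1)) * (k x y * ennreal (v y) * ennreal ((g y / v y) powr p))) \<partial>N \<partial>M)"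
  proof (intro nn_integral_mono)
    fix x assume x: "x \<in> space M"
    have [measurable]: "k x \<in> borel_measurable N"
      using measurable_Pair2[OF assms(3) x] by simp
    have eq: "(\<integral>\<^sup>+ y. k x y * ennreal (g y) \<partial>N) = (\<integral>\<^sup>+ y. (k x y * ennreal (v y)) * ennreal (g y / v y) \<partial>N)"
    proof (intro nn_integral_cong)
      fix y assume y: "y \<in> space N"
      have "ennreal (v y) * ennreal (g y / v y) = ennreal (v y * (g y / v y))"
        using v[OF y] g[OF y] by (intro ennreal_mult[symmetric]) auto
      also have "v y * (g y / v y) = g y" using v[OF y] by simp
      finally show "k x y * ennreal (g y) = (k x y * ennreal (v y)) * ennreal (g y / v y)"
        by (simp add: mult.assoc)
    qed
    have "ennreal (G x powr p) \<le> ennreal ((A * u x) powr (p - 1)) *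
        (\<integral>\<^sup>+ y. (k x y * ennreal (v y)) * ennreal ((g y / v y) powr p) \<partial>N)"
      using Gle[OF x] kv[OF x] A u[OF x] G[OF x] p v g
      by (intro nn_integral_power_mean) (auto simp: eq intro!: divide_nonneg_pos)
    also have "ennreal ((A * u x) powr (p - 1)) = ennreal (A powr (p - 1)) * ennreal (u x powr (p - 1))"
      using A u[OF x] by (simp add: powr_mult ennreal_mult)
    finally show "ennreal (G x powr p) \<le> (\<integral>\<^sup>+ y. ennreal (A powr (p - 1)) * (ennreal (u x powr (p - 1)) *
        (k x y * ennreal (v y) * ennreal ((g y / v y) powr p))) \<partial>N)"
      by (simp add: nn_integral_cmult mult.assoc)
  qed
  also have "\<dots> = (\<integral>\<^sup>+ y. \<integral>\<^sup>+ x. ennreal (A powr (p - 1)) * (ennreal (u x powr (p - 1)) * (k x y * ennreal (v y) * ennreal ((g y / v y) powr p))) \<partial>M \<partial>N)"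
    by (rule Fubini'[symmetric]) measurable
  also have "\<dots> \<le> (\<integral>\<^sup>+ y. ennreal (A powr (p - 1) * B) * ennreal (g y powr p) \<partial>N)"
  proof (intro nn_integral_mono)
    fix y assume y: "y \<in> space N"
    have [measurable]: "(\<lambda>x. k x y) \<in> borel_measurable M"
      using measurable_Pair1[OF assms(3) y] by simp
    let ?q = "v y * (g y / v y) powr p"
    have q: "0 \<le> ?q" using v[OF y] by simp
    have "(\<integral>\<^sup>+ x. ennreal (A powr (p - 1)) * (ennreal (u x powr (p - 1)) * (k x y * ennreal (v y) * ennreal ((g y / v y) powr p))) \<partial>M)
        = (\<integral>\<^sup>+ x. (ennreal (A powr (p - 1)) * ennreal ?q) * (k x y * ennreal (u x powr (p - 1))) \<partial>M)"
      using v[OF y] by (intro nn_integral_cong) (simp add: ennreal_mult mult_ac)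
    also have "\<dots> = (ennreal (A powr (p - 1)) * ennreal ?q) * (\<integral>\<^sup>+ x. k x y * ennreal (u x powr (p - 1)) \<partial>M)"
      by (rule nn_integral_cmult) measurable
    also have "\<dots> \<le> (ennreal (A powr (p - 1)) * ennreal ?q) * ennreal (B * v y powr (p - 1))"
      by (intro mult_left_mono ku[OF y]) auto
    also have "\<dots> = ennreal (A powr (p - 1) * B * (?q * v y powr (p - 1)))"
      using q B v[OF y] by (simp add: ennreal_mult[symmetric] mult_ac)
    also have "?q * v y powr (p - 1) = g y powr p"
    proof -
      have "v y * v y powr (p - 1) = v y powr (1 + (p - 1))"
        using v[OF y] by (subst powr_add) simp
      then have "?q * v y powr (p - 1) = (g y / v y) powr p * v y powr p"
        by (simp add: mult_ac)
      also have "\<dots> = g y powr p" using v[OF y] g[OF y] by (simp add: powr_divide)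
      finally show ?thesis .
    qed
    finally show "(\<integral>\<^sup>+ x. ennreal (A powr (p - 1)) * (ennreal (u x powr (p - 1)) * (k x y * ennreal (v y) * ennreal ((g y / v y) powr p))) \<partial>M)
        \<le> ennreal (A powr (p - 1) * B) * ennreal (g y powr p)"
      using B by (simp add: ennreal_mult[symmetric])
  qed
  also have "\<dots> = ennreal (A powr (p - 1) * B) * (\<integral>\<^sup>+ y. ennreal (g y powr p) \<partial>N)"
    by (rule nn_integral_cmult) measurable
  finally show ?thesis .
qed

text \<open>Minkowski's integral inequality, again from the power mean: the weight is
  \<open>a * n\<close>, of mass at most \<open>W\<close>, and the averaged function is
  \<open>h / n\<close>, whose \<open>p\<close>-th power has integral at most 1 in \<open>x\<close>.
  Working with a majorant \<open>n\<close> of the norms instead of the norms keeps the divisor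
  positive.\<close>

lemma minkowski_kernel:
  assumes "sigma_finite_measure M" "sigma_finite_measure N"
    and [measurable]: "case_prod h \<in> borel_measurable (M \<Otimes>\<^sub>M N)"
      "a \<in> borel_measurable N" "n \<in> borel_measurable N"
    and p: "p > 1" and W: "0 \<le> W"
    and h: "\<And>x y. x \<in> space M \<Longrightarrow> y \<in> space N \<Longrightarrow> 0 \<le> h x y"
    and a: "\<And>y. y \<in> space N \<Longrightarrow> 0 \<le> a y"
    and n: "\<And>y. y \<in> space N \<Longrightarrow> 0 < n y" and G: "\<And>x. x \<in> space M \<Longrightarrow> 0 \<le> G x"
    and hn: "\<And>y. y \<in> space N \<Longrightarrow> (\<integral>\<^sup>+ x. ennreal (h x y powr p) \<partial>M) \<le> ennreal (n y powr p)"
    and Wle: "(\<integral>\<^sup>+ y. ennreal (a y * n y) \<partial>N) \<le> ennreal W"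
    and Gle: "\<And>x. x \<in> space M \<Longrightarrow> ennreal (G x) \<le> (\<integral>\<^sup>+ y. ennreal (a y * h x y) \<partial>N)"
  shows "(\<integral>\<^sup>+ x. ennreal (G x powr p) \<partial>M) \<le> ennreal (W powr p)"
proof -
  interpret pair_sigma_finite M N using assms(1,2) by (simp add: pair_sigma_finite_def)
  have "(\<integral>\<^sup>+ x. ennreal (G x powr p) \<partial>M) \<le>
      (\<integral>\<^sup>+ x. \<integral>\<^sup>+ y. ennreal (W powr (p - 1)) * (ennreal (a y * n y) * ennreal ((h x y / n y) powr p)) \<partial>N \<partial>M)"
  proof (intro nn_integral_mono)
    fix x assume x: "x \<in> space M"
    have [measurable]: "h x \<in> borel_measurable N"
      using measurable_Pair2[OF assms(3) x] by simp
    have eq: "(\<integral>\<^sup>+ y. ennreal (a y * h x y) \<partial>N) = (\<integral>\<^sup>+ y. ennreal (a y * n y) * ennreal (h x y / n y) \<partial>N)"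
    proof (intro nn_integral_cong)
      fix y assume y: "y \<in> space N"
      have "ennreal (a y * n y) * ennreal (h x y / n y) = ennreal ((a y * n y) * (h x y / n y))"
        using n[OF y] a[OF y] h[OF x y] by (intro ennreal_mult[symmetric]) auto
      also have "(a y * n y) * (h x y / n y) = a y * h x y" using n[OF y] by simp
      finally show "ennreal (a y * h x y) = ennreal (a y * n y) * ennreal (h x y / n y)" by simp
    qed
    have "ennreal (G x powr p) \<le> ennreal (W powr (p - 1)) *
        (\<integral>\<^sup>+ y. ennreal (a y * n y) * ennreal ((h x y / n y) powr p) \<partial>N)"
      using Gle[OF x] Wle W G[OF x] p n h[OF x]
      by (intro nn_integral_power_mean) (auto simp: eq intro!: divide_nonneg_pos)
    then show "ennreal (G x powr p) \<le> (\<integral>\<^sup>+ y. ennreal (W powr (p - 1)) *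
        (ennreal (a y * n y) * ennreal ((h x y / n y) powr p)) \<partial>N)"
      by (simp add: nn_integral_cmult)
  qed
  also have "\<dots> = (\<integral>\<^sup>+ y. \<integral>\<^sup>+ x. ennreal (W powr (p - 1)) * (ennreal (a y * n y) * ennreal ((h x y / n y) powr p)) \<partial>M \<partial>N)"
    by (rule Fubini'[symmetric]) measurable
  also have "\<dots> \<le> (\<integral>\<^sup>+ y. ennreal (W powr (p - 1)) * ennreal (a y * n y) \<partial>N)"
  proof (intro nn_integral_mono)
    fix y assume y: "y \<in> space N"
    have [measurable]: "(\<lambda>x. h x y) \<in> borel_measurable M"
      using measurable_Pair1[OF assms(3) y] by simp
    let ?e = "ennreal (W powr (p - 1)) * ennreal (a y * n y) * ennreal (n y powr (- p))"
    have "(\<integral>\<^sup>+ x. ennreal (W powr (p - 1)) * (ennreal (a y * n y) * ennreal ((h x y / n y) powr p)) \<partial>M)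
        = (\<integral>\<^sup>+ x. ?e * ennreal (h x y powr p) \<partial>M)"
    proof (intro nn_integral_cong)
      fix x assume x: "x \<in> space M"
      have "(h x y / n y) powr p = n y powr (- p) * h x y powr p"
        using h[OF x y] n[OF y] by (simp add: powr_divide powr_minus field_simps)
      then show "ennreal (W powr (p - 1)) * (ennreal (a y * n y) * ennreal ((h x y / n y) powr p))
          = ?e * ennreal (h x y powr p)"
        by (simp add: ennreal_mult mult.assoc)
    qed
    also have "\<dots> = ?e * (\<integral>\<^sup>+ x. ennreal (h x y powr p) \<partial>M)"
      by (rule nn_integral_cmult) measurable
    also have "\<dots> \<le> ?e * ennreal (n y powr p)"
      by (intro mult_left_mono hn[OF y]) auto
    also have "\<dots> = ennreal (W powr (p - 1)) * ennreal (a y * n y) * ennreal (n y powr (- p) * n y powr p)"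
      by (simp add: ennreal_mult mult.assoc)
    also have "n y powr (- p) * n y powr p = 1" using n[OF y] by (simp flip: powr_add)
    finally show "(\<integral>\<^sup>+ x. ennreal (W powr (p - 1)) * (ennreal (a y * n y) * ennreal ((h x y / n y) powr p)) \<partial>M)
        \<le> ennreal (W powr (p - 1)) * ennreal (a y * n y)" by simp
  qed
  also have "\<dots> = ennreal (W powr (p - 1)) * (\<integral>\<^sup>+ y. ennreal (a y * n y) \<partial>N)"
    by (rule nn_integral_cmult) measurable
  also have "\<dots> \<le> ennreal (W powr (p - 1)) * ennreal W"
    by (intro mult_left_mono Wle) auto
  also have "\<dots> = ennreal (W powr p)"
  proof -
    have "W powr (p - 1) * W = W powr p"
      using W by (cases "W = 0") (auto simp: powr_diff)
    then show ?thesis using W by (simp flip: ennreal_mult)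
  qed
  finally show ?thesis .
qed

section \<open>Circle means\<close>

abbreviation unit_lborel :: "real measure" where
  "unit_lborel \<equiv> restrict_space lborel {0<..<1}"

text \<open>Circles are parametrised by \<open>cis (2 * pi * t)\<close> with \<open>0 < t < 1\<close>, so the point \<open>1\<close>
  corresponds to both ends of the interval.\<close>

definition arc_dist :: "real \<Rightarrow> real" where
  "arc_dist t = min t (1 - t)"

lemma arc_dist_measurable [measurable]: "arc_dist \<in> borel_measurable borel"
  unfolding arc_dist_def[abs_def] by measurable

lemma arc_dist_pos: "0 < t \<Longrightarrow> t < 1 \<Longrightarrow> 0 < arc_dist t"
  by (simp add: arc_dist_def)

lemma sigma_finite_unit_lborel: "sigma_finite_measure unit_lborel"
  by (rule sigma_finite_measure_restrict_space) (auto intro: sigma_finite_lborel)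

lemma nn_integral_unit_lborel:
  "(\<integral>\<^sup>+ t. f t \<partial>unit_lborel) = (\<integral>\<^sup>+ t. f t * indicator {0<..<1} t \<partial>lborel)"
  by (rule nn_integral_restrict_space) simp

lemma nn_integral_unit_reflect:
  assumes [measurable]: "f \<in> borel_measurable borel"
  shows "(\<integral>\<^sup>+ t. f (1 - t) \<partial>unit_lborel) = (\<integral>\<^sup>+ t. f t \<partial>unit_lborel)"
proof -
  have "(\<integral>\<^sup>+ t. f t * indicator {0<..<1} t \<partial>lborel)
      = (\<integral>\<^sup>+ t. f (1 + (-1) * t) * indicator {0<..<1} (1 + (-1) * t) \<partial>lborel)"
    by (subst nn_integral_real_affine[where c = "-1" and t = 1]) auto
  also have "\<dots> = (\<integral>\<^sup>+ t. f (1 - t) * indicator {0<..<1} t \<partial>lborel)"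
    by (intro nn_integral_cong) (auto simp: indicator_def)
  finally show ?thesis by (simp add: nn_integral_unit_lborel)
qed

text \<open>The integrand is one of \<open>f t\<close> and \<open>f (1 - t)\<close>, and reflection
  preserves the measure.\<close>

lemma nn_integral_arc_dist_le:
  assumes [measurable]: "f \<in> borel_measurable borel"
  shows "(\<integral>\<^sup>+ t. f (arc_dist t) \<partial>unit_lborel) \<le> 2 * (\<integral>\<^sup>+ t. f t \<partial>unit_lborel)"
proof -
  have "(\<integral>\<^sup>+ t. f (arc_dist t) \<partial>unit_lborel) \<le> (\<integral>\<^sup>+ t. f t + f (1 - t) \<partial>unit_lborel)"
    by (intro nn_integral_mono) (auto simp: arc_dist_def min_def)
  also have "\<dots> = 2 * (\<integral>\<^sup>+ t. f t \<partial>unit_lborel)"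
    by (subst nn_integral_add) (auto simp: nn_integral_unit_reflect mult_2 intro!: measurable_restrict_space1)
  finally show ?thesis .
qed

text \<open>The denominator is at least the larger of \<open>c\<close> and \<open>s\<close>. Below
  \<open>c\<close> the integral of \<open>s powr (- a)\<close> converges because
  \<open>a < 1\<close>, above \<open>c\<close> that of \<open>s powr (- a - 1)\<close> because
  \<open>a > 0\<close>; the two pieces give the two terms of the constant.\<close>

lemma nn_integral_hilbert_kernel:
  fixes a c :: real
  assumes a: "0 < a" "a < 1" and c: "0 < c"
  shows "(\<integral>\<^sup>+ s. ennreal (s powr (- a) / (c + s)) \<partial>unit_lborel) \<le> ennreal ((1 / (1 - a) + 1 / a) * c powr (- a))"
proof -
  have "(\<integral>\<^sup>+ s. ennreal (s powr (- a) / (c + s)) \<partial>unit_lborel) \<le>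
     (\<integral>\<^sup>+ s. ennreal (1 / c) * (ennreal (s powr (- a)) * indicator {0..c} s) +
        ennreal (s powr (- a - 1)) * indicator {c..} s \<partial>lborel)"
    unfolding nn_integral_unit_lborel
  proof (intro nn_integral_mono)
    fix s :: real
    show "ennreal (s powr (- a) / (c + s)) * indicator {0<..<1} s \<le>
      ennreal (1 / c) * (ennreal (s powr (- a)) * indicator {0..c} s) +
        ennreal (s powr (- a - 1)) * indicator {c..} s"
    proof (cases "0 < s \<and> s < 1")
      case True
      show ?thesis
      proof (cases "s \<le> c")
        case le: True
        have "s powr (- a) / (c + s) \<le> s powr (- a) / c"
          using True c by (intro divide_left_mono) auto
        then have "ennreal (s powr (- a) / (c + s)) \<le> ennreal (1 / c) * ennreal (s powr (- a))"
          using c by (simp add: ennreal_leI flip: ennreal_mult)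
        then show ?thesis using True le by (simp add: add_increasing2)
      next
        case False
        have "s powr (- a) / (c + s) \<le> s powr (- a) / s"
          using True c by (intro divide_left_mono) auto
        also have "\<dots> = s powr (- a - 1)" using True by (simp add: powr_diff)
        finally show ?thesis using True False by (simp add: ennreal_leI)
      qed
    qed auto
  qed
  also have "\<dots> = ennreal (1 / c) * (\<integral>\<^sup>+ s. ennreal (s powr (- a)) * indicator {0..c} s \<partial>lborel) +
       (\<integral>\<^sup>+ s. ennreal (s powr (- a - 1)) * indicator {c..} s \<partial>lborel)"
    by (simp add: nn_integral_add nn_integral_cmult)
  also have "(\<integral>\<^sup>+ s. ennreal (s powr (- a)) * indicator {0..c} s \<partial>lborel) = ennreal (c powr (- a + 1) / (- a + 1))"
    using has_integral_powr_from_0[of "- a" c] a c by (intro nn_integral_has_integral_lebesgue') auto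
  also have "(\<integral>\<^sup>+ s. ennreal (s powr (- a - 1)) * indicator {c..} s \<partial>lborel) = ennreal (- (c powr (- a - 1 + 1)) / (- a - 1 + 1))"
    using has_integral_powr_to_inf[of "- a - 1" c] a c by (intro nn_integral_has_integral_lebesgue') auto
  also have "ennreal (1 / c) * ennreal (c powr (- a + 1) / (- a + 1)) + ennreal (- (c powr (- a - 1 + 1)) / (- a - 1 + 1))
      = ennreal ((1 / c) * (c powr (- a + 1) / (- a + 1)) + c powr (- a) / a)"
  proof -
    have "ennreal (1 / c) * ennreal (c powr (- a + 1) / (- a + 1)) = ennreal ((1 / c) * (c powr (- a + 1) / (- a + 1)))"
      using a c by (intro ennreal_mult[symmetric]) auto
    moreover have "0 \<le> (1 / c) * (c powr (- a + 1) / (- a + 1))" using a c by simp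
    ultimately show ?thesis using a by (simp add: ennreal_plus)
  qed
  also have "(1 / c) * (c powr (- a + 1) / (- a + 1)) + c powr (- a) / a = (1 / (1 - a) + 1 / a) * c powr (- a)"
  proof -
    have "c powr (- a + 1) = c powr (- a) * c powr 1" by (rule powr_add)
    then have "(1 / c) * (c powr (- a + 1) / (- a + 1)) = c powr (- a) / (1 - a)" using c by simp
    then show ?thesis by (simp add: distrib_right)
  qed
  finally show ?thesis .
qed

lemma nn_integral_arc_dist_hilbert:
  fixes a c :: real
  assumes a: "0 < a" "a < 1" and c: "0 < c"
  shows "(\<integral>\<^sup>+ t. ennreal (arc_dist t powr (- a) / (c + arc_dist t)) \<partial>unit_lborel)
    \<le> ennreal (2 * ((1 / (1 - a) + 1 / a) * c powr (- a)))"
proof -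
  have "(\<integral>\<^sup>+ t. ennreal (arc_dist t powr (- a) / (c + arc_dist t)) \<partial>unit_lborel)
      \<le> 2 * (\<integral>\<^sup>+ t. ennreal (t powr (- a) / (c + t)) \<partial>unit_lborel)"
    by (rule nn_integral_arc_dist_le) measurable
  also have "\<dots> \<le> 2 * ennreal ((1 / (1 - a) + 1 / a) * c powr (- a))"
    by (intro mult_left_mono nn_integral_hilbert_kernel assms) auto
  also have "\<dots> = ennreal (2 * ((1 / (1 - a) + 1 / a) * c powr (- a)))"
    using a by (simp add: ennreal_mult)
  finally show ?thesis .
qed

lemma nn_integral_arc_dist_powr:
  fixes p s :: real
  assumes p: "p > 1" and s: "s > 0"
  shows "(\<integral>\<^sup>+ t. ennreal ((s + arc_dist t) powr (- p)) \<partial>unit_lborel) \<le> ennreal (2 / (p - 1) * s powr (1 - p))"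
proof -
  have "(\<integral>\<^sup>+ t. ennreal ((s + arc_dist t) powr (- p)) \<partial>unit_lborel)
      \<le> 2 * (\<integral>\<^sup>+ t. ennreal ((s + t) powr (- p)) \<partial>unit_lborel)"
    by (rule nn_integral_arc_dist_le) measurable
  also have "\<dots> \<le> 2 * (\<integral>\<^sup>+ t. ennreal ((s + 1 * t) powr (- p)) * indicator {s..} (s + 1 * t) \<partial>lborel)"
    unfolding nn_integral_unit_lborel by (intro mult_left_mono nn_integral_mono) (auto simp: indicator_def)
  also have "(\<integral>\<^sup>+ t. ennreal ((s + 1 * t) powr (- p)) * indicator {s..} (s + 1 * t) \<partial>lborel)
      = (\<integral>\<^sup>+ t. ennreal (t powr (- p)) * indicator {s..} t \<partial>lborel)"
    using nn_integral_real_affine[of "\<lambda>t. ennreal (t powr (- p)) * indicator {s..} t" 1 s] by simp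
  also have "\<dots> = ennreal (- (s powr (- p + 1)) / (- p + 1))"
    using has_integral_powr_to_inf[of "- p" s] p s by (intro nn_integral_has_integral_lebesgue') auto
  also have "- (s powr (- p + 1)) / (- p + 1) = s powr (1 - p) / (p - 1)"
    using p by (simp add: field_simps)
  also have "2 * ennreal (s powr (1 - p) / (p - 1)) = ennreal (2 * (s powr (1 - p) / (p - 1)))"
    using p by (subst ennreal_mult) auto
  finally show ?thesis by simp
qed

section \<open>Chords and arcs near the point 1, circle means and Cauchy's formula\<close>

lemma sin_ge_quarter:
  fixes y :: real
  assumes "0 \<le> y" "y \<le> pi / 2"
  shows "y / 4 \<le> sin y"
\<comment> \<open>Up to \<open>pi / 3\<close> the cosine in the mean value theorem is at least 1/2;
  beyond it the sine itself is at least 1/2, while \<open>y \<le> 2\<close>.\<close>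
proof (cases "y \<le> pi / 3")
  case True
  show ?thesis
  proof (cases "y = 0")
    case False
    with assms have y: "0 < y" by simp
    have "\<exists>z. 0 < z \<and> z < y \<and> sin y - sin 0 = (y - 0) * cos z"
      by (rule MVT2[OF y]) (auto intro!: derivative_eq_intros)
    then obtain z where z: "0 < z" "z < y" "sin y = y * cos z" by auto
    have "cos (pi / 3) \<le> cos z" using z True y by (intro cos_monotone_0_pi_le) auto
    then have "1 / 2 \<le> cos z" by (simp add: cos_60)
    then have "y * (1 / 2) \<le> y * cos z" using y by (intro mult_left_mono) auto
    then show ?thesis using z y by simp
  qed simp
next
  case False
  have "sin (pi / 6) \<le> sin y" using False assms pi_gt_zero by (intro sin_monotone_2pi_le) linarith+
  then have "1 / 2 \<le> sin y" by (simp add: sin_30)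
  moreover have "y \<le> 2" using assms pi_less_4 by linarith
  ultimately show ?thesis by simp
qed

lemma norm_one_minus_cis: "cmod (1 - cis (2 * y)) = 2 * \<bar>sin y\<bar>"
proof -
  have "1 - cis (2 * y) = cis y * (cis (- y) - cis y)"
    by (simp add: right_diff_distrib cis_mult)
  also have "cis (- y) - cis y = Complex 0 (- 2 * sin y)"
    by (simp add: complex_eq_iff)
  finally show ?thesis by (simp add: norm_mult complex_norm real_sqrt_mult)
qed

lemma arc_dist_le:
  assumes "0 \<le> t" "t \<le> 1"
  shows "arc_dist t \<le> cmod (1 - cis (2 * pi * t))"
proof -
  have *: "t \<le> 2 * sin (pi * t)" if "0 \<le> t" "t \<le> 1 / 2" for t
  proof -
    have "pi * t \<le> pi * (1 / 2)" using that by (intro mult_left_mono) auto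
    then have "pi * t / 4 \<le> sin (pi * t)" using that by (intro sin_ge_quarter) auto
    moreover have "2 * t \<le> pi * t" using that pi_ge_two by (intro mult_right_mono) auto
    ultimately show ?thesis by linarith
  qed
  have "arc_dist t \<le> 2 * \<bar>sin (pi * t)\<bar>"
  proof (cases "t \<le> 1 / 2")
    case True
    then show ?thesis using *[of t] assms by (simp add: arc_dist_def)
  next
    case False
    have "sin (pi * (1 - t)) = sin (pi * t)" by (simp add: right_diff_distrib sin_diff)
    then show ?thesis using *[of "1 - t"] False assms by (simp add: arc_dist_def)
  qed
  also have "\<dots> = cmod (1 - cis (2 * pi * t))"
    using norm_one_minus_cis[of "pi * t"] by (simp add: mult.assoc)
  finally show ?thesis .
qed

text \<open>The right-hand modulus dominates \<open>1 - x\<close> with factor 1 and, by the triangle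
  inequality, the chord from 1 to the point of the unit circle with factor 2; together this gives
  the 3. Thus |1 - w| becomes the denominator of the Hilbert-type kernel.\<close>

lemma norm_one_minus_ge:
  assumes "0 \<le> x" "x \<le> 1" "0 \<le> t" "t \<le> 1"
  shows "1 - x + arc_dist t \<le> 3 * cmod (1 - of_real x * cis (2 * pi * t))"
proof -
  let ?e = "cis (2 * pi * t)"
  have 1: "1 - x \<le> cmod (1 - of_real x * ?e)"
    using norm_triangle_ineq2[of 1 "of_real x * ?e"] assms by (simp add: norm_mult)
  have "1 - ?e = (1 - of_real x * ?e) - of_real (1 - x) * ?e" by (simp add: algebra_simps)
  then have "cmod (1 - ?e) \<le> cmod (1 - of_real x * ?e) + cmod (of_real (1 - x) * ?e)"
    by (metis norm_triangle_ineq4)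
  also have "cmod (of_real (1 - x) * ?e) = 1 - x" using assms by (simp only: norm_mult norm_of_real norm_cis) simp
  finally have "cmod (1 - ?e) \<le> 2 * cmod (1 - of_real x * ?e)" using 1 by linarith
  then show ?thesis using 1 arc_dist_le[OF assms(3,4)] by linarith
qed

text \<open>The substitution \<open>\<theta> = 2 * pi * t\<close> cancels the normalising factor,
  and the two endpoints form a null set. The passage to a nonnegative integral makes Tonelli's
  theorem and the inequalities above applicable.\<close>

lemma Mp_powr:
  assumes cont: "continuous_on (sphere 0 r) F" and r: "0 \<le> r" and p: "p > 0"
  shows "ennreal (Mp p r F powr p) = (\<integral>\<^sup>+ t. ennreal (cmod (F (of_real r * cis (2 * pi * t))) powr p) \<partial>unit_lborel)"
proof -
  define g where "g \<theta> = cmod (F (rcis r \<theta>)) powr p" for \<theta>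
  have "continuous_on UNIV (\<lambda>\<theta>. F (rcis r \<theta>))"
    by (rule continuous_on_compose2[OF cont])
       (use r in \<open>auto simp: rcis_def norm_mult intro!: continuous_intros\<close>)
  then have gc: "continuous_on UNIV g"
    unfolding g_def[abs_def] using p by (intro continuous_on_powr' continuous_intros) auto
  then have [measurable]: "g \<in> borel_measurable borel"
    by (rule borel_measurable_continuous_onI)
  have gint: "integrable lborel (\<lambda>\<theta>. indicator {0..2 * pi} \<theta> *\<^sub>R g \<theta>)"
    by (rule borel_integrable_compact) (auto intro: continuous_on_subset[OF gc])
  define L where "L = (LINT \<theta>:{0..2 * pi}|lborel. g \<theta>)"
  have L: "0 \<le> L"
    unfolding L_def set_lebesgue_integral_def
    by (rule integral_nonneg_AE) (auto simp: g_def indicator_def)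
  have "ennreal L = (\<integral>\<^sup>+ \<theta>. ennreal (indicator {0..2 * pi} \<theta> *\<^sub>R g \<theta>) \<partial>lborel)"
    unfolding L_def set_lebesgue_integral_def
    by (rule nn_integral_eq_integral[symmetric, OF gint]) (auto simp: g_def indicator_def)
  also have "\<dots> = (\<integral>\<^sup>+ \<theta>. ennreal (g \<theta>) * indicator {0..2 * pi} \<theta> \<partial>lborel)"
    by (intro nn_integral_cong) (auto simp: indicator_def)
  also have "\<dots> = ennreal (2 * pi) * (\<integral>\<^sup>+ t. ennreal (g (0 + 2 * pi * t)) * indicator {0..2 * pi} (0 + 2 * pi * t) \<partial>lborel)"
    by (subst nn_integral_real_affine[where c = "2 * pi" and t = 0]) auto
  also have "(\<integral>\<^sup>+ t. ennreal (g (0 + 2 * pi * t)) * indicator {0..2 * pi} (0 + 2 * pi * t) \<partial>lborel)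
      = (\<integral>\<^sup>+ t. ennreal (g (2 * pi * t)) * indicator {0<..<1} t \<partial>lborel)"
  proof (intro nn_integral_cong_AE)
    have *: "0 \<le> 2 * pi * t \<longleftrightarrow> 0 \<le> t" "2 * pi * t \<le> 2 * pi \<longleftrightarrow> t \<le> 1" for t
      using mult_le_cancel_left_pos[of "2 * pi" 0 t] mult_le_cancel_left_pos[of "2 * pi" t 1] by auto
    show "AE t in lborel. ennreal (g (0 + 2 * pi * t)) * indicator {0..2 * pi} (0 + 2 * pi * t)
        = ennreal (g (2 * pi * t)) * indicator {0<..<1} t"
      using AE_lborel_singleton[of 0] AE_lborel_singleton[of 1]
      by eventually_elim (auto simp: indicator_def * simp del: mult_le_cancel_left1 mult_le_cancel_left2)
  qed
  finally have L2: "ennreal L = ennreal (2 * pi) * (\<integral>\<^sup>+ t. ennreal (g (2 * pi * t)) \<partial>unit_lborel)"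
    by (simp add: nn_integral_unit_lborel)
  have "Mp p r F powr p = 1 / (2 * pi) * L"
    using p L by (simp add: Mp_def L_def g_def powr_powr)
  then have "ennreal (Mp p r F powr p) = ennreal (1 / (2 * pi)) * ennreal L"
    using L by (simp only: ennreal_mult divide_nonneg_nonneg zero_le_one pi_ge_zero mult_nonneg_nonneg zero_le_numeral)
  also have "\<dots> = (ennreal (1 / (2 * pi)) * ennreal (2 * pi)) * (\<integral>\<^sup>+ t. ennreal (g (2 * pi * t)) \<partial>unit_lborel)"
    unfolding L2 by (simp only: mult.assoc)
  also have "ennreal (1 / (2 * pi)) * ennreal (2 * pi) = 1"
    by (simp flip: ennreal_mult)
  finally show ?thesis by (simp add: g_def rcis_def)
qed

text \<open>Cauchy's formula at the point \<open>\<rho> * r\<close> inside the circle of radius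
  \<rho>. The radius cancels against the derivative of the parametrisation, so the resulting kernel
  is free of \<rho>.\<close>

lemma cauchy_circle_bound:
  assumes F: "F holomorphic_on ball 0 1" and \<rho>: "0 < \<rho>" "\<rho> < 1" and r: "0 \<le> r" "r < 1"
  shows "ennreal (cmod (F (of_real (\<rho> * r)))) \<le>
    (\<integral>\<^sup>+ t. ennreal (cmod (F (of_real \<rho> * cis (2 * pi * t))) / cmod (1 - of_real r * cis (2 * pi * t))) \<partial>unit_lborel)"
proof -
  let ?e = "\<lambda>t. cis (2 * pi * t)"
  define H where "H t = F (of_real \<rho> * ?e t) / (of_real \<rho> * ?e t - of_real (\<rho> * r)) * (of_real \<rho> * ?e t)" for t
  have sub: "cball 0 \<rho> \<subseteq> ball (0::complex) 1" using \<rho> by auto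
  have Fc: "continuous_on (cball 0 \<rho>) F"
    using F sub by (meson holomorphic_on_imp_continuous_on continuous_on_subset)
  have "\<rho> * r < \<rho> * 1" using \<rho> r by (intro mult_strict_left_mono) auto
  then have rr: "\<rho> * r < \<rho>" by simp
  have "((\<lambda>u. F u / (u - of_real (\<rho> * r))) has_contour_integral (2 * of_real pi * \<i> * F (of_real (\<rho> * r)))) (circlepath 0 \<rho>)"
    using Fc rr \<rho> r sub by (intro Cauchy_integral_circlepath holomorphic_on_subset[OF F]) (auto simp: abs_mult norm_mult)
  then have "((\<lambda>t. (2 * of_real pi * \<i>) * H t) has_integral (2 * of_real pi * \<i> * F (of_real (\<rho> * r)))) {0..1}"
    unfolding has_contour_integral_def
  proof (rule has_integral_eq[rotated])
    fix t :: real assume t: "t \<in> {0..1}"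
    have e: "exp (2 * complex_of_real pi * \<i> * of_real t) = ?e t"
      by (simp add: cis_conv_exp mult_ac)
    show "F (circlepath 0 \<rho> t) / (circlepath 0 \<rho> t - of_real (\<rho> * r)) *
        vector_derivative (circlepath 0 \<rho>) (at t within {0..1}) = 2 * of_real pi * \<i> * H t"
    proof -
      have "circlepath 0 \<rho> t = of_real \<rho> * ?e t"
        by (simp add: circlepath e)
      moreover have "vector_derivative (circlepath 0 \<rho>) (at t within {0..1}) = 2 * of_real pi * \<i> * (of_real \<rho> * ?e t)"
        using t by (simp add: vector_derivative_circlepath01 e)
      ultimately show ?thesis by (simp add: H_def)
    qed
  qed
  from has_integral_mult_right[OF this, of "1 / (2 * of_real pi * \<i>)"]
  have Hint: "(H has_integral F (of_real (\<rho> * r))) {0..1}" by simp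
  have ne: "of_real \<rho> * ?e t - of_real (\<rho> * r) \<noteq> 0" for t
  proof
    assume "of_real \<rho> * ?e t - of_real (\<rho> * r) = 0"
    then have "of_real \<rho> * ?e t = of_real (\<rho> * r)" by (simp only: right_minus_eq)
    then have "cmod (of_real \<rho> * ?e t) = cmod (of_real (\<rho> * r) :: complex)" by (rule arg_cong)
    then have "\<rho> = \<rho> * r" using \<rho> r by (simp add: norm_mult abs_mult)
    with rr show False by simp
  qed
  have "continuous_on UNIV (\<lambda>t. F (of_real \<rho> * ?e t))"
    by (rule continuous_on_compose2[OF Fc]) (use \<rho> in \<open>auto simp: norm_mult intro!: continuous_intros\<close>)
  then have Hc: "continuous_on UNIV H"
    unfolding H_def[abs_def] using ne by (intro continuous_intros) auto
  have Hi: "integrable lborel (\<lambda>t. indicator {0..1} t *\<^sub>R H t)"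
    by (rule borel_integrable_compact) (auto intro: continuous_on_subset[OF Hc])
  then have "F (of_real (\<rho> * r)) = (LINT t|lborel. indicator {0..1} t *\<^sub>R H t)"
    using set_borel_integral_eq_integral(2)[of "{0..1}" H] integral_unique[OF Hint]
    by (simp add: set_integrable_def set_lebesgue_integral_def)
  then have "ennreal (cmod (F (of_real (\<rho> * r)))) \<le> (\<integral>\<^sup>+ t. ennreal (norm (indicator {0..1} t *\<^sub>R H t)) \<partial>lborel)"
    using integral_norm_bound_ennreal[OF Hi] by simp
  also have "\<dots> = (\<integral>\<^sup>+ t. ennreal (cmod (H t)) * indicator {0<..<1} t \<partial>lborel)"
  proof (intro nn_integral_cong_AE)
    show "AE t in lborel. ennreal (norm (indicator {0..1} t *\<^sub>R H t)) = ennreal (cmod (H t)) * indicator {0<..<1} t"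
      using AE_lborel_singleton[of 0] AE_lborel_singleton[of 1]
      by eventually_elim (auto simp: indicator_def)
  qed
  also have "\<dots> = (\<integral>\<^sup>+ t. ennreal (cmod (H t)) \<partial>unit_lborel)"
    by (simp add: nn_integral_unit_lborel)
  also have "(\<lambda>t. cmod (H t)) = (\<lambda>t. cmod (F (of_real \<rho> * ?e t)) / cmod (1 - of_real r * ?e t))"
  proof
    fix t
    \<comment> \<open>On the unit circle \<open>e - r = e * cnj (1 - r * e)\<close>, so the distance
      to the point equals \<rho> times the modulus that occurs in the kernel bounds.\<close>
    have "of_real \<rho> * ?e t - of_real (\<rho> * r) = of_real \<rho> * ?e t * cnj (1 - of_real r * ?e t)"
      by (simp add: right_diff_distrib cis_cnj mult.assoc cis_mult)
    then have "cmod (of_real \<rho> * ?e t - of_real (\<rho> * r)) = \<rho> * cmod (1 - of_real r * ?e t)"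
      using \<rho> by (simp add: norm_mult del: of_real_mult complex_cnj_diff complex_cnj_mult)
    then show "cmod (H t) = cmod (F (of_real \<rho> * ?e t)) / cmod (1 - of_real r * ?e t)"
      using \<rho> by (simp add: H_def norm_mult norm_divide)
  qed
  finally show ?thesis .
qed

section \<open>The operator\<close>

lemma MplusD:
  assumes "\<mu> \<in> Mplus"
  shows "finite_measure \<mu>" "sets \<mu> = sets (restrict_space borel {0..<1})" "space \<mu> = {0..<1}"
proof -
  show 1: "finite_measure \<mu>" "sets \<mu> = sets (restrict_space borel {0..<1})"
    using assms by (auto simp: Mplus_def)
  show "space \<mu> = {0..<1}" unfolding sets_eq_imp_space_eq[OF 1(2)] by (simp add: space_restrict_space)
qed

lemma Mplus_measurable:
  assumes "\<mu> \<in> Mplus" "f \<in> borel_measurable (restrict_space borel {0..<1})"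
  shows "f \<in> borel_measurable \<mu>"
  by (subst measurable_cong_sets[OF MplusD(2)[OF assms(1)] refl]) (rule assms(2))

lemma Mplus_measurable_borel:
  assumes "\<mu> \<in> Mplus" "f \<in> borel_measurable borel"
  shows "f \<in> borel_measurable \<mu>"
  by (rule Mplus_measurable[OF assms(1) measurable_restrict_space1[OF assms(2)]])

lemma Mplus_measurable_continuous:
  fixes f :: "real \<Rightarrow> 'a :: {second_countable_topology, topological_space}"
  assumes "\<mu> \<in> Mplus" "continuous_on {0..<1} f"
  shows "f \<in> borel_measurable \<mu>"
  by (rule Mplus_measurable[OF assms(1) borel_measurable_continuous_on_restrict[OF assms(2)]])

lemma measure_tail_0:
  assumes "\<mu> \<in> Mplus"
  shows "measure_tail \<mu> 0 = measure \<mu> (space \<mu>)"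
  by (simp add: measure_tail_def MplusD(3)[OF assms])

lemma measure_tail_emeasure:
  assumes "\<mu> \<in> Mplus"
  shows "ennreal (measure_tail \<mu> r) = emeasure \<mu> {r..<1}"
  using finite_measure.emeasure_eq_measure[OF MplusD(1)[OF assms]] by (simp add: measure_tail_def)

lemma measure_tail_antimono:
  assumes "\<mu> \<in> Mplus" "0 \<le> r" "r \<le> t"
  shows "measure_tail \<mu> t \<le> measure_tail \<mu> r"
  unfolding measure_tail_def
proof (rule finite_measure.finite_measure_mono[OF MplusD(1)[OF assms(1)]])
  show "{r..<1} \<in> sets \<mu>"
    using assms(2) by (subst MplusD(2)[OF assms(1)]) (auto simp: sets_restrict_space_iff)
qed (use assms in auto)

lemma measure_moment_ennreal:
  assumes "\<mu> \<in> Mplus"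
  shows "ennreal (measure_moment \<mu> n) = (\<integral>\<^sup>+ t. ennreal (t ^ n) \<partial>\<mu>)" "0 \<le> measure_moment \<mu> n"
proof -
  have sp: "space \<mu> = {0..<1}" by (rule MplusD(3)[OF assms])
  have "integrable \<mu> (\<lambda>t. t ^ n)"
    by (rule finite_measure.integrable_const_bound[OF MplusD(1)[OF assms], of _ 1])
       (auto simp: sp power_le_one abs_of_nonneg intro!: AE_I2 Mplus_measurable_borel[OF assms])
  then show "ennreal (measure_moment \<mu> n) = (\<integral>\<^sup>+ t. ennreal (t ^ n) \<partial>\<mu>)"
    unfolding measure_moment_def by (intro nn_integral_eq_integral[symmetric]) (auto simp: sp)
  show "0 \<le> measure_moment \<mu> n"
    unfolding measure_moment_def by (rule integral_nonneg_AE) (auto simp: sp)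
qed

text \<open>\<open>Minfty\<close> is a real supremum, so compactness of the circle is needed to see
  that it bounds the values. \<open>enn2real\<close> is harmless because members of the space have
  finite norm.\<close>

lemma X_norm_pointwise:
  assumes f: "f \<in> analytic_space (X_norm \<beta>)" and z: "cmod z < 1"
  shows "cmod (f z) \<le> enn2real (X_norm \<beta> f) * (1 - cmod z) powr (- \<beta>)"
proof -
  define r where "r = cmod z"
  have r: "0 \<le> r" "r < 1" using z by (auto simp: r_def)
  have hol: "f holomorphic_on ball 0 1" and fin: "X_norm \<beta> f < \<infinity>"
    using f by (auto simp: analytic_space_def)
  have "continuous_on (sphere 0 r) f"
    using r by (intro continuous_on_subset[OF holomorphic_on_imp_continuous_on[OF hol]]) auto
  then have "compact ((\<lambda>w. cmod (f w)) ` sphere 0 r)"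
    by (intro compact_continuous_image continuous_intros) auto
  then have "bdd_above ((\<lambda>w. cmod (f w)) ` sphere 0 r)"
    by (intro bounded_imp_bdd_above compact_imp_bounded)
  then have "cmod (f z) \<le> Minfty r f"
    unfolding Minfty_def by (intro cSUP_upper) (auto simp: r_def)
  then have "(1 - r) powr \<beta> * cmod (f z) \<le> (1 - r) powr \<beta> * Minfty r f"
    by (intro mult_left_mono) auto
  then have "ennreal ((1 - r) powr \<beta> * cmod (f z)) \<le> ennreal ((1 - r) powr \<beta> * Minfty r f)"
    by (rule ennreal_leI)
  also have "\<dots> \<le> X_norm \<beta> f"
    unfolding X_norm_def using r by (intro SUP_upper) auto
  also have "\<dots> = ennreal (enn2real (X_norm \<beta> f))" using fin by simp
  finally have "(1 - r) powr \<beta> * cmod (f z) \<le> enn2real (X_norm \<beta> f)"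
    by (subst (asm) ennreal_le_iff) auto
  then have "(1 - r) powr (- \<beta>) * ((1 - r) powr \<beta> * cmod (f z)) \<le> (1 - r) powr (- \<beta>) * enn2real (X_norm \<beta> f)"
    by (intro mult_left_mono) auto
  moreover have "(1 - r) powr (- \<beta>) * (1 - r) powr \<beta> = 1"
    using r by (simp flip: powr_add)
  ultimately have "cmod (f z) \<le> (1 - r) powr (- \<beta>) * enn2real (X_norm \<beta> f)"
    by (simp only: mult.assoc[symmetric] mult_1)
  then show ?thesis by (simp add: r_def mult.commute)
qed

text \<open>The function of extremal growth for \<open>X_norm \<beta>\<close>. The principal branch
  is holomorphic because \<open>1 - z\<close> stays in the right half-plane, and its values on the
  radius are positive.\<close>

definition test_fun :: "real \<Rightarrow> complex \<Rightarrow> complex" where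
  "test_fun \<beta> z = (1 - z) powr (of_real (- \<beta>))"

lemma test_fun_holomorphic: "test_fun \<beta> holomorphic_on ball 0 1"
  unfolding test_fun_def[abs_def]
proof (intro holomorphic_intros)
  fix z :: complex assume "z \<in> ball 0 1"
  then have "Re z < 1" using complex_Re_le_cmod[of z] by simp
  then show "1 - z \<notin> \<real>\<^sub>\<le>\<^sub>0" by (auto simp: complex_nonpos_Reals_iff)
qed

lemma test_fun_of_real:
  assumes "x < 1"
  shows "test_fun \<beta> (of_real x) = of_real ((1 - x) powr (- \<beta>))"
proof -
  have "test_fun \<beta> (of_real x) = of_real (1 - x) powr of_real (- \<beta>)" by (simp add: test_fun_def)
  also have "\<dots> = of_real ((1 - x) powr (- \<beta>))" using assms by (intro powr_of_real) auto
  finally show ?thesis .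
qed

lemma test_fun_norm:
  assumes "0 \<le> \<beta>"
  shows "X_norm \<beta> (test_fun \<beta>) \<le> 1" "test_fun \<beta> \<in> analytic_space (X_norm \<beta>)"
proof -
  show 1: "X_norm \<beta> (test_fun \<beta>) \<le> 1"
    unfolding X_norm_def
  proof (rule SUP_least)
    fix r :: real assume r: "r \<in> {0..<1}"
    have "Minfty r (test_fun \<beta>) \<le> (1 - r) powr (- \<beta>)"
      unfolding Minfty_def
    proof (rule cSUP_least)
      show "sphere 0 r \<noteq> ({} :: complex set)" using r by simp
      fix z :: complex assume "z \<in> sphere 0 r"
      then have z: "cmod z = r" by simp
      have "1 - r \<le> cmod (1 - z)" using norm_triangle_ineq2[of 1 z] z by simp
      then show "cmod (test_fun \<beta> z) \<le> (1 - r) powr (- \<beta>)"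
        unfolding test_fun_def using assms r
        by (subst norm_powr_real_powr') (auto intro!: powr_mono2')
    qed
    then have "(1 - r) powr \<beta> * Minfty r (test_fun \<beta>) \<le> (1 - r) powr \<beta> * (1 - r) powr (- \<beta>)"
      by (intro mult_left_mono) auto
    also have "\<dots> = 1" using r by (simp flip: powr_add)
    finally show "ennreal ((1 - r) powr \<beta> * Minfty r (test_fun \<beta>)) \<le> 1"
      by (simp add: ennreal_leI flip: ennreal_1)
  qed
  then show "test_fun \<beta> \<in> analytic_space (X_norm \<beta>)"
    using test_fun_holomorphic by (auto simp: analytic_space_def intro: le_less_trans)
qed

lemma norm_of_real_mult_less:
  assumes "0 \<le> t" "t < 1" "cmod z < 1"
  shows "cmod (of_real t * z) < 1" "cmod (of_real t * z) = t * cmod z" "t * cmod z < 1"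
proof -
  have "t * cmod z \<le> 1 * cmod z" using assms by (intro mult_right_mono) auto
  then show "t * cmod z < 1" "cmod (of_real t * z) = t * cmod z" "cmod (of_real t * z) < 1"
    using assms by (auto simp: norm_mult)
qed

context Dhat_weight
begin

text \<open>The points \<open>t * z\<close> stay in the closed disc of radius \<open>cmod z\<close>,
  where \<open>g\<close> is bounded, and \<mu> is finite.\<close>

lemma Cop_integrable:
  assumes \<mu>: "\<mu> \<in> Mplus" and g: "g holomorphic_on ball 0 1" and z: "cmod z < 1"
  shows "integrable \<mu> (\<lambda>t. g (of_real t * z) :: complex)"
proof -
  have gc: "continuous_on (cball 0 (cmod z)) g"
    using z by (intro continuous_on_subset[OF holomorphic_on_imp_continuous_on[OF g]]) auto
  have "bounded (g ` cball 0 (cmod z))"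
    by (intro compact_imp_bounded compact_continuous_image gc) auto
  then obtain B where "\<forall>w\<in>cball 0 (cmod z). cmod (g w) \<le> B"
    by (auto simp: bounded_iff)
  then have B: "\<And>w. cmod w \<le> cmod z \<Longrightarrow> cmod (g w) \<le> B" by simp
  have le: "t * cmod z \<le> cmod z" if "0 \<le> t" "t < 1" for t
    using mult_right_mono[of t 1 "cmod z"] that by simp
  have "continuous_on {0..<1} (\<lambda>t. g (of_real t * z))"
    by (rule continuous_on_compose2[OF gc]) (auto simp: norm_mult le intro!: continuous_intros)
  then show ?thesis
    by (intro finite_measure.integrable_const_bound[OF MplusD(1)[OF \<mu>], of _ B])
       (auto simp: MplusD(3)[OF \<mu>] norm_mult le intro!: AE_I2 B Mplus_measurable_continuous[OF \<mu>])
qed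

lemma Cop_eq: "Cop \<mu> \<omega> f z = (LINT t|\<mu>. f (of_real t * z) * kernel \<omega> 1 (of_real t * z))"
  unfolding Cop_def by (subst kernel_eq) simp

text \<open>If \<open>a n\<close> are the Taylor coefficients of \<open>f\<close> times the kernel,
  then \<open>Cop \<mu> \<omega> f\<close> has the Taylor coefficients
  \<open>a n * measure_moment \<mu> n\<close>. An \<open>op_bound\<close> demands holomorphic
  images, so this is part of every sufficiency claim.\<close>

lemma Cop_holomorphic:
  assumes \<mu>: "\<mu> \<in> Mplus" and f: "f holomorphic_on ball 0 1"
  shows "Cop \<mu> \<omega> f holomorphic_on ball 0 1"
proof -
  define g where "g w = f w * kernel \<omega> 1 w" for w
  have g: "g holomorphic_on ball 0 1"
    unfolding g_def[abs_def] by (intro holomorphic_intros f kernel_holomorphic)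
  define a where "a n = (deriv ^^ n) g 0 / fact n" for n
  have a: "(\<lambda>n. a n * w ^ n) sums g w" if "cmod w < 1" for w
    using holomorphic_power_series[OF g, of w] that by (simp add: a_def)
  show ?thesis
  proof (rule power_series_holomorphic)
    fix z :: complex assume "z \<in> ball 0 1"
    then have z: "cmod z < 1" by simp
    \<comment> \<open>A point of larger modulus inside the disc gives absolute convergence at
      \<open>z\<close>, which dominates the series uniformly in \<open>t\<close>.\<close>
    define x :: complex where "x = of_real ((1 + cmod z) / 2)"
    have x: "cmod z < cmod x" "cmod x < 1" using z by (simp_all add: x_def abs_of_nonneg del: of_real_divide of_real_add)
    have asm: "summable (\<lambda>n. norm (a n * z ^ n))"
      by (rule powser_insidea[OF sums_summable[OF a[OF x(2)]] x(1)])
    let ?h = "\<lambda>n t. a n * z ^ n * of_real (t ^ n)"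
    have hi: "integrable \<mu> (?h n)" for n
    proof -
      have "integrable \<mu> (\<lambda>t. of_real t ^ n :: complex)"
        by (intro finite_measure.integrable_const_bound[OF MplusD(1)[OF \<mu>], of _ 1])
           (auto simp: MplusD(3)[OF \<mu>] norm_power power_le_one intro!: AE_I2 Mplus_measurable_borel[OF \<mu>])
      then show ?thesis by (intro integrable_mult_right) simp
    qed
    have hn: "norm (?h n t) \<le> norm (a n * z ^ n)" if "t \<in> space \<mu>" for n t
      using that mult_left_le[of "t ^ n" "norm (a n * z ^ n)"]
      by (simp add: MplusD(3)[OF \<mu>] norm_mult norm_power power_le_one)
    have m1: "(\<lambda>n. integral\<^sup>L \<mu> (?h n)) sums (LINT t|\<mu>. (\<Sum>n. ?h n t))"
    proof (rule sums_integral[OF hi])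
      show "AE t in \<mu>. summable (\<lambda>n. norm (?h n t))"
        by (intro AE_I2 summable_comparison_test'[OF asm, of 0]) (use hn in auto)
      have "norm (LINT t|\<mu>. norm (?h n t)) \<le> norm (a n * z ^ n) * measure \<mu> (space \<mu>)" for n
      proof -
        have "(LINT t|\<mu>. norm (?h n t)) \<le> (LINT t|\<mu>. norm (a n * z ^ n))"
          by (intro integral_mono integrable_norm hi finite_measure.integrable_const[OF MplusD(1)[OF \<mu>]] hn)
        then show ?thesis by (simp add: mult.commute)
      qed
      then show "summable (\<lambda>n. LINT t|\<mu>. norm (?h n t))"
        by (intro summable_comparison_test'[OF summable_mult2[OF asm, of "measure \<mu> (space \<mu>)"], of 0]) auto
    qed
    have m2: "integral\<^sup>L \<mu> (?h n) = (a n * of_real (measure_moment \<mu> n)) * (z - 0) ^ n" for n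
      unfolding measure_moment_def by (simp del: of_real_power add: integral_complex_of_real)
    have m3: "(LINT t|\<mu>. (\<Sum>n. ?h n t)) = Cop \<mu> \<omega> f z"
      unfolding Cop_eq
    proof (rule Bochner_Integration.integral_cong[OF refl])
      fix t assume "t \<in> space \<mu>"
      then have "cmod (of_real t * z) < 1"
        using norm_of_real_mult_less(1)[of t z] z by (simp add: MplusD(3)[OF \<mu>])
      from sums_unique[OF a[OF this]] show "(\<Sum>n. ?h n t) = f (of_real t * z) * kernel \<omega> 1 (of_real t * z)"
        by (simp add: g_def power_mult_distrib mult_ac)
    qed
    show "(\<lambda>n. (a n * of_real (measure_moment \<mu> n)) * (z - 0) ^ n) sums Cop \<mu> \<omega> f z"
      using m1 unfolding m2 m3 .
  qed
qed

lemma Cop_norm_le: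
  assumes \<mu>: "\<mu> \<in> Mplus" and f: "f \<in> analytic_space (X_norm \<beta>)" and z: "cmod z < 1"
  shows "ennreal (cmod (Cop \<mu> \<omega> f z)) \<le> (\<integral>\<^sup>+ t. ennreal (enn2real (X_norm \<beta> f) *
    ((1 - t * cmod z) powr (- \<beta>) * cmod (kernel \<omega> 1 (of_real t * z)))) \<partial>\<mu>)"
proof -
  have hol: "(\<lambda>w. f w * kernel \<omega> 1 w) holomorphic_on ball 0 1"
    using f by (intro holomorphic_intros kernel_holomorphic) (simp add: analytic_space_def)
  have "ennreal (cmod (Cop \<mu> \<omega> f z)) \<le> (\<integral>\<^sup>+ t. norm (f (of_real t * z) * kernel \<omega> 1 (of_real t * z)) \<partial>\<mu>)"
    unfolding Cop_eq using Cop_integrable[OF \<mu> hol z] by (rule integral_norm_bound_ennreal)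
  also have "\<dots> \<le> (\<integral>\<^sup>+ t. ennreal (enn2real (X_norm \<beta> f) *
    ((1 - t * cmod z) powr (- \<beta>) * cmod (kernel \<omega> 1 (of_real t * z)))) \<partial>\<mu>)"
  proof (intro nn_integral_mono ennreal_leI)
    fix t assume "t \<in> space \<mu>"
    then have t: "0 \<le> t" "t < 1" by (auto simp: MplusD(3)[OF \<mu>])
    note n = norm_of_real_mult_less[OF t z]
    have "cmod (f (of_real t * z)) \<le> enn2real (X_norm \<beta> f) * (1 - t * cmod z) powr (- \<beta>)"
      using X_norm_pointwise[OF f n(1)] n(2) by simp
    then show "norm (f (of_real t * z) * kernel \<omega> 1 (of_real t * z)) \<le>
        enn2real (X_norm \<beta> f) * ((1 - t * cmod z) powr (- \<beta>) * cmod (kernel \<omega> 1 (of_real t * z)))"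
      unfolding norm_mult mult.assoc[symmetric] by (rule mult_right_mono) simp
  qed
  finally show ?thesis .
qed

lemma kernel_size_split:
  assumes "x < 1"
  shows "(1 - x) powr (- \<beta>) * \<Phi> 0 x = \<Phi> \<beta> x"
  using assms by (simp add: kernel_size_def powr_diff)

text \<open>At a point of the radius the test function and the kernel are nonnegative along the
  whole integral, so its modulus is the integral itself and nothing cancels; the lower kernel bound
  then applies pointwise.\<close>

lemma kernel_size_le_Cop:
  obtains C where "C > 0"
    "\<And>\<mu> \<beta> x. \<mu> \<in> Mplus \<Longrightarrow> 0 \<le> x \<Longrightarrow> x < 1 \<Longrightarrow>
      (\<integral>\<^sup>+ t. ennreal (\<Phi> \<beta> (t * x)) \<partial>\<mu>) \<le> ennreal (C * cmod (Cop \<mu> \<omega> (test_fun \<beta>) (of_real x)))"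
proof -
  obtain C where C: "C > 0" "\<And>x. 0 \<le> x \<Longrightarrow> x < 1 \<Longrightarrow> \<Phi> 0 x \<le> C * real_kernel \<omega> x"
    using real_kernel_lower by blast
  show ?thesis
  proof (rule that[OF C(1)])
    fix \<mu> and \<beta> x :: real assume \<mu>: "\<mu> \<in> Mplus" and x: "0 \<le> x" "x < 1"
    let ?g = "\<lambda>w. test_fun \<beta> w * kernel \<omega> 1 w"
    have int: "integrable \<mu> (\<lambda>t. ?g (of_real t * of_real x))"
      using x by (intro Cop_integrable[OF \<mu>] holomorphic_intros test_fun_holomorphic kernel_holomorphic) auto
    have val: "?g (of_real t * of_real x) = of_real ((1 - t * x) powr (- \<beta>) * real_kernel \<omega> (t * x))"
      "\<Phi> \<beta> (t * x) \<le> C * ((1 - t * x) powr (- \<beta>) * real_kernel \<omega> (t * x))"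
      "0 \<le> (1 - t * x) powr (- \<beta>) * real_kernel \<omega> (t * x)"
      if "t \<in> space \<mu>" for t
    proof -
      have t: "0 \<le> t" "t < 1" using that by (auto simp: MplusD(3)[OF \<mu>])
      have "t * x < 1" using norm_of_real_mult_less(3)[OF t, of "of_real x"] x by simp
      with t x have tx: "0 \<le> t * x" "t * x < 1" by auto
      show "?g (of_real t * of_real x) = of_real ((1 - t * x) powr (- \<beta>) * real_kernel \<omega> (t * x))"
        unfolding of_real_mult[symmetric] kernel_of_real[OF tx] test_fun_of_real[OF tx(2)] by simp
      have "\<Phi> \<beta> (t * x) = (1 - t * x) powr (- \<beta>) * \<Phi> 0 (t * x)"
        using kernel_size_split tx by simp
      also have "\<dots> \<le> (1 - t * x) powr (- \<beta>) * (C * real_kernel \<omega> (t * x))"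
        by (intro mult_left_mono C(2) tx) auto
      finally show "\<Phi> \<beta> (t * x) \<le> C * ((1 - t * x) powr (- \<beta>) * real_kernel \<omega> (t * x))"
        by (simp add: mult_ac)
      have "0 < C * real_kernel \<omega> (t * x)"
        using C(2)[OF tx] kernel_size_pos[OF tx, of 0] by linarith
      then have "0 < real_kernel \<omega> (t * x)" using C(1) by (simp add: zero_less_mult_iff)
      then show "0 \<le> (1 - t * x) powr (- \<beta>) * real_kernel \<omega> (t * x)" by simp
    qed
    let ?h = "\<lambda>t. (1 - t * x) powr (- \<beta>) * real_kernel \<omega> (t * x)"
    have "integrable \<mu> (\<lambda>t. complex_of_real (?h t))"
    proof -
      have "integrable \<mu> (\<lambda>t. ?g (of_real t * of_real x)) \<longleftrightarrow> integrable \<mu> (\<lambda>t. complex_of_real (?h t))"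
        by (intro Bochner_Integration.integrable_cong refl val(1))
      with int show ?thesis by blast
    qed
    then have hint: "integrable \<mu> ?h" by (simp only: complex_of_real_integrable_eq)
    have "Cop \<mu> \<omega> (test_fun \<beta>) (of_real x) = (LINT t|\<mu>. complex_of_real (?h t))"
      unfolding Cop_eq by (intro Bochner_Integration.integral_cong refl val(1))
    then have "cmod (Cop \<mu> \<omega> (test_fun \<beta>) (of_real x)) = \<bar>LINT t|\<mu>. ?h t\<bar>"
      by (simp only: integral_complex_of_real norm_of_real)
    also have "\<dots> = (LINT t|\<mu>. ?h t)"
      using val(3) by (intro abs_of_nonneg integral_nonneg_AE AE_I2) auto
    finally have eq: "cmod (Cop \<mu> \<omega> (test_fun \<beta>) (of_real x)) = (LINT t|\<mu>. ?h t)" .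
    have "(\<integral>\<^sup>+ t. ennreal (\<Phi> \<beta> (t * x)) \<partial>\<mu>) \<le> (\<integral>\<^sup>+ t. ennreal (C * ?h t) \<partial>\<mu>)"
      using val(2) by (intro nn_integral_mono ennreal_leI)
    also have "\<dots> = ennreal (LINT t|\<mu>. C * ?h t)"
      using hint C val(3) by (intro nn_integral_eq_integral AE_I2) auto
    also have "(LINT t|\<mu>. C * ?h t) = C * cmod (Cop \<mu> \<omega> (test_fun \<beta>) (of_real x))"
      by (simp add: eq)
    finally show "(\<integral>\<^sup>+ t. ennreal (\<Phi> \<beta> (t * x)) \<partial>\<mu>) \<le> ennreal (C * cmod (Cop \<mu> \<omega> (test_fun \<beta>) (of_real x)))" .
  qed
qed

end

section \<open>Growth spaces as targets\<close>

text \<open>Tails of the weight and of \<mu> are measurable because they are monotone. Monotonicity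
  is known for nonnegative arguments only, hence the restriction to a set \<open>A\<close>.\<close>

lemma antimono_on_borel_measurable:
  fixes f :: "real \<Rightarrow> real"
  assumes "\<And>x y. x \<in> A \<Longrightarrow> y \<in> A \<Longrightarrow> x \<le> y \<Longrightarrow> f y \<le> f x"
  shows "f \<in> borel_measurable (restrict_space borel A)"
proof -
  have "(\<lambda>x. - f x) \<in> borel_measurable (restrict_space borel A)"
    by (rule borel_measurable_mono_on_fnc) (use assms in \<open>auto intro!: mono_onI\<close>)
  then have "(\<lambda>x. - (- f x)) \<in> borel_measurable (restrict_space borel A)"
    by (rule borel_measurable_uminus)
  then show ?thesis by simp
qed

lemma measurable_restrict_lborel:
  "borel_measurable (restrict_space lborel A) = borel_measurable (restrict_space borel A)"
  by (rule measurable_cong_sets[OF sets_restrict_space_cong[OF sets_lborel] refl])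

lemma mult_in_unit:
  fixes t r :: real
  assumes "0 \<le> t" "t < 1" "0 \<le> r" "r \<le> 1"
  shows "0 \<le> t * r" "t * r < 1" "t * r \<le> t"
proof -
  have "t * r \<le> t * 1" using assms by (intro mult_left_mono) auto
  then show "0 \<le> t * r" "t * r < 1" "t * r \<le> t" using assms by auto
qed

text \<open>Estimates in both directions give equivalence and comparison at once: the upper one
  shows that the set of admissible constants is nonempty, the lower one bounds each of its elements
  from below. \<open>C\<close> and \<open>c\<close> are chosen before \<mu>, as comparability
  asks.\<close>

lemma ratio_characterization:
  assumes C: "0 < C" and c: "0 < c"
    and upper: "\<And>\<mu>. \<mu> \<in> A \<Longrightarrow> fin \<mu> \<Longrightarrow> op_bound NX NY (T \<mu>) (C * Q \<mu>)"
    and lower: "\<And>\<mu> K. \<mu> \<in> A \<Longrightarrow> op_bound NX NY (T \<mu>) K \<Longrightarrow> fin \<mu> \<and> Q \<mu> \<le> c * K"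
  shows "(\<forall>\<mu>\<in>A. bounded_op NX NY (T \<mu>) \<longleftrightarrow> fin \<mu>)
    \<and> comparable_on {\<mu>\<in>A. bounded_op NX NY (T \<mu>)} (\<lambda>\<mu>. op_norm NX NY (T \<mu>)) Q"
proof
  show 1: "\<forall>\<mu>\<in>A. bounded_op NX NY (T \<mu>) \<longleftrightarrow> fin \<mu>"
    using upper lower unfolding bounded_op_def by blast
  show "comparable_on {\<mu>\<in>A. bounded_op NX NY (T \<mu>)} (\<lambda>\<mu>. op_norm NX NY (T \<mu>)) Q"
  proof -
    have "1 / c * Q \<mu> \<le> op_norm NX NY (T \<mu>) \<and> op_norm NX NY (T \<mu>) \<le> C * Q \<mu>"
      if "\<mu> \<in> {\<mu>\<in>A. bounded_op NX NY (T \<mu>)}" for \<mu>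
    proof
      have \<mu>: "\<mu> \<in> A" "fin \<mu>" using that 1 by auto
      have ob: "op_bound NX NY (T \<mu>) (C * Q \<mu>)" by (rule upper[OF \<mu>])
      show "1 / c * Q \<mu> \<le> op_norm NX NY (T \<mu>)"
        unfolding op_norm_def
      proof (rule cInf_greatest)
        fix K assume "K \<in> {K. op_bound NX NY (T \<mu>) K}"
        then have "Q \<mu> \<le> c * K" using lower[OF \<mu>(1)] by blast
        then show "1 / c * Q \<mu> \<le> K" using c by (simp add: field_simps)
      qed (use ob in blast)
      show "op_norm NX NY (T \<mu>) \<le> C * Q \<mu>"
        unfolding op_norm_def
      proof (rule cInf_lower)
        show "bdd_below {K. op_bound NX NY (T \<mu>) K}"
          by (rule bdd_belowI[of _ 0]) (simp add: op_bound_def)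
      qed (use ob in simp)
    qed
    moreover have "0 < 1 / c" using c by simp
    ultimately show ?thesis
      using C unfolding comparable_on_def by blast
  qed
qed

section \<open>Estimates by moment ratios\<close>

context Dhat_weight
begin

lemma weight_tail_measurable:
  assumes "0 \<le> r" "r \<le> 1"
  shows "(\<lambda>t. tail (t * r)) \<in> borel_measurable (restrict_space borel {0..<1})"
  by (rule antimono_on_borel_measurable)
     (use assms in \<open>auto intro!: weight_tail_antimono mult_right_mono\<close>)

lemma kernel_size_measurable:
  assumes "\<mu> \<in> Mplus" "0 \<le> r" "r \<le> 1"
  shows "(\<lambda>t. \<Phi> \<alpha> (t * r)) \<in> borel_measurable \<mu>"
proof (rule Mplus_measurable[OF assms(1)])
  have [measurable]: "(\<lambda>t. tail (t * r)) \<in> borel_measurable (restrict_space borel {0..<1})"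
    by (rule weight_tail_measurable[OF assms(2,3)])
  have [measurable]: "(\<lambda>t. (1 - t * r) powr (- \<alpha> - 1)) \<in> borel_measurable (restrict_space borel {0..<1})"
    by (rule measurable_restrict_space1) measurable
  show "(\<lambda>t. \<Phi> \<alpha> (t * r)) \<in> borel_measurable (restrict_space borel {0..<1})"
    unfolding kernel_size_def by measurable
qed

lemma op_bound_Cop:
  assumes \<mu>: "\<mu> \<in> Mplus" and c: "0 \<le> c"
    and le: "\<And>f. f \<in> analytic_space (X_norm \<beta>) \<Longrightarrow> N (Cop \<mu> \<omega> f) \<le> ennreal (c * enn2real (X_norm \<beta> f))"
  shows "op_bound (X_norm \<beta>) N (Cop \<mu> \<omega>) c"
  unfolding op_bound_def
proof (intro conjI ballI c)
  fix f assume f: "f \<in> analytic_space (X_norm \<beta>)"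
  then have hol: "f holomorphic_on ball 0 1" and fin: "X_norm \<beta> f < \<infinity>"
    by (auto simp: analytic_space_def)
  have "N (Cop \<mu> \<omega> f) < \<infinity>" by (rule le_less_trans[OF le[OF f]]) simp
  then show "Cop \<mu> \<omega> f \<in> analytic_space N"
    using Cop_holomorphic[OF \<mu> hol] by (simp add: analytic_space_def)
  show "N (Cop \<mu> \<omega> f) \<le> ennreal c * X_norm \<beta> f"
    using le[OF f] c fin by (simp add: ennreal_mult)
qed

lemma op_bound_test_fun:
  assumes \<beta>: "0 \<le> \<beta>" and ob: "op_bound (X_norm \<beta>) N (Cop \<mu> \<omega>) K"
  shows "0 \<le> K" "Cop \<mu> \<omega> (test_fun \<beta>) \<in> analytic_space N" "N (Cop \<mu> \<omega> (test_fun \<beta>)) \<le> ennreal K"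
    "Cop \<mu> \<omega> (test_fun \<beta>) holomorphic_on ball 0 1"
proof -
  show "0 \<le> K" and F: "Cop \<mu> \<omega> (test_fun \<beta>) \<in> analytic_space N"
    using ob test_fun_norm(2)[OF \<beta>] by (auto simp: op_bound_def)
  then show "Cop \<mu> \<omega> (test_fun \<beta>) holomorphic_on ball 0 1" by (simp add: analytic_space_def)
  have "N (Cop \<mu> \<omega> (test_fun \<beta>)) \<le> ennreal K * X_norm \<beta> (test_fun \<beta>)"
    using ob test_fun_norm(2)[OF \<beta>] by (simp add: op_bound_def)
  also have "\<dots> \<le> ennreal K * 1" by (intro mult_left_mono test_fun_norm(1)[OF \<beta>]) simp
  finally show "N (Cop \<mu> \<omega> (test_fun \<beta>)) \<le> ennreal K" by simp
qed

lemma moment_ratio_nonneg: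
  assumes "\<mu> \<in> Mplus"
  shows "0 \<le> moment_ratio \<alpha> \<omega> \<mu> n"
  unfolding moment_ratio_def
  using measure_moment_ennreal(2)[OF assms] weight_moment_pos[of n] by simp

text \<open>A real supremum is meaningful only for a bounded family. The upper estimate is therefore
  asked for every bound \<open>Q\<close> of the ratios, and the lower one for each single
  ratio.\<close>

lemma moment_characterization:
  assumes C: "0 < C" and c: "0 < c"
    and upper: "\<And>\<mu> Q. \<mu> \<in> Mplus \<Longrightarrow> 0 \<le> Q \<Longrightarrow> (\<And>n. moment_ratio \<delta> \<omega> \<mu> n \<le> Q) \<Longrightarrow> op_bound NX NY (Cop \<mu> \<omega>) (C * Q)"
    and lower: "\<And>\<mu> K n. \<mu> \<in> Mplus \<Longrightarrow> op_bound NX NY (Cop \<mu> \<omega>) K \<Longrightarrow> moment_ratio \<delta> \<omega> \<mu> n \<le> c * K"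
  shows "(\<forall>\<mu>\<in>Mplus. bounded_op NX NY (Cop \<mu> \<omega>) \<longleftrightarrow> bdd_above (range (moment_ratio \<delta> \<omega> \<mu>)))
    \<and> comparable_on {\<mu>\<in>Mplus. bounded_op NX NY (Cop \<mu> \<omega>)} (\<lambda>\<mu>. op_norm NX NY (Cop \<mu> \<omega>))
        (\<lambda>\<mu>. SUP n. moment_ratio \<delta> \<omega> \<mu> n)"
proof (rule ratio_characterization[OF C c])
  fix \<mu> assume \<mu>: "\<mu> \<in> Mplus" and fin: "bdd_above (range (moment_ratio \<delta> \<omega> \<mu>))"
  have le: "moment_ratio \<delta> \<omega> \<mu> n \<le> (SUP n. moment_ratio \<delta> \<omega> \<mu> n)" for n
    by (rule cSUP_upper[OF _ fin]) simp
  from upper[OF \<mu> order_trans[OF moment_ratio_nonneg[OF \<mu>] le[of 0]] le]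
  show "op_bound NX NY (Cop \<mu> \<omega>) (C * (SUP n. moment_ratio \<delta> \<omega> \<mu> n))" .
next
  fix \<mu> K assume "\<mu> \<in> Mplus" "op_bound NX NY (Cop \<mu> \<omega>) K"
  note le = lower[OF this]
  show "bdd_above (range (moment_ratio \<delta> \<omega> \<mu>)) \<and> (SUP n. moment_ratio \<delta> \<omega> \<mu> n) \<le> c * K"
    by (intro conjI bdd_aboveI2[OF le] cSUP_least le) simp
qed

text \<open>The exponents are arranged such that \<open>(n + 1) powr \<alpha>\<close> from the
  expansion and \<open>(n + 1) powr (\<gamma> - \<alpha> - 1)\<close> from the ratio multiply to
  \<open>(n + 1) powr (\<gamma> - 1)\<close>, whose power series grows at most like
  \<open>(1 - r) powr (- \<gamma>)\<close>. A general \<alpha> is kept because circle means need a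
  value below \<beta>, possibly negative.\<close>

lemma kernel_size_integral_le:
  assumes "\<alpha> > -1" "\<gamma> > 0"
  obtains C where "C > 0"
    "\<And>\<mu> Q r. \<mu> \<in> Mplus \<Longrightarrow> 0 \<le> Q \<Longrightarrow> (\<And>n. moment_ratio (\<gamma> - \<alpha> - 1) \<omega> \<mu> n \<le> Q) \<Longrightarrow> 0 \<le> r \<Longrightarrow> r < 1 \<Longrightarrow>
      (\<integral>\<^sup>+ t. ennreal (\<Phi> \<alpha> (t * r)) \<partial>\<mu>) \<le> ennreal (C * Q * (1 - r) powr (- \<gamma>))"
proof -
  obtain C1 where C1: "C1 > 0"
    "\<And>x. 0 \<le> x \<Longrightarrow> x < 1 \<Longrightarrow>
       \<exists>M. \<Phi> \<alpha> x \<le> C1 * (\<Sum>n<M. x ^ n * real (Suc n) powr \<alpha> / moment n)"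
    using kernel_size_le_sum[OF assms(1)] by blast
  obtain C2 where C2: "C2 > 0"
    "\<And>r. 0 \<le> r \<Longrightarrow> r < 1 \<Longrightarrow> summable (\<lambda>n. real (Suc n) powr (\<gamma> - 1) * r ^ n)"
    "\<And>r. 0 \<le> r \<Longrightarrow> r < 1 \<Longrightarrow> (\<Sum>n. real (Suc n) powr (\<gamma> - 1) * r ^ n) \<le> C2 * (1 - r) powr (- \<gamma>)"
    using powr_geometric_bound[OF assms(2)] by blast
  show ?thesis
  proof (rule that[of "C1 * C2"])
    show "0 < C1 * C2" using C1 C2 by simp
    fix \<mu> and Q r :: real
    assume \<mu>: "\<mu> \<in> Mplus" and Q: "0 \<le> Q" "\<And>n. moment_ratio (\<gamma> - \<alpha> - 1) \<omega> \<mu> n \<le> Q" and r: "0 \<le> r" "r < 1"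
    note mp = weight_moment_pos
    define c where "c n = C1 * (real (Suc n) powr \<alpha> / moment n) * r ^ n" for n
    have c: "0 \<le> c n" for n using C1 r mp[of n] by (simp add: c_def)
    have "(\<integral>\<^sup>+ t. ennreal (\<Phi> \<alpha> (t * r)) \<partial>\<mu>) \<le> (\<integral>\<^sup>+ t. (\<Sum>n. ennreal (c n) * ennreal (t ^ n)) \<partial>\<mu>)"
    proof (intro nn_integral_mono)
      fix t assume "t \<in> space \<mu>"
      then have t: "0 \<le> t" "t < 1" by (auto simp: MplusD(3)[OF \<mu>])
      have tr: "0 \<le> t * r" "t * r < 1" using mult_in_unit[OF t r(1)] r by auto
      obtain M where M: "\<Phi> \<alpha> (t * r) \<le> C1 * (\<Sum>n<M. (t * r) ^ n * real (Suc n) powr \<alpha> / moment n)"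
        using C1(2)[OF tr] by blast
      also have "\<dots> = (\<Sum>n<M. c n * t ^ n)"
        by (simp add: sum_distrib_left c_def power_mult_distrib mult_ac)
      finally have "ennreal (\<Phi> \<alpha> (t * r)) \<le> ennreal (\<Sum>n<M. c n * t ^ n)"
        by (rule ennreal_leI)
      also have "\<dots> = (\<Sum>n<M. ennreal (c n) * ennreal (t ^ n))"
        using c t by (subst sum_ennreal[symmetric]) (auto simp: ennreal_mult)
      also have "\<dots> \<le> (\<Sum>n. ennreal (c n) * ennreal (t ^ n))"
        by (intro sum_le_suminf) auto
      finally show "ennreal (\<Phi> \<alpha> (t * r)) \<le> (\<Sum>n. ennreal (c n) * ennreal (t ^ n))" .
    qed
    also have "\<dots> = (\<Sum>n. \<integral>\<^sup>+ t. ennreal (c n) * ennreal (t ^ n) \<partial>\<mu>)"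
      by (intro nn_integral_suminf Mplus_measurable_borel[OF \<mu>]) measurable
    also have "\<dots> = (\<Sum>n. ennreal (c n) * ennreal (measure_moment \<mu> n))"
      unfolding measure_moment_ennreal(1)[OF \<mu>]
      by (intro suminf_cong nn_integral_cmult Mplus_measurable_borel[OF \<mu>]) measurable
    also have "\<dots> \<le> (\<Sum>n. ennreal (C1 * Q * (real (Suc n) powr (\<gamma> - 1) * r ^ n)))"
    proof (intro suminf_le)
      fix n
      define s where "s = real (Suc n)"
      have s: "s > 0" by (simp add: s_def)
      have "measure_moment \<mu> n / (moment n * s powr (\<gamma> - \<alpha> - 1)) \<le> Q"
        using Q(2)[of n] by (simp add: moment_ratio_def s_def)
      then have "measure_moment \<mu> n / moment n \<le> Q * s powr (\<gamma> - \<alpha> - 1)"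
        using s mp[of n] by (simp add: field_simps)
      then have "(C1 * s powr \<alpha> * r ^ n) * (measure_moment \<mu> n / moment n)
          \<le> (C1 * s powr \<alpha> * r ^ n) * (Q * s powr (\<gamma> - \<alpha> - 1))"
        using C1 r by (intro mult_left_mono) auto
      also have "\<dots> = C1 * Q * ((s powr \<alpha> * s powr (\<gamma> - \<alpha> - 1)) * r ^ n)" by simp
      also have "s powr \<alpha> * s powr (\<gamma> - \<alpha> - 1) = s powr (\<gamma> - 1)"
        by (simp flip: powr_add)
      finally have "c n * measure_moment \<mu> n \<le> C1 * Q * (s powr (\<gamma> - 1) * r ^ n)"
        by (simp add: c_def s_def)
      then show "ennreal (c n) * ennreal (measure_moment \<mu> n) \<le> ennreal (C1 * Q * (real (Suc n) powr (\<gamma> - 1) * r ^ n))"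
        using c measure_moment_ennreal(2)[OF \<mu>, of n]
        by (simp add: ennreal_leI s_def flip: ennreal_mult)
    qed auto
    also have "\<dots> = ennreal (\<Sum>n. C1 * Q * (real (Suc n) powr (\<gamma> - 1) * r ^ n))"
      using C1 Q r C2(2)[OF r] by (intro suminf_ennreal2 summable_mult) auto
    also have "(\<Sum>n. C1 * Q * (real (Suc n) powr (\<gamma> - 1) * r ^ n)) = C1 * Q * (\<Sum>n. real (Suc n) powr (\<gamma> - 1) * r ^ n)"
      by (rule suminf_mult[OF C2(2)[OF r]])
    also have "ennreal \<dots> \<le> ennreal (C1 * Q * (C2 * (1 - r) powr (- \<gamma>)))"
      using C1 Q C2(3)[OF r] by (intro ennreal_leI mult_left_mono) auto
    finally show "(\<integral>\<^sup>+ t. ennreal (\<Phi> \<alpha> (t * r)) \<partial>\<mu>) \<le> ennreal (C1 * C2 * Q * (1 - r) powr (- \<gamma>))"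
      by (simp add: mult_ac)
  qed
qed

text \<open>Evaluation at \<open>node n\<close>: there \<open>x ^ n\<close> is at least 1/3 and
  \<open>(1 - x) powr \<gamma>\<close> equals \<open>(n + 1) powr (- \<gamma>)\<close>, so the
  single-term bound at \<open>t * x\<close> isolates the moment of order \<open>n\<close>. The inner
  \<gamma> is later taken as the growth exponent itself or increased by 1/p.\<close>

lemma moment_ratio_le_test_fun:
  assumes "\<beta> \<ge> 0"
  obtains C where "C > 0"
    "\<And>\<mu> \<gamma> K n. \<mu> \<in> Mplus \<Longrightarrow>
      (\<And>x. 0 \<le> x \<Longrightarrow> x < 1 \<Longrightarrow> (1 - x) powr \<gamma> * cmod (Cop \<mu> \<omega> (test_fun \<beta>) (of_real x)) \<le> K) \<Longrightarrow>
      moment_ratio (\<gamma> - \<beta> - 1) \<omega> \<mu> n \<le> C * K"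
proof -
  obtain C1 where C1: "C1 > 0"
    "\<And>\<mu> \<beta> x. \<mu> \<in> Mplus \<Longrightarrow> 0 \<le> x \<Longrightarrow> x < 1 \<Longrightarrow>
      (\<integral>\<^sup>+ t. ennreal (\<Phi> \<beta> (t * x)) \<partial>\<mu>) \<le> ennreal (C1 * cmod (Cop \<mu> \<omega> (test_fun \<beta>) (of_real x)))"
    using kernel_size_le_Cop by blast
  have "\<beta> \<ge> -1" using assms by simp
  then obtain C2 where C2: "C2 > 0"
    "\<And>x n. 0 \<le> x \<Longrightarrow> x < 1 \<Longrightarrow>
       x ^ n * real (Suc n) powr (\<beta> + 1) / moment n \<le> C2 * \<Phi> \<beta> x"
    using power_le_kernel_size by blast
  show ?thesis
  proof (rule that[of "3 * C2 * C1"])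
    show "0 < 3 * C2 * C1" using C1 C2 by simp
    fix \<mu> and \<gamma> K :: real and n :: nat
    assume \<mu>: "\<mu> \<in> Mplus"
      and K: "\<And>x. 0 \<le> x \<Longrightarrow> x < 1 \<Longrightarrow> (1 - x) powr \<gamma> * cmod (Cop \<mu> \<omega> (test_fun \<beta>) (of_real x)) \<le> K"
    define s where "s = real (Suc n)"
    have s: "s > 0" by (simp add: s_def)
    define x where "x = node n"
    have x: "0 \<le> x" "x < 1" using node_bounds by (auto simp: x_def)
    note mp = weight_moment_pos[of n]
    note mm = measure_moment_ennreal[OF \<mu>, of n]
    define F where "F = cmod (Cop \<mu> \<omega> (test_fun \<beta>) (of_real x))"
    define e where "e = x ^ n * s powr (\<beta> + 1) / moment n"
    have e: "0 \<le> e" using x mp by (simp add: e_def)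
    have "ennreal (e * measure_moment \<mu> n) = ennreal e * (\<integral>\<^sup>+ t. ennreal (t ^ n) \<partial>\<mu>)"
      using e mm by (simp add: ennreal_mult)
    also have "\<dots> = (\<integral>\<^sup>+ t. ennreal e * ennreal (t ^ n) \<partial>\<mu>)"
      by (intro nn_integral_cmult[symmetric] Mplus_measurable_borel[OF \<mu>]) measurable
    also have "\<dots> \<le> (\<integral>\<^sup>+ t. ennreal C2 * ennreal (\<Phi> \<beta> (t * x)) \<partial>\<mu>)"
    proof (intro nn_integral_mono)
      fix t assume "t \<in> space \<mu>"
      then have t: "0 \<le> t" "t < 1" by (auto simp: MplusD(3)[OF \<mu>])
      have tx: "0 \<le> t * x" "t * x < 1" using mult_in_unit[OF t x(1)] x by auto
      have "e * t ^ n = (t * x) ^ n * real (Suc n) powr (\<beta> + 1) / moment n"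
        by (simp add: e_def s_def power_mult_distrib mult_ac)
      also have "\<dots> \<le> C2 * \<Phi> \<beta> (t * x)" by (rule C2(2)[OF tx])
      finally show "ennreal e * ennreal (t ^ n) \<le> ennreal C2 * ennreal (\<Phi> \<beta> (t * x))"
        using e t C2(1) kernel_size_pos[OF tx, of \<beta>]
        by (simp add: ennreal_leI flip: ennreal_mult)
    qed
    also have "\<dots> = ennreal C2 * (\<integral>\<^sup>+ t. ennreal (\<Phi> \<beta> (t * x)) \<partial>\<mu>)"
      using kernel_size_measurable[OF \<mu> x(1) less_imp_le[OF x(2)]] by (intro nn_integral_cmult) measurable
    also have "\<dots> \<le> ennreal C2 * ennreal (C1 * F)"
      unfolding F_def by (intro mult_left_mono C1(2)[OF \<mu> x]) auto
    also have "\<dots> = ennreal (C2 * (C1 * F))"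
      using C1 C2 by (intro ennreal_mult[symmetric]) (auto simp: F_def)
    finally have 1: "e * measure_moment \<mu> n \<le> C2 * (C1 * F)"
      using C1 C2 by (subst (asm) ennreal_le_iff) (auto simp: F_def)
    have "(1 - x) powr \<gamma> = s powr (- \<gamma>)"
      using s by (simp add: x_def one_minus_node s_def powr_divide powr_minus field_simps del: of_nat_Suc)
    then have "s powr (- \<gamma>) * F \<le> K" using K[OF x] by (simp add: F_def)
    then have 2: "(C2 * C1) * (s powr (- \<gamma>) * F) \<le> (C2 * C1) * K" using C1 C2 by (intro mult_left_mono) auto
    have "moment_ratio (\<gamma> - \<beta> - 1) \<omega> \<mu> n = (s powr (- \<gamma>) * s powr (\<beta> + 1)) * (measure_moment \<mu> n / moment n)"
    proof -
      have "- \<gamma> + (\<beta> + 1) = - (\<gamma> - \<beta> - 1)" by simp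
      then have eq: "s powr (- \<gamma>) * s powr (\<beta> + 1) = 1 / s powr (\<gamma> - \<beta> - 1)"
        by (metis powr_add powr_minus_divide)
      show ?thesis unfolding eq moment_ratio_def by (simp add: s_def)
    qed
    also have "\<dots> = (1 / 3) * ((3 * s powr (- \<gamma>)) * (s powr (\<beta> + 1) * (measure_moment \<mu> n / moment n)))"
      by simp
    also have "\<dots> \<le> x ^ n * ((3 * s powr (- \<gamma>)) * (s powr (\<beta> + 1) * (measure_moment \<mu> n / moment n)))"
      using node_power_ge[of n] mp mm(2) by (intro mult_right_mono) (auto simp: x_def)
    also have "\<dots> = 3 * (s powr (- \<gamma>) * (e * measure_moment \<mu> n))" by (simp add: e_def)
    also have "\<dots> \<le> 3 * (s powr (- \<gamma>) * (C2 * (C1 * F)))"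
      using 1 by (intro mult_left_mono) auto
    also have "\<dots> = 3 * ((C2 * C1) * (s powr (- \<gamma>) * F))" by simp
    also have "\<dots> \<le> 3 * ((C2 * C1) * K)" using 2 by simp
    finally show "moment_ratio (\<gamma> - \<beta> - 1) \<omega> \<mu> n \<le> 3 * C2 * C1 * K" by simp
  qed
qed

lemma Cop_norm_le_kernel_size:
  obtains C where "C > 0"
    "\<And>\<mu> \<beta> f z. \<mu> \<in> Mplus \<Longrightarrow> f \<in> analytic_space (X_norm \<beta>) \<Longrightarrow> cmod z < 1 \<Longrightarrow>
      ennreal (cmod (Cop \<mu> \<omega> f z)) \<le>
        (\<integral>\<^sup>+ t. ennreal (C * enn2real (X_norm \<beta> f) * \<Phi> \<beta> (t * cmod z)) \<partial>\<mu>)"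
proof -
  obtain C where C: "C > 0"
    "\<And>w. cmod w < 1 \<Longrightarrow> cmod (kernel \<omega> 1 w) \<le> C * \<Phi> 0 (cmod w)"
    "\<And>w. cmod w < 1 \<Longrightarrow> cmod (kernel \<omega> 1 w) \<le> C / (tail (cmod w) * cmod (1 - w))"
    using kernel_norm_bounds by blast
  show ?thesis
  proof (rule that[OF C(1)])
    fix \<mu> and \<beta> :: real and f and z :: complex
    assume \<mu>: "\<mu> \<in> Mplus" and f: "f \<in> analytic_space (X_norm \<beta>)" and z: "cmod z < 1"
    let ?N = "enn2real (X_norm \<beta> f)"
    have "ennreal (cmod (Cop \<mu> \<omega> f z)) \<le> (\<integral>\<^sup>+ t. ennreal (?N *
      ((1 - t * cmod z) powr (- \<beta>) * cmod (kernel \<omega> 1 (of_real t * z)))) \<partial>\<mu>)"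
      by (rule Cop_norm_le[OF \<mu> f z])
    also have "\<dots> \<le> (\<integral>\<^sup>+ t. ennreal (C * ?N * \<Phi> \<beta> (t * cmod z)) \<partial>\<mu>)"
    proof (intro nn_integral_mono ennreal_leI)
      fix t assume "t \<in> space \<mu>"
      then have t: "0 \<le> t" "t < 1" by (auto simp: MplusD(3)[OF \<mu>])
      note n = norm_of_real_mult_less[OF t z]
      have "?N * ((1 - t * cmod z) powr (- \<beta>) * cmod (kernel \<omega> 1 (of_real t * z)))
          \<le> ?N * ((1 - t * cmod z) powr (- \<beta>) * (C * \<Phi> 0 (t * cmod z)))"
        using C(2)[OF n(1)] n(2) by (intro mult_left_mono) auto
      also have "\<dots> = C * ?N * ((1 - t * cmod z) powr (- \<beta>) * \<Phi> 0 (t * cmod z))" by simp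
      also have "\<dots> = C * ?N * \<Phi> \<beta> (t * cmod z)"
        using kernel_size_split[OF n(3)] by simp
      finally show "?N * ((1 - t * cmod z) powr (- \<beta>) * cmod (kernel \<omega> 1 (of_real t * z)))
        \<le> C * ?N * \<Phi> \<beta> (t * cmod z)" .
    qed
    finally show "ennreal (cmod (Cop \<mu> \<omega> f z)) \<le>
      (\<integral>\<^sup>+ t. ennreal (C * ?N * \<Phi> \<beta> (t * cmod z)) \<partial>\<mu>)" .
  qed
qed

text \<open>The version for circle means: the second kernel bound combined with
  \<open>norm_one_minus_ge\<close>, which is the source of the factor 3.\<close>

lemma Cop_norm_le_arc_kernel:
  obtains C where "C > 0"
    "\<And>\<mu> \<beta> f r \<tau>. \<mu> \<in> Mplus \<Longrightarrow> f \<in> analytic_space (X_norm \<beta>) \<Longrightarrow> 0 \<le> r \<Longrightarrow> r < 1 \<Longrightarrow> 0 < \<tau> \<Longrightarrow> \<tau> < 1 \<Longrightarrow>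
      ennreal (cmod (Cop \<mu> \<omega> f (of_real r * cis (2 * pi * \<tau>)))) \<le>
        (\<integral>\<^sup>+ t. ennreal (C * enn2real (X_norm \<beta> f) *
          ((1 - t * r) powr (- \<beta>) / tail (t * r)) * (1 / (1 - t * r + arc_dist \<tau>))) \<partial>\<mu>)"
proof -
  obtain C where C: "C > 0"
    "\<And>w. cmod w < 1 \<Longrightarrow> cmod (kernel \<omega> 1 w) \<le> C * \<Phi> 0 (cmod w)"
    "\<And>w. cmod w < 1 \<Longrightarrow> cmod (kernel \<omega> 1 w) \<le> C / (tail (cmod w) * cmod (1 - w))"
    using kernel_norm_bounds by blast
  show ?thesis
  proof (rule that[of "3 * C"])
    show "0 < 3 * C" using C by simp
  next
    fix \<mu> and \<beta> :: real and f and r \<tau> :: real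
    assume \<mu>: "\<mu> \<in> Mplus" and f: "f \<in> analytic_space (X_norm \<beta>)" and r: "0 \<le> r" "r < 1" and \<tau>: "0 < \<tau>" "\<tau> < 1"
    let ?N = "enn2real (X_norm \<beta> f)"
    let ?z = "of_real r * cis (2 * pi * \<tau>)"
    have z: "cmod ?z = r" using r by (simp add: norm_mult)
    then have z1: "cmod ?z < 1" using r by simp
    have "ennreal (cmod (Cop \<mu> \<omega> f ?z)) \<le> (\<integral>\<^sup>+ t. ennreal (?N *
      ((1 - t * r) powr (- \<beta>) * cmod (kernel \<omega> 1 (of_real t * ?z)))) \<partial>\<mu>)"
      using Cop_norm_le[OF \<mu> f z1] z by simp
    also have "\<dots> \<le> (\<integral>\<^sup>+ t. ennreal (3 * C * ?N *
          ((1 - t * r) powr (- \<beta>) / tail (t * r)) * (1 / (1 - t * r + arc_dist \<tau>))) \<partial>\<mu>)"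
    proof (intro nn_integral_mono ennreal_leI)
      fix t assume "t \<in> space \<mu>"
      then have t: "0 \<le> t" "t < 1" by (auto simp: MplusD(3)[OF \<mu>])
      have n: "cmod (of_real t * ?z) < 1" "cmod (of_real t * ?z) = t * r" "t * r < 1"
        using norm_of_real_mult_less[OF t z1] z by auto
      have tr: "0 \<le> t * r" using t r by simp
      have wp: "0 < tail (t * r)" by (rule weight_tail_pos[OF tr n(3)])
      have d: "0 < 1 - t * r + arc_dist \<tau>" using n arc_dist_pos[OF \<tau>] by simp
      have eq: "of_real t * ?z = of_real (t * r) * cis (2 * pi * \<tau>)" by simp
      have d3: "1 - t * r + arc_dist \<tau> \<le> 3 * cmod (1 - of_real t * ?z)"
        unfolding eq using tr n \<tau> by (intro norm_one_minus_ge) auto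
      have "cmod (kernel \<omega> 1 (of_real t * ?z)) \<le> C / (tail (t * r) * cmod (1 - of_real t * ?z))"
        using C(3)[OF n(1)] n(2) by simp
      also have "\<dots> = C / tail (t * r) * (1 / cmod (1 - of_real t * ?z))" by simp
      also have "\<dots> \<le> C / tail (t * r) * (3 / (1 - t * r + arc_dist \<tau>))"
      proof (intro mult_left_mono)
        have "1 / c \<le> 3 / e" if "0 < e" "e \<le> 3 * c" for c e :: real
          using that by (simp add: field_simps)
        from this[OF d d3] show "1 / cmod (1 - of_real t * ?z) \<le> 3 / (1 - t * r + arc_dist \<tau>)" .
      qed (use C wp in auto)
      finally have "?N * ((1 - t * r) powr (- \<beta>) * cmod (kernel \<omega> 1 (of_real t * ?z)))
          \<le> ?N * ((1 - t * r) powr (- \<beta>) * (C / tail (t * r) * (3 / (1 - t * r + arc_dist \<tau>))))"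
        by (intro mult_left_mono) auto
      then show "?N * ((1 - t * r) powr (- \<beta>) * cmod (kernel \<omega> 1 (of_real t * ?z)))
        \<le> 3 * C * ?N * ((1 - t * r) powr (- \<beta>) / tail (t * r)) * (1 / (1 - t * r + arc_dist \<tau>))"
        by (simp add: mult_ac)
    qed
    finally show "ennreal (cmod (Cop \<mu> \<omega> f ?z)) \<le>
        (\<integral>\<^sup>+ t. ennreal (3 * C * ?N *
          ((1 - t * r) powr (- \<beta>) / tail (t * r)) * (1 / (1 - t * r + arc_dist \<tau>))) \<partial>\<mu>)" .
  qed
qed

text \<open>Both directions are pointwise: \<open>kernel_size_integral_le\<close> with \<alpha> =
  \<beta> bounds the image on each circle, and the test function at the nodes gives the
  converse.\<close>

lemma Cop_X_to_X:
  assumes \<beta>: "0 \<le> \<beta>" and \<gamma>: "0 < \<gamma>"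
  shows "(\<forall>\<mu>\<in>Mplus. bounded_op (X_norm \<beta>) (X_norm \<gamma>) (Cop \<mu> \<omega>)
         \<longleftrightarrow> bdd_above (range (moment_ratio (\<gamma> - \<beta> - 1) \<omega> \<mu>)))
     \<and> comparable_on {\<mu>\<in>Mplus. bounded_op (X_norm \<beta>) (X_norm \<gamma>) (Cop \<mu> \<omega>)}
         (\<lambda>\<mu>. op_norm (X_norm \<beta>) (X_norm \<gamma>) (Cop \<mu> \<omega>))
         (\<lambda>\<mu>. SUP n. moment_ratio (\<gamma> - \<beta> - 1) \<omega> \<mu> n)"
proof -
  have "\<beta> > -1" using \<beta> by simp
  then obtain C1 where C1: "C1 > 0"
    "\<And>\<mu> Q r. \<mu> \<in> Mplus \<Longrightarrow> 0 \<le> Q \<Longrightarrow> (\<And>n. moment_ratio (\<gamma> - \<beta> - 1) \<omega> \<mu> n \<le> Q) \<Longrightarrow> 0 \<le> r \<Longrightarrow> r < 1 \<Longrightarrow>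
      (\<integral>\<^sup>+ t. ennreal (\<Phi> \<beta> (t * r)) \<partial>\<mu>) \<le> ennreal (C1 * Q * (1 - r) powr (- \<gamma>))"
    using kernel_size_integral_le[OF _ \<gamma>] by blast
  obtain C2 where C2: "C2 > 0"
    "\<And>\<mu> \<beta> f z. \<mu> \<in> Mplus \<Longrightarrow> f \<in> analytic_space (X_norm \<beta>) \<Longrightarrow> cmod z < 1 \<Longrightarrow>
      ennreal (cmod (Cop \<mu> \<omega> f z)) \<le>
        (\<integral>\<^sup>+ t. ennreal (C2 * enn2real (X_norm \<beta> f) * \<Phi> \<beta> (t * cmod z)) \<partial>\<mu>)"
    using Cop_norm_le_kernel_size by blast
  obtain C3 where C3: "C3 > 0"
    "\<And>\<mu> \<gamma> K n. \<mu> \<in> Mplus \<Longrightarrow>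
      (\<And>x. 0 \<le> x \<Longrightarrow> x < 1 \<Longrightarrow> (1 - x) powr \<gamma> * cmod (Cop \<mu> \<omega> (test_fun \<beta>) (of_real x)) \<le> K) \<Longrightarrow>
      moment_ratio (\<gamma> - \<beta> - 1) \<omega> \<mu> n \<le> C3 * K"
    using moment_ratio_le_test_fun[OF \<beta>] by blast
  show ?thesis
  proof (rule moment_characterization[of "C2 * C1" C3])
    show "0 < C2 * C1" "0 < C3" using C1 C2 C3 by auto
  next
    fix \<mu> and Q :: real
    assume \<mu>: "\<mu> \<in> Mplus" and Q: "0 \<le> Q" and mQ: "\<And>n. moment_ratio (\<gamma> - \<beta> - 1) \<omega> \<mu> n \<le> Q"
    show "op_bound (X_norm \<beta>) (X_norm \<gamma>) (Cop \<mu> \<omega>) (C2 * C1 * Q)"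
    proof (rule op_bound_Cop[OF \<mu>])
      show "0 \<le> C2 * C1 * Q" using C1 C2 Q by simp
      fix f assume f: "f \<in> analytic_space (X_norm \<beta>)"
      let ?N = "enn2real (X_norm \<beta> f)"
      show "X_norm \<gamma> (Cop \<mu> \<omega> f) \<le> ennreal (C2 * C1 * Q * ?N)"
        unfolding X_norm_def[of \<gamma>]
      proof (rule SUP_least)
        fix r :: real assume "r \<in> {0..<1}"
        then have r: "0 \<le> r" "r < 1" by auto
        let ?B = "C2 * ?N * (C1 * Q * (1 - r) powr (- \<gamma>))"
        have "Minfty r (Cop \<mu> \<omega> f) \<le> ?B"
          unfolding Minfty_def
        proof (rule cSUP_least)
          show "sphere 0 r \<noteq> ({} :: complex set)" using r by simp
          fix z :: complex assume "z \<in> sphere 0 r"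
          then have z: "cmod z = r" "cmod z < 1" using r by auto
          have "ennreal (cmod (Cop \<mu> \<omega> f z)) \<le>
              (\<integral>\<^sup>+ t. ennreal (C2 * ?N) * ennreal (\<Phi> \<beta> (t * r)) \<partial>\<mu>)"
            using C2(2)[OF \<mu> f z(2)] C2(1) z by (simp add: ennreal_mult')
          also have "\<dots> = ennreal (C2 * ?N) * (\<integral>\<^sup>+ t. ennreal (\<Phi> \<beta> (t * r)) \<partial>\<mu>)"
            using kernel_size_measurable[OF \<mu> r(1) less_imp_le[OF r(2)]] by (intro nn_integral_cmult) measurable
          also have "\<dots> \<le> ennreal (C2 * ?N) * ennreal (C1 * Q * (1 - r) powr (- \<gamma>))"
            by (intro mult_left_mono C1(2)[OF \<mu> Q mQ r]) auto
          also have "\<dots> = ennreal ?B"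
            using C1 C2 Q by (intro ennreal_mult[symmetric]) auto
          finally show "cmod (Cop \<mu> \<omega> f z) \<le> ?B"
            using C1 C2 Q by (subst (asm) ennreal_le_iff) auto
        qed
        then have "(1 - r) powr \<gamma> * Minfty r (Cop \<mu> \<omega> f) \<le> (1 - r) powr \<gamma> * ?B"
          by (intro mult_left_mono) auto
        also have "\<dots> = ((1 - r) powr \<gamma> * (1 - r) powr (- \<gamma>)) * (C2 * C1 * Q * ?N)" by simp
        also have "(1 - r) powr \<gamma> * (1 - r) powr (- \<gamma>) = 1" using r by (simp flip: powr_add)
        finally show "ennreal ((1 - r) powr \<gamma> * Minfty r (Cop \<mu> \<omega> f)) \<le> ennreal (C2 * C1 * Q * ?N)"
          by (simp add: ennreal_leI)
      qed
    qed
  next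
    fix \<mu> and K :: real and n assume \<mu>: "\<mu> \<in> Mplus" and ob: "op_bound (X_norm \<beta>) (X_norm \<gamma>) (Cop \<mu> \<omega>) K"
    let ?F = "Cop \<mu> \<omega> (test_fun \<beta>)"
    note F = op_bound_test_fun[OF \<beta> ob]
    have le: "enn2real (X_norm \<gamma> ?F) \<le> K" using F(1,3) by (simp add: enn2real_leI)
    have "(1 - x) powr \<gamma> * cmod (?F (of_real x)) \<le> K" if x: "0 \<le> x" "x < 1" for x
    proof -
      have "cmod (?F (of_real x)) \<le> enn2real (X_norm \<gamma> ?F) * (1 - x) powr (- \<gamma>)"
        using X_norm_pointwise[OF F(2), of "of_real x"] x by simp
      also have "\<dots> \<le> K * (1 - x) powr (- \<gamma>)" by (intro mult_right_mono le) auto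
      finally have "(1 - x) powr \<gamma> * cmod (?F (of_real x)) \<le> (1 - x) powr \<gamma> * (K * (1 - x) powr (- \<gamma>))"
        by (intro mult_left_mono) auto
      also have "\<dots> = K * ((1 - x) powr \<gamma> * (1 - x) powr (- \<gamma>))" by simp
      also have "(1 - x) powr \<gamma> * (1 - x) powr (- \<gamma>) = 1" using x by (simp flip: powr_add)
      finally show ?thesis by simp
    qed
    from C3(2)[OF \<mu> this] show "moment_ratio (\<gamma> - \<beta> - 1) \<omega> \<mu> n \<le> C3 * K" .
  qed
qed

end

section \<open>Weighted Hardy spaces as targets\<close>

text \<open>The measures live on trace sigma-algebras of the Borel sets; joint measurability is
  transferred from the plane through the identity maps.\<close>

lemma pair_borel_measurable:
  assumes "(\<lambda>x. x) \<in> borel_measurable M" "(\<lambda>x. x) \<in> borel_measurable N"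
    and "case_prod h \<in> borel_measurable (borel \<Otimes>\<^sub>M borel)"
  shows "case_prod h \<in> borel_measurable (M \<Otimes>\<^sub>M N)"
proof -
  have "(\<lambda>p. (fst p, snd p)) \<in> M \<Otimes>\<^sub>M N \<rightarrow>\<^sub>M borel \<Otimes>\<^sub>M borel"
    using measurable_compose[OF measurable_fst assms(1)] measurable_compose[OF measurable_snd assms(2)]
    by (rule measurable_Pair)
  then have "(\<lambda>p. case_prod h (fst p, snd p)) \<in> borel_measurable (M \<Otimes>\<^sub>M N)"
    by (rule measurable_compose[OF _ assms(3)])
  then show ?thesis by simp
qed

lemma Mplus_sigma_finite: "\<mu> \<in> Mplus \<Longrightarrow> sigma_finite_measure \<mu>"
  using MplusD(1) finite_measure_def by blast

lemma holomorphic_circle_measurable: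
  assumes "F holomorphic_on ball 0 1" "0 \<le> r" "r < 1"
  shows "(\<lambda>t. F (of_real r * cis (2 * pi * t))) \<in> borel_measurable borel"
proof (rule borel_measurable_continuous_onI)
  show "continuous_on UNIV (\<lambda>t. F (of_real r * cis (2 * pi * t)))"
    by (rule continuous_on_compose2[OF holomorphic_on_imp_continuous_on[OF assms(1)]])
       (use assms in \<open>auto simp: norm_mult intro!: continuous_intros\<close>)
qed

lemma Mp_powr_holomorphic:
  assumes "F holomorphic_on ball 0 1" "0 \<le> r" "r < 1" "p > 0"
  shows "ennreal (Mp p r F powr p) = (\<integral>\<^sup>+ t. ennreal (cmod (F (of_real r * cis (2 * pi * t))) powr p) \<partial>unit_lborel)"
proof (rule Mp_powr)
  show "continuous_on (sphere 0 r) F"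
    by (rule continuous_on_subset[OF holomorphic_on_imp_continuous_on[OF assms(1)]]) (use assms in auto)
qed (use assms in auto)

lemma Mp_nonneg: "0 \<le> Mp p r F"
  by (simp add: Mp_def)

lemma cauchy_arc_bound:
  assumes F: "F holomorphic_on ball 0 1" and \<rho>: "0 < \<rho>" "\<rho> < 1" and r: "0 \<le> r" "r < 1"
  shows "ennreal (cmod (F (of_real (\<rho> * r)))) \<le>
    (\<integral>\<^sup>+ t. ennreal (1 / (1 - r + arc_dist t)) * ennreal (3 * cmod (F (of_real \<rho> * cis (2 * pi * t)))) \<partial>unit_lborel)"
proof -
  have "ennreal (cmod (F (of_real (\<rho> * r)))) \<le>
    (\<integral>\<^sup>+ t. ennreal (cmod (F (of_real \<rho> * cis (2 * pi * t))) / cmod (1 - of_real r * cis (2 * pi * t))) \<partial>unit_lborel)"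
    by (rule cauchy_circle_bound[OF assms])
  also have "\<dots> \<le> (\<integral>\<^sup>+ t. ennreal (1 / (1 - r + arc_dist t)) * ennreal (3 * cmod (F (of_real \<rho> * cis (2 * pi * t)))) \<partial>unit_lborel)"
  proof (intro nn_integral_mono)
    fix t :: real assume "t \<in> space unit_lborel"
    then have t: "0 < t" "t < 1" by (auto simp: space_restrict_space)
    let ?a = "cmod (F (of_real \<rho> * cis (2 * pi * t)))"
    let ?b = "cmod (1 - of_real r * cis (2 * pi * t))"
    have d: "0 < 1 - r + arc_dist t" using arc_dist_pos[OF t] r by simp
    have "1 - r + arc_dist t \<le> 3 * ?b" using r t by (intro norm_one_minus_ge) auto
    moreover have "1 / c \<le> 3 / e" if "0 < e" "e \<le> 3 * c" for c e :: real
      using that by (simp add: field_simps)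
    ultimately have "1 / ?b \<le> 3 / (1 - r + arc_dist t)" using d by blast
    then have "?a * (1 / ?b) \<le> ?a * (3 / (1 - r + arc_dist t))" by (intro mult_left_mono) auto
    then have "ennreal (?a / ?b) \<le> ennreal (1 / (1 - r + arc_dist t) * (3 * ?a))"
      by (intro ennreal_leI) (simp add: mult_ac)
    also have "\<dots> = ennreal (1 / (1 - r + arc_dist t)) * ennreal (3 * ?a)"
      using d by (intro ennreal_mult) auto
    finally show "ennreal (?a / ?b) \<le> ennreal (1 / (1 - r + arc_dist t)) * ennreal (3 * ?a)" .
  qed
  finally show ?thesis .
qed

lemma powr_cancel_le:
  fixes a b p :: real
  assumes "0 < p" "0 \<le> b" "a powr p \<le> b powr p"
  shows "a \<le> b"
proof (rule ccontr)
  assume "\<not> a \<le> b"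
  then have "b powr p < a powr p" using assms by (intro powr_less_mono2) auto
  with assms show False by simp
qed

text \<open>Cauchy's formula on the circle of radius \<open>(1 + x) / 2\<close>, followed by Hoelder's inequality.\<close>

lemma Hp_weighted_pointwise:
  assumes p: "p > 1"
  obtains C where "C > 0"
    "\<And>F \<gamma> K x. F holomorphic_on ball 0 1 \<Longrightarrow> 0 \<le> \<gamma> \<Longrightarrow> 0 \<le> K \<Longrightarrow> Hp_weighted_norm p \<gamma> F \<le> ennreal K \<Longrightarrow>
      0 \<le> x \<Longrightarrow> x < 1 \<Longrightarrow> (1 - x) powr (\<gamma> + 1 / p) * cmod (F (of_real x)) \<le> C * 2 powr \<gamma> * K"
proof -
  \<comment> \<open>The exponent conjugate to \<open>p\<close>; the two identities derived from it
    make the weights below cancel.\<close>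
  define q where "q = p / (p - 1)"
  have q: "q > 1" using p by (simp add: q_def)
  have q1: "(1 - q) * (p - 1) = -1" "(q - 1) * p = q" using p by (simp_all add: q_def field_simps)
  define A where "A = (2 / (q - 1)) powr (p - 1) * 3 powr p"
  have A: "A > 0" using q by (simp add: A_def)
  show ?thesis
  proof (rule that[of "A powr (1 / p) * 2 powr (1 / p)"])
    show "0 < A powr (1 / p) * 2 powr (1 / p)" using A by simp
    fix F and \<gamma> K x :: real
    assume F: "F holomorphic_on ball 0 1" and \<gamma>: "0 \<le> \<gamma>" and K: "0 \<le> K" and le: "Hp_weighted_norm p \<gamma> F \<le> ennreal K"
      and x: "0 \<le> x" "x < 1"
    define \<rho> where "\<rho> = (1 + x) / 2"
    define r where "r = x / \<rho>"
    have \<rho>: "0 < \<rho>" "\<rho> < 1" "1 - \<rho> = (1 - x) / 2" using x by (auto simp: \<rho>_def field_simps)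
    have xr: "x = \<rho> * r" using \<rho> by (simp add: r_def)
    \<comment> \<open>Since \<rho> is the midpoint between \<open>x\<close> and 1, \<open>r\<close>
      is as far from 1 as \<open>x\<close> up to a factor 2.\<close>
    have "1 - r = (1 - x) / (2 * \<rho>)" using \<rho>(1) by (simp add: r_def \<rho>_def field_simps)
    also have "\<dots> \<ge> (1 - x) / 2" using x \<rho> by (intro divide_left_mono) auto
    finally have r: "0 \<le> r" "r < 1" "(1 - x) / 2 \<le> 1 - r" using x \<rho> by (auto simp: r_def)
    let ?a = "\<lambda>t. cmod (F (of_real \<rho> * cis (2 * pi * t)))"
    let ?y = "\<lambda>t. 1 - r + arc_dist t"
    have y: "0 < ?y t" if "t \<in> space unit_lborel" for t
      using that arc_dist_pos[of t] r by (auto simp: space_restrict_space)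
    have am: "(\<lambda>t. F (of_real \<rho> * cis (2 * pi * t))) \<in> borel_measurable borel"
      using F \<rho> by (intro holomorphic_circle_measurable) auto
    define W where "W = 2 / (q - 1) * (1 - r) powr (1 - q)"
    have W: "0 \<le> W" using q by (simp add: W_def)
    \<comment> \<open>Hoelder's inequality as a power mean: the weight
      \<open>?y t powr (- q)\<close> has integral of order \<open>(1 - r) powr (1 - q)\<close>, and
      the compensating factor \<open>?y t powr (q - 1)\<close> becomes \<open>?y t powr q\<close>
      after the power \<open>p\<close>, which cancels the weight.\<close>
    have "ennreal (cmod (F (of_real x)) powr p) \<le> ennreal (W powr (p - 1)) *
        (\<integral>\<^sup>+ t. ennreal (?y t powr (- q)) * ennreal ((3 * ?a t * ?y t powr (q - 1)) powr p) \<partial>unit_lborel)"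
    proof (rule nn_integral_power_mean[OF _ _ p])
      have "ennreal (cmod (F (of_real (\<rho> * r)))) \<le> (\<integral>\<^sup>+ t. ennreal (1 / ?y t) * ennreal (3 * ?a t) \<partial>unit_lborel)"
        by (rule cauchy_arc_bound[OF F \<rho>(1,2) r(1,2)])
      also have "\<dots> = (\<integral>\<^sup>+ t. ennreal (?y t powr (- q)) * ennreal (3 * ?a t * ?y t powr (q - 1)) \<partial>unit_lborel)"
      proof (intro nn_integral_cong)
        fix t assume t: "t \<in> space unit_lborel"
        have "?y t powr (- q) * ?y t powr (q - 1) = 1 / ?y t"
          using y[OF t] by (simp add: powr_diff powr_minus field_simps)
        moreover have "?y t powr (- q) * (3 * ?a t * ?y t powr (q - 1)) = (?y t powr (- q) * ?y t powr (q - 1)) * (3 * ?a t)"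
          by (simp only: mult_ac)
        ultimately have "1 / ?y t * (3 * ?a t) = ?y t powr (- q) * (3 * ?a t * ?y t powr (q - 1))"
          by (simp only:)
        then show "ennreal (1 / ?y t) * ennreal (3 * ?a t) = ennreal (?y t powr (- q)) * ennreal (3 * ?a t * ?y t powr (q - 1))"
          using y[OF t] by (simp flip: ennreal_mult)
      qed
      finally show "ennreal (cmod (F (of_real x))) \<le> (\<integral>\<^sup>+ t. ennreal (?y t powr (- q)) * ennreal (3 * ?a t * ?y t powr (q - 1)) \<partial>unit_lborel)"
        by (simp only: xr)
      show "(\<integral>\<^sup>+ t. ennreal (?y t powr (- q)) \<partial>unit_lborel) \<le> ennreal W"
        unfolding W_def using r by (intro nn_integral_arc_dist_powr q) auto
      show "(\<lambda>t. ennreal (?y t powr (- q))) \<in> borel_measurable unit_lborel"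
        by (rule measurable_restrict_space1) measurable
      have "(\<lambda>t. 3 * ?a t * ?y t powr (q - 1)) \<in> borel_measurable lborel"
        using am by measurable
      then show "(\<lambda>t. 3 * ?a t * ?y t powr (q - 1)) \<in> borel_measurable unit_lborel"
        by (rule measurable_restrict_space1)
    qed (use W in auto)
    also have "(\<integral>\<^sup>+ t. ennreal (?y t powr (- q)) * ennreal ((3 * ?a t * ?y t powr (q - 1)) powr p) \<partial>unit_lborel)
        = (\<integral>\<^sup>+ t. ennreal (3 powr p) * ennreal (?a t powr p) \<partial>unit_lborel)"
    proof (intro nn_integral_cong)
      fix t assume t: "t \<in> space unit_lborel"
      have "(3 * ?a t * ?y t powr (q - 1)) powr p = 3 powr p * ?a t powr p * ?y t powr q"
        using y[OF t] q1(2) by (simp add: powr_mult powr_powr)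
      moreover have "?y t powr (- q) * ?y t powr q = 1"
        using y[OF t] by (simp flip: powr_add)
      moreover have "?y t powr (- q) * (3 powr p * ?a t powr p * ?y t powr q)
          = (?y t powr (- q) * ?y t powr q) * (3 powr p * ?a t powr p)"
        by (simp only: mult_ac)
      ultimately have "?y t powr (- q) * (3 * ?a t * ?y t powr (q - 1)) powr p = 3 powr p * ?a t powr p"
        by (simp only: mult_1)
      then show "ennreal (?y t powr (- q)) * ennreal ((3 * ?a t * ?y t powr (q - 1)) powr p)
          = ennreal (3 powr p) * ennreal (?a t powr p)"
        by (simp flip: ennreal_mult)
    qed
    also have "\<dots> = ennreal (3 powr p) * (\<integral>\<^sup>+ t. ennreal (?a t powr p) \<partial>unit_lborel)"
      using am by (intro nn_integral_cmult measurable_restrict_space1) measurable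
    also have "(\<integral>\<^sup>+ t. ennreal (?a t powr p) \<partial>unit_lborel) = ennreal (Mp p \<rho> F powr p)"
      using F \<rho> p by (intro Mp_powr_holomorphic[symmetric]) auto
    also have "ennreal (W powr (p - 1)) * (ennreal (3 powr p) * ennreal (Mp p \<rho> F powr p))
        = ennreal (W powr (p - 1) * 3 powr p * Mp p \<rho> F powr p)"
      by (simp add: ennreal_mult mult.assoc)
    \<comment> \<open>Since \<open>(1 - q) * (p - 1) = -1\<close>, exactly one power of
      \<open>1 - r\<close> is lost, that is 1/p after the root.\<close>
    also have "W powr (p - 1) * 3 powr p = A * (1 - r) powr (- 1)"
    proof -
      have "W powr (p - 1) = (2 / (q - 1)) powr (p - 1) * (1 - r) powr ((1 - q) * (p - 1))"
        unfolding W_def using q by (subst powr_mult) (auto simp: powr_powr)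
      then show ?thesis unfolding q1(1) by (simp only: A_def mult_ac)
    qed
    finally have "cmod (F (of_real x)) powr p \<le> A * (1 - r) powr (- 1) * Mp p \<rho> F powr p"
      using A by (subst (asm) ennreal_le_iff) auto
    also have "\<dots> \<le> A * ((1 - x) / 2) powr (- 1) * (K * (1 - \<rho>) powr (- \<gamma>)) powr p"
    proof (intro mult_mono order_refl)
      show "(1 - r) powr (- 1) \<le> ((1 - x) / 2) powr (- 1)"
        using r x by (intro powr_mono2') auto
      show "Mp p \<rho> F powr p \<le> (K * (1 - \<rho>) powr (- \<gamma>)) powr p"
      proof (intro powr_mono2 Mp_nonneg)
        have "ennreal ((1 - \<rho>) powr \<gamma> * Mp p \<rho> F) \<le> Hp_weighted_norm p \<gamma> F"
          unfolding Hp_weighted_norm_def using \<rho> by (intro SUP_upper) auto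
        also note le
        finally have "(1 - \<rho>) powr \<gamma> * Mp p \<rho> F \<le> K"
          using K by (subst (asm) ennreal_le_iff) auto
        then have "(1 - \<rho>) powr (- \<gamma>) * ((1 - \<rho>) powr \<gamma> * Mp p \<rho> F) \<le> (1 - \<rho>) powr (- \<gamma>) * K"
          by (intro mult_left_mono) auto
        moreover have "(1 - \<rho>) powr (- \<gamma>) * (1 - \<rho>) powr \<gamma> = 1" using \<rho>(2) by (simp flip: powr_add)
        ultimately have "Mp p \<rho> F \<le> (1 - \<rho>) powr (- \<gamma>) * K"
          by (simp only: mult.assoc[symmetric] mult_1)
        then show "Mp p \<rho> F \<le> K * (1 - \<rho>) powr (- \<gamma>)"
          by (simp only: mult.commute)
      qed (use p in auto)
    qed (use A in auto)
    also have "\<dots> = (A powr (1 / p) * ((1 - x) / 2) powr (- 1 / p) * (K * (1 - \<rho>) powr (- \<gamma>))) powr p"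
    proof -
      have "(A powr (1 / p) * h powr (- 1 / p) * L) powr p = A * h powr (- 1) * L powr p"
        if "0 \<le> h" "0 \<le> L" for h L
        using that A p by (simp add: powr_mult powr_powr)
      then show ?thesis using x K by simp
    qed
    finally have pw: "cmod (F (of_real x)) powr p \<le>
        (A powr (1 / p) * ((1 - x) / 2) powr (- 1 / p) * (K * (1 - \<rho>) powr (- \<gamma>))) powr p" .
    have "cmod (F (of_real x)) \<le> A powr (1 / p) * ((1 - x) / 2) powr (- 1 / p) * (K * (1 - \<rho>) powr (- \<gamma>))"
      by (rule powr_cancel_le[OF _ _ pw]) (use p A K in auto)
    also have "((1 - x) / 2) powr (- 1 / p) = 2 powr (1 / p) * (1 - x) powr (- 1 / p)"
    proof -
      have "((1 - x) / 2) powr (- e) = 2 powr e * (1 - x) powr (- e)" for e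
        using x by (simp add: powr_divide powr_minus field_simps)
      from this[of "1 / p"] show ?thesis by simp
    qed
    also have "(1 - \<rho>) powr (- \<gamma>) = 2 powr \<gamma> * (1 - x) powr (- \<gamma>)"
      unfolding \<rho>(3) using x by (simp add: powr_divide powr_minus field_simps)
    finally have "(1 - x) powr (\<gamma> + 1 / p) * cmod (F (of_real x)) \<le> (1 - x) powr (\<gamma> + 1 / p) *
        (A powr (1 / p) * (2 powr (1 / p) * (1 - x) powr (- 1 / p)) * (K * (2 powr \<gamma> * (1 - x) powr (- \<gamma>))))"
      by (intro mult_left_mono) auto
    also have "\<dots> = ((1 - x) powr (\<gamma> + 1 / p) * ((1 - x) powr (- 1 / p) * (1 - x) powr (- \<gamma>))) *
        (A powr (1 / p) * 2 powr (1 / p) * 2 powr \<gamma> * K)"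
      by (simp only: mult_ac)
    also have "(1 - x) powr (\<gamma> + 1 / p) * ((1 - x) powr (- 1 / p) * (1 - x) powr (- \<gamma>)) = 1"
      using x by (simp flip: powr_add)
    finally show "(1 - x) powr (\<gamma> + 1 / p) * cmod (F (of_real x)) \<le> A powr (1 / p) * 2 powr (1 / p) * 2 powr \<gamma> * K"
      by simp
  qed
qed

context Dhat_weight
begin

lemma Cop_X_to_Hp_weighted:
  assumes p: "1 < p" and \<beta>: "0 \<le> \<beta>" and \<gamma>: "0 < \<gamma>"
  shows "(\<forall>\<mu>\<in>Mplus. bounded_op (X_norm \<beta>) (Hp_weighted_norm p \<gamma>) (Cop \<mu> \<omega>)
         \<longleftrightarrow> bdd_above (range (moment_ratio (\<gamma> - \<beta> + 1 / p - 1) \<omega> \<mu>)))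
     \<and> comparable_on {\<mu>\<in>Mplus. bounded_op (X_norm \<beta>) (Hp_weighted_norm p \<gamma>) (Cop \<mu> \<omega>)}
         (\<lambda>\<mu>. op_norm (X_norm \<beta>) (Hp_weighted_norm p \<gamma>) (Cop \<mu> \<omega>))
         (\<lambda>\<mu>. SUP n. moment_ratio (\<gamma> - \<beta> + 1 / p - 1) \<omega> \<mu> n)"
proof -
  let ?\<delta> = "\<gamma> - \<beta> + 1 / p - 1"
  \<comment> \<open>The \<open>p\<close>-norm of \<open>1 / (s + arc_dist \<tau>)\<close> over the
    circle is at most of order \<open>s powr (1 / p - 1)\<close> instead of \<open>1 / s\<close>.
    Hence the radial integral has the exponent \<open>\<beta> - 1 / p\<close> in place of \<beta>;
    it may be negative but stays above -1.\<close>
  define \<alpha> where "\<alpha> = \<beta> - 1 / p"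
  have "1 / p < 1" using p by simp
  then have \<alpha>: "\<alpha> > -1" unfolding \<alpha>_def using \<beta> by linarith
  \<comment> \<open>The same exponent arises twice: from \<gamma> and \<alpha> in the upper
    estimate, from \<open>\<gamma> + 1 / p\<close> and \<beta> in the lower one.\<close>
  have \<delta>: "\<gamma> - \<alpha> - 1 = ?\<delta>" "(\<gamma> + 1 / p) - \<beta> - 1 = ?\<delta>" by (auto simp: \<alpha>_def)
  obtain C1 where C1: "C1 > 0"
    "\<And>\<mu> Q r. \<mu> \<in> Mplus \<Longrightarrow> 0 \<le> Q \<Longrightarrow> (\<And>n. moment_ratio ?\<delta> \<omega> \<mu> n \<le> Q) \<Longrightarrow> 0 \<le> r \<Longrightarrow> r < 1 \<Longrightarrow>
      (\<integral>\<^sup>+ t. ennreal (\<Phi> \<alpha> (t * r)) \<partial>\<mu>) \<le> ennreal (C1 * Q * (1 - r) powr (- \<gamma>))"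
    using kernel_size_integral_le[OF \<alpha> \<gamma>] unfolding \<delta> by blast
  obtain C2 where C2: "C2 > 0"
    "\<And>\<mu> \<beta> f r \<tau>. \<mu> \<in> Mplus \<Longrightarrow> f \<in> analytic_space (X_norm \<beta>) \<Longrightarrow> 0 \<le> r \<Longrightarrow> r < 1 \<Longrightarrow> 0 < \<tau> \<Longrightarrow> \<tau> < 1 \<Longrightarrow>
      ennreal (cmod (Cop \<mu> \<omega> f (of_real r * cis (2 * pi * \<tau>)))) \<le>
        (\<integral>\<^sup>+ t. ennreal (C2 * enn2real (X_norm \<beta> f) *
          ((1 - t * r) powr (- \<beta>) / tail (t * r)) * (1 / (1 - t * r + arc_dist \<tau>))) \<partial>\<mu>)"
    using Cop_norm_le_arc_kernel by blast
  obtain C3 where C3: "C3 > 0"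
    "\<And>\<mu> \<gamma> K n. \<mu> \<in> Mplus \<Longrightarrow>
      (\<And>x. 0 \<le> x \<Longrightarrow> x < 1 \<Longrightarrow> (1 - x) powr \<gamma> * cmod (Cop \<mu> \<omega> (test_fun \<beta>) (of_real x)) \<le> K) \<Longrightarrow>
      moment_ratio (\<gamma> - \<beta> - 1) \<omega> \<mu> n \<le> C3 * K"
    using moment_ratio_le_test_fun[OF \<beta>] by blast
  obtain C4 where C4: "C4 > 0"
    "\<And>F \<gamma> K x. F holomorphic_on ball 0 1 \<Longrightarrow> 0 \<le> \<gamma> \<Longrightarrow> 0 \<le> K \<Longrightarrow> Hp_weighted_norm p \<gamma> F \<le> ennreal K \<Longrightarrow>
      0 \<le> x \<Longrightarrow> x < 1 \<Longrightarrow> (1 - x) powr (\<gamma> + 1 / p) * cmod (F (of_real x)) \<le> C4 * 2 powr \<gamma> * K"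
    using Hp_weighted_pointwise[OF p] by blast
  define c0 where "c0 = (2 / (p - 1)) powr (1 / p)"
  have c0: "c0 > 0" using p by (simp add: c0_def)
  show ?thesis
  proof (rule moment_characterization[of "C2 * c0 * C1" "C3 * (C4 * 2 powr \<gamma>)"])
    show "0 < C2 * c0 * C1" "0 < C3 * (C4 * 2 powr \<gamma>)" using C1 C2 C3 C4 c0 by auto
  next
    fix \<mu> and Q :: real
    assume \<mu>: "\<mu> \<in> Mplus" and Q: "0 \<le> Q" and mQ: "\<And>n. moment_ratio ?\<delta> \<omega> \<mu> n \<le> Q"
    show "op_bound (X_norm \<beta>) (Hp_weighted_norm p \<gamma>) (Cop \<mu> \<omega>) (C2 * c0 * C1 * Q)"
    proof (rule op_bound_Cop[OF \<mu>])
      show "0 \<le> C2 * c0 * C1 * Q" using C1 C2 c0 Q by simp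
      fix f assume f: "f \<in> analytic_space (X_norm \<beta>)"
      let ?F = "Cop \<mu> \<omega> f"
      have Fhol: "?F holomorphic_on ball 0 1"
        using f by (intro Cop_holomorphic[OF \<mu>]) (simp add: analytic_space_def)
      define N where "N = enn2real (X_norm \<beta> f)"
      have N0: "0 \<le> N" by (simp add: N_def)
      have "Hp_weighted_norm p \<gamma> ?F \<le> ennreal (C2 * c0 * C1 * Q * N)"
        unfolding Hp_weighted_norm_def
      proof (rule SUP_least)
        fix r :: real assume "r \<in> {0..<1}"
        then have r: "0 \<le> r" "r < 1" by auto
        define a where "a t = C2 * N * ((1 - t * r) powr (- \<beta>) / tail (t * r))" for t
        \<comment> \<open>\<open>n t\<close> majorises the \<open>p\<close>-norm of the kernel in
          the angle, \<open>a t\<close> is the remaining radial factor, and \<open>W\<close> bounds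
          the integral of their product.\<close>
        define n where "n t = c0 * (1 - t * r) powr ((1 - p) / p)" for t
        define W where "W = C2 * N * c0 * (C1 * Q * (1 - r) powr (- \<gamma>))"
        have W: "0 \<le> W" using C1 C2 c0 N0 Q by (simp add: W_def)
        have sp: "t \<in> space \<mu> \<Longrightarrow> 0 \<le> t \<and> t < 1" for t by (auto simp: MplusD(3)[OF \<mu>])
        have tr: "0 \<le> t * r" "t * r < 1" if "t \<in> space \<mu>" for t
          using mult_in_unit[of t r] sp[OF that] r by auto
        have am: "a \<in> borel_measurable \<mu>"
        proof (rule Mplus_measurable[OF \<mu>])
          have [measurable]: "(\<lambda>t. tail (t * r)) \<in> borel_measurable (restrict_space borel {0..<1})"
            using r by (intro weight_tail_measurable) auto
          have [measurable]: "(\<lambda>t. (1 - t * r) powr (- \<beta>)) \<in> borel_measurable (restrict_space borel {0..<1})"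
            by (rule measurable_restrict_space1) measurable
          show "a \<in> borel_measurable (restrict_space borel {0..<1})" unfolding a_def by measurable
        qed
        have nm: "n \<in> borel_measurable \<mu>"
          unfolding n_def by (rule Mplus_measurable_borel[OF \<mu>]) measurable
        have "ennreal (Mp p r ?F powr p) = (\<integral>\<^sup>+ \<tau>. ennreal (cmod (?F (of_real r * cis (2 * pi * \<tau>))) powr p) \<partial>unit_lborel)"
          using p by (intro Mp_powr_holomorphic[OF Fhol r]) auto
        also have "\<dots> \<le> ennreal (W powr p)"
        proof (rule minkowski_kernel[where N = \<mu> and h = "\<lambda>\<tau> t. 1 / (1 - t * r + arc_dist \<tau>)" and a = a and n = n])
          show "case_prod (\<lambda>\<tau> t. 1 / (1 - t * r + arc_dist \<tau>)) \<in> borel_measurable (unit_lborel \<Otimes>\<^sub>M \<mu>)"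
          proof (rule pair_borel_measurable)
            show "(\<lambda>x. x) \<in> borel_measurable unit_lborel" by (rule measurable_restrict_space1) measurable
            show "(\<lambda>x. x) \<in> borel_measurable \<mu>" by (rule Mplus_measurable_borel[OF \<mu>]) measurable
          qed measurable
          show "0 \<le> 1 / (1 - t * r + arc_dist \<tau>)" if "\<tau> \<in> space unit_lborel" "t \<in> space \<mu>" for \<tau> t
            using that tr[OF that(2)] arc_dist_pos[of \<tau>] by (auto simp: space_restrict_space)
          show "0 \<le> a t" if "t \<in> space \<mu>" for t
            using weight_tail_pos[OF tr[OF that]] C2 N0 by (simp add: a_def)
          show "0 < n t" if "t \<in> space \<mu>" for t
            using tr[OF that] c0 by (simp add: n_def)
          show "(\<integral>\<^sup>+ \<tau>. ennreal ((1 / (1 - t * r + arc_dist \<tau>)) powr p) \<partial>unit_lborel) \<le> ennreal (n t powr p)"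
            if t: "t \<in> space \<mu>" for t
          proof -
            have "(\<integral>\<^sup>+ \<tau>. ennreal ((1 / (1 - t * r + arc_dist \<tau>)) powr p) \<partial>unit_lborel)
                = (\<integral>\<^sup>+ \<tau>. ennreal ((1 - t * r + arc_dist \<tau>) powr (- p)) \<partial>unit_lborel)"
            proof (intro nn_integral_cong)
              fix \<tau> :: real assume "\<tau> \<in> space unit_lborel"
              then have "0 < 1 - t * r + arc_dist \<tau>"
                using tr[OF t] arc_dist_pos[of \<tau>] by (auto simp: space_restrict_space)
              then show "ennreal ((1 / (1 - t * r + arc_dist \<tau>)) powr p) = ennreal ((1 - t * r + arc_dist \<tau>) powr (- p))"
                by (simp add: powr_divide powr_minus_divide)
            qed
            also have "\<dots> \<le> ennreal (2 / (p - 1) * (1 - t * r) powr (1 - p))"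
              using tr[OF t] by (intro nn_integral_arc_dist_powr p) auto
            also have "2 / (p - 1) * (1 - t * r) powr (1 - p) = n t powr p"
              using p by (simp add: n_def c0_def powr_mult powr_powr)
            finally show ?thesis .
          qed
          show "(\<integral>\<^sup>+ t. ennreal (a t * n t) \<partial>\<mu>) \<le> ennreal W"
          proof -
            have "(\<integral>\<^sup>+ t. ennreal (a t * n t) \<partial>\<mu>) = (\<integral>\<^sup>+ t. ennreal (C2 * N * c0) * ennreal (\<Phi> \<alpha> (t * r)) \<partial>\<mu>)"
            proof (intro nn_integral_cong)
              fix t assume t: "t \<in> space \<mu>"
              have "(1 - t * r) powr (- \<beta>) * (1 - t * r) powr ((1 - p) / p) = (1 - t * r) powr (- \<alpha> - 1)"
              proof -
                have "- \<beta> + (1 - p) / p = - \<alpha> - 1" using p by (simp add: \<alpha>_def diff_divide_distrib)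
                then show ?thesis by (metis powr_add)
              qed
              moreover have "a t * n t = C2 * N * c0 *
                  (((1 - t * r) powr (- \<beta>) * (1 - t * r) powr ((1 - p) / p)) / tail (t * r))"
                by (simp add: a_def n_def)
              ultimately have "a t * n t = C2 * N * c0 * \<Phi> \<alpha> (t * r)"
                by (simp only: kernel_size_def)
              then show "ennreal (a t * n t) = ennreal (C2 * N * c0) * ennreal (\<Phi> \<alpha> (t * r))"
                using C2 N0 c0 kernel_size_pos[OF tr[OF t], of \<alpha>] by (simp add: ennreal_mult)
            qed
            also have "\<dots> = ennreal (C2 * N * c0) * (\<integral>\<^sup>+ t. ennreal (\<Phi> \<alpha> (t * r)) \<partial>\<mu>)"
              using kernel_size_measurable[OF \<mu> r(1) less_imp_le[OF r(2)]] by (intro nn_integral_cmult) measurable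
            also have "\<dots> \<le> ennreal (C2 * N * c0) * ennreal (C1 * Q * (1 - r) powr (- \<gamma>))"
              by (intro mult_left_mono C1(2)[OF \<mu> Q mQ r]) auto
            also have "\<dots> = ennreal W"
              unfolding W_def using C1 C2 c0 N0 Q by (intro ennreal_mult[symmetric]) auto
            finally show ?thesis .
          qed
          show "ennreal (cmod (?F (of_real r * cis (2 * pi * \<tau>)))) \<le> (\<integral>\<^sup>+ t. ennreal (a t * (1 / (1 - t * r + arc_dist \<tau>))) \<partial>\<mu>)"
            if "\<tau> \<in> space unit_lborel" for \<tau>
            using C2(2)[OF \<mu> f r, of \<tau>] that by (auto simp: a_def N_def space_restrict_space)
        qed (use am nm p W sigma_finite_unit_lborel Mplus_sigma_finite[OF \<mu>] in auto)
        finally have pw: "Mp p r ?F powr p \<le> W powr p" by (subst (asm) ennreal_le_iff) auto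
        have "Mp p r ?F \<le> W" by (rule powr_cancel_le[OF _ W pw]) (use p in auto)
        then have "(1 - r) powr \<gamma> * Mp p r ?F \<le> (1 - r) powr \<gamma> * W"
          by (intro mult_left_mono) auto
        also have "\<dots> = ((1 - r) powr \<gamma> * (1 - r) powr (- \<gamma>)) * (C2 * c0 * C1 * Q * N)"
          unfolding W_def by (simp only: mult_ac)
        also have "(1 - r) powr \<gamma> * (1 - r) powr (- \<gamma>) = 1" using r by (simp flip: powr_add)
        finally show "ennreal ((1 - r) powr \<gamma> * Mp p r ?F) \<le> ennreal (C2 * c0 * C1 * Q * N)"
          by (simp add: ennreal_leI)
      qed
      then show "Hp_weighted_norm p \<gamma> ?F \<le> ennreal (C2 * c0 * C1 * Q * enn2real (X_norm \<beta> f))"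
        by (simp only: N_def)
    qed
  next
    fix \<mu> and K :: real and n assume \<mu>: "\<mu> \<in> Mplus" and ob: "op_bound (X_norm \<beta>) (Hp_weighted_norm p \<gamma>) (Cop \<mu> \<omega>) K"
    note F = op_bound_test_fun[OF \<beta> ob]
    from C3(2)[OF \<mu> C4(2)[OF F(4) less_imp_le[OF \<gamma>] F(1,3)]]
    show "moment_ratio ?\<delta> \<omega> \<mu> n \<le> C3 * (C4 * 2 powr \<gamma>) * K"
      unfolding \<delta> by (simp add: mult.assoc)
  qed
qed

end

section \<open>Hardy spaces as targets\<close>

lemma space_unit_lborel: "t \<in> space unit_lborel \<longleftrightarrow> 0 < t \<and> t < 1"
  by (simp add: space_restrict_space)

lemma arc_kernel_integral_arc:
  fixes a r :: real
  assumes a: "0 < a" "a < 1" and r: "r < 1"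
  shows "(\<integral>\<^sup>+ \<tau>. ennreal (1 / (1 - r + arc_dist \<tau>)) * ennreal (arc_dist \<tau> powr (- a)) \<partial>unit_lborel)
    \<le> ennreal (2 * (1 / (1 - a) + 1 / a) * (1 - r) powr (- a))"
proof -
  have "(\<integral>\<^sup>+ \<tau>. ennreal (1 / (1 - r + arc_dist \<tau>)) * ennreal (arc_dist \<tau> powr (- a)) \<partial>unit_lborel)
      = (\<integral>\<^sup>+ \<tau>. ennreal (arc_dist \<tau> powr (- a) / ((1 - r) + arc_dist \<tau>)) \<partial>unit_lborel)"
  proof (intro nn_integral_cong)
    fix \<tau> assume "\<tau> \<in> space unit_lborel"
    then have "0 < arc_dist \<tau>" using arc_dist_pos[of \<tau>] by (simp add: space_unit_lborel)
    then show "ennreal (1 / (1 - r + arc_dist \<tau>)) * ennreal (arc_dist \<tau> powr (- a))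
        = ennreal (arc_dist \<tau> powr (- a) / ((1 - r) + arc_dist \<tau>))"
      using r by (simp flip: ennreal_mult)
  qed
  also have "\<dots> \<le> ennreal (2 * ((1 / (1 - a) + 1 / a) * (1 - r) powr (- a)))"
    using r by (intro nn_integral_arc_dist_hilbert a) auto
  finally show ?thesis by (simp only: mult.assoc)
qed

lemma arc_kernel_integral_radius:
  fixes a \<tau> :: real
  assumes a: "0 < a" "a < 1" and \<tau>: "0 < \<tau>" "\<tau> < 1"
  shows "(\<integral>\<^sup>+ r. ennreal (1 / (1 - r + arc_dist \<tau>)) * ennreal ((1 - r) powr (- a)) \<partial>unit_lborel)
    \<le> ennreal ((1 / (1 - a) + 1 / a) * arc_dist \<tau> powr (- a))"
proof -
  have d: "0 < arc_dist \<tau>" by (rule arc_dist_pos[OF \<tau>])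
  have "(\<integral>\<^sup>+ r. ennreal (1 / (1 - r + arc_dist \<tau>)) * ennreal ((1 - r) powr (- a)) \<partial>unit_lborel)
      = (\<integral>\<^sup>+ r. ennreal ((1 - r) powr (- a) / (arc_dist \<tau> + (1 - r))) \<partial>unit_lborel)"
  proof (intro nn_integral_cong)
    fix r assume "r \<in> space unit_lborel"
    then have "r < 1" by (simp add: space_unit_lborel)
    then show "ennreal (1 / (1 - r + arc_dist \<tau>)) * ennreal ((1 - r) powr (- a))
        = ennreal ((1 - r) powr (- a) / (arc_dist \<tau> + (1 - r)))"
      using d by (simp add: add_ac flip: ennreal_mult)
  qed
  also have "\<dots> = (\<integral>\<^sup>+ s. ennreal (s powr (- a) / (arc_dist \<tau> + s)) \<partial>unit_lborel)"
    by (rule nn_integral_unit_reflect) measurable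
  also have "\<dots> \<le> ennreal ((1 / (1 - a) + 1 / a) * arc_dist \<tau> powr (- a))"
    by (rule nn_integral_hilbert_kernel[OF a d])
  finally show ?thesis .
qed

text \<open>Schur's test with the weights \<open>(1 - r) powr (- 1 / p)\<close> and \<open>arc_dist \<tau> powr (- 1 / p)\<close>.\<close>

lemma hilbert_inequality_arc:
  fixes p :: real
  assumes p: "p > 1"
  obtains A where "A > 0"
    "\<And>G g. (\<And>\<tau>. 0 < \<tau> \<Longrightarrow> \<tau> < 1 \<Longrightarrow> 0 \<le> G \<tau>) \<Longrightarrow> (\<And>r. 0 < r \<Longrightarrow> r < 1 \<Longrightarrow> 0 \<le> g r) \<Longrightarrow>
      g \<in> borel_measurable unit_lborel \<Longrightarrow>
      (\<And>\<tau>. 0 < \<tau> \<Longrightarrow> \<tau> < 1 \<Longrightarrow> ennreal (G \<tau>) \<le> (\<integral>\<^sup>+ r. ennreal (1 / (1 - r + arc_dist \<tau>)) * ennreal (g r) \<partial>unit_lborel)) \<Longrightarrow>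
      (\<integral>\<^sup>+ \<tau>. ennreal (G \<tau> powr p) \<partial>unit_lborel) \<le> ennreal A * (\<integral>\<^sup>+ r. ennreal (g r powr p) \<partial>unit_lborel)"
    "\<And>G g. (\<And>r. 0 < r \<Longrightarrow> r < 1 \<Longrightarrow> 0 \<le> G r) \<Longrightarrow> (\<And>\<tau>. 0 < \<tau> \<Longrightarrow> \<tau> < 1 \<Longrightarrow> 0 \<le> g \<tau>) \<Longrightarrow>
      g \<in> borel_measurable unit_lborel \<Longrightarrow>
      (\<And>r. 0 < r \<Longrightarrow> r < 1 \<Longrightarrow> ennreal (G r) \<le> (\<integral>\<^sup>+ \<tau>. ennreal (1 / (1 - r + arc_dist \<tau>)) * ennreal (g \<tau>) \<partial>unit_lborel)) \<Longrightarrow>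
      (\<integral>\<^sup>+ r. ennreal (G r powr p) \<partial>unit_lborel) \<le> ennreal A * (\<integral>\<^sup>+ \<tau>. ennreal (g \<tau> powr p) \<partial>unit_lborel)"
proof -
  define a where "a = 1 / p"
  define b where "b = 1 - 1 / p"
  have a: "0 < a" "a < 1" and b: "0 < b" "b < 1" using p by (auto simp: a_def b_def)
  \<comment> \<open>The power \<open>p - 1\<close> of a weight with exponent
    \<open>- (1 / p)\<close> has exponent \<open>- (1 - 1 / p)\<close>, again strictly between -1
    and 0, so the same integral formulas serve both conditions of Schur's test.\<close>
  have ab: "- a * (p - 1) = - b" using p by (simp add: a_def b_def field_simps)
  define Ka where "Ka = 2 * (1 / (1 - a) + 1 / a)"
  define Kb where "Kb = 2 * (1 / (1 - b) + 1 / b)"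
  have K: "0 < Ka" "0 < Kb" using a b by (auto simp: Ka_def Kb_def add_pos_pos)
  have idm: "(\<lambda>x. x) \<in> borel_measurable unit_lborel" by (rule measurable_restrict_space1) measurable
  have arc: "(\<integral>\<^sup>+ \<tau>. ennreal (1 / (1 - r + arc_dist \<tau>)) * ennreal (arc_dist \<tau> powr (- c)) \<partial>unit_lborel)
      \<le> ennreal (2 * (1 / (1 - c) + 1 / c) * (1 - r) powr (- c))"
    if "r \<in> space unit_lborel" "0 < c" "c < 1" for r c
    using that by (intro arc_kernel_integral_arc) (auto simp: space_unit_lborel)
  \<comment> \<open>Along the radius only one end comes near the singularity, so the integral has
    half the constant. The factor 2 is put in to let both inequalities share \<open>Ka\<close> and
    \<open>Kb\<close>.\<close>
  have rad: "(\<integral>\<^sup>+ r. ennreal (1 / (1 - r + arc_dist \<tau>)) * ennreal ((1 - r) powr (- c)) \<partial>unit_lborel)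
      \<le> ennreal (2 * (1 / (1 - c) + 1 / c) * arc_dist \<tau> powr (- c))"
    if "\<tau> \<in> space unit_lborel" "0 < c" "c < 1" for \<tau> c
  proof -
    have "(\<integral>\<^sup>+ r. ennreal (1 / (1 - r + arc_dist \<tau>)) * ennreal ((1 - r) powr (- c)) \<partial>unit_lborel)
        \<le> ennreal ((1 / (1 - c) + 1 / c) * arc_dist \<tau> powr (- c))"
      using that by (intro arc_kernel_integral_radius) (auto simp: space_unit_lborel)
    also have "\<dots> \<le> ennreal (2 * (1 / (1 - c) + 1 / c) * arc_dist \<tau> powr (- c))"
    proof (intro ennreal_leI mult_right_mono)
      have "0 \<le> 1 / (1 - c) + 1 / c" using that by simp
      then show "1 / (1 - c) + 1 / c \<le> 2 * (1 / (1 - c) + 1 / c)"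
        by (simp only: mult_2 le_add_same_cancel1)
    qed auto
    finally show ?thesis .
  qed
  have pw: "(arc_dist \<tau> powr (- a)) powr (p - 1) = arc_dist \<tau> powr (- b)"
    "((1 - r) powr (- a)) powr (p - 1) = (1 - r) powr (- b)" for \<tau> r :: real
    by (simp_all only: powr_powr ab)
  show ?thesis
  proof (rule that[of "Ka powr (p - 1) * Kb"])
    show "0 < Ka powr (p - 1) * Kb" using K by simp
  next
    fix G g :: "real \<Rightarrow> real"
    assume G: "\<And>\<tau>. 0 < \<tau> \<Longrightarrow> \<tau> < 1 \<Longrightarrow> 0 \<le> G \<tau>" and g: "\<And>r. 0 < r \<Longrightarrow> r < 1 \<Longrightarrow> 0 \<le> g r"
      and gm: "g \<in> borel_measurable unit_lborel"
      and le: "\<And>\<tau>. 0 < \<tau> \<Longrightarrow> \<tau> < 1 \<Longrightarrow> ennreal (G \<tau>) \<le> (\<integral>\<^sup>+ r. ennreal (1 / (1 - r + arc_dist \<tau>)) * ennreal (g r) \<partial>unit_lborel)"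
    show "(\<integral>\<^sup>+ \<tau>. ennreal (G \<tau> powr p) \<partial>unit_lborel) \<le> ennreal (Ka powr (p - 1) * Kb) * (\<integral>\<^sup>+ r. ennreal (g r powr p) \<partial>unit_lborel)"
    proof (rule schur_test[where k = "\<lambda>\<tau> r. ennreal (1 / (1 - r + arc_dist \<tau>))"
          and u = "\<lambda>\<tau>. arc_dist \<tau> powr (- a)" and v = "\<lambda>r. (1 - r) powr (- a)"])
      show "case_prod (\<lambda>\<tau> r. ennreal (1 / (1 - r + arc_dist \<tau>))) \<in> borel_measurable (unit_lborel \<Otimes>\<^sub>M unit_lborel)"
        by (rule pair_borel_measurable[OF idm idm]) measurable
      show "(\<lambda>\<tau>. arc_dist \<tau> powr (- a)) \<in> borel_measurable unit_lborel" "(\<lambda>r. (1 - r) powr (- a)) \<in> borel_measurable unit_lborel"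
        by (rule measurable_restrict_space1, measurable)+
      show "(\<integral>\<^sup>+ r. ennreal (1 / (1 - r + arc_dist \<tau>)) * ennreal ((1 - r) powr (- a)) \<partial>unit_lborel)
          \<le> ennreal (Ka * arc_dist \<tau> powr (- a))" if "\<tau> \<in> space unit_lborel" for \<tau>
        unfolding Ka_def by (rule rad[OF that a])
      show "(\<integral>\<^sup>+ \<tau>. ennreal (1 / (1 - r + arc_dist \<tau>)) * ennreal ((arc_dist \<tau> powr (- a)) powr (p - 1)) \<partial>unit_lborel)
          \<le> ennreal (Kb * ((1 - r) powr (- a)) powr (p - 1))" if "r \<in> space unit_lborel" for r
        unfolding Kb_def pw by (rule arc[OF that b])
      show "0 < arc_dist \<tau> powr (- a)" if "\<tau> \<in> space unit_lborel" for \<tau>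
        using arc_dist_pos[of \<tau>] that by (auto simp: space_unit_lborel)
    qed (use p K sigma_finite_unit_lborel gm G g le in \<open>auto simp: space_unit_lborel\<close>)
  next
    fix G g :: "real \<Rightarrow> real"
    assume G: "\<And>r. 0 < r \<Longrightarrow> r < 1 \<Longrightarrow> 0 \<le> G r" and g: "\<And>\<tau>. 0 < \<tau> \<Longrightarrow> \<tau> < 1 \<Longrightarrow> 0 \<le> g \<tau>"
      and gm: "g \<in> borel_measurable unit_lborel"
      and le: "\<And>r. 0 < r \<Longrightarrow> r < 1 \<Longrightarrow> ennreal (G r) \<le> (\<integral>\<^sup>+ \<tau>. ennreal (1 / (1 - r + arc_dist \<tau>)) * ennreal (g \<tau>) \<partial>unit_lborel)"
    show "(\<integral>\<^sup>+ r. ennreal (G r powr p) \<partial>unit_lborel) \<le> ennreal (Ka powr (p - 1) * Kb) * (\<integral>\<^sup>+ \<tau>. ennreal (g \<tau> powr p) \<partial>unit_lborel)"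
    proof (rule schur_test[where k = "\<lambda>r \<tau>. ennreal (1 / (1 - r + arc_dist \<tau>))"
          and v = "\<lambda>\<tau>. arc_dist \<tau> powr (- a)" and u = "\<lambda>r. (1 - r) powr (- a)"])
      show "case_prod (\<lambda>r \<tau>. ennreal (1 / (1 - r + arc_dist \<tau>))) \<in> borel_measurable (unit_lborel \<Otimes>\<^sub>M unit_lborel)"
        by (rule pair_borel_measurable[OF idm idm]) measurable
      show "(\<lambda>r. (1 - r) powr (- a)) \<in> borel_measurable unit_lborel" "(\<lambda>\<tau>. arc_dist \<tau> powr (- a)) \<in> borel_measurable unit_lborel"
        by (rule measurable_restrict_space1, measurable)+
      show "(\<integral>\<^sup>+ \<tau>. ennreal (1 / (1 - r + arc_dist \<tau>)) * ennreal (arc_dist \<tau> powr (- a)) \<partial>unit_lborel)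
          \<le> ennreal (Ka * (1 - r) powr (- a))" if "r \<in> space unit_lborel" for r
        unfolding Ka_def by (rule arc[OF that a])
      show "(\<integral>\<^sup>+ r. ennreal (1 / (1 - r + arc_dist \<tau>)) * ennreal (((1 - r) powr (- a)) powr (p - 1)) \<partial>unit_lborel)
          \<le> ennreal (Kb * (arc_dist \<tau> powr (- a)) powr (p - 1))" if "\<tau> \<in> space unit_lborel" for \<tau>
        unfolding Kb_def pw by (rule rad[OF that b])
      show "0 < arc_dist \<tau> powr (- a)" if "\<tau> \<in> space unit_lborel" for \<tau>
        using arc_dist_pos[of \<tau>] that by (auto simp: space_unit_lborel)
    qed (use p K sigma_finite_unit_lborel gm G g le in \<open>auto simp: space_unit_lborel\<close>)
  qed
qed

text \<open>The lower bound for the image of the test function is available on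
  \<open>r \<le> \<rho>\<close> for each \<rho> < 1; monotone convergence along the nodes removes
  \<rho>. The nodes start at index 1 because \<open>node 0 = 0\<close> is not an admissible
  \<rho>.\<close>

lemma nn_integral_le_of_truncations:
  assumes [measurable]: "f \<in> borel_measurable unit_lborel"
    and le: "\<And>\<rho>. 0 < \<rho> \<Longrightarrow> \<rho> < 1 \<Longrightarrow> (\<integral>\<^sup>+ r. f r * indicator {..<\<rho>} r \<partial>unit_lborel) \<le> B"
  shows "(\<integral>\<^sup>+ r. f r \<partial>unit_lborel) \<le> B"
proof -
  define g where "g n r = f r * indicator {..<node (Suc n)} r" for n r
  have gm: "g n \<in> borel_measurable unit_lborel" for n
  proof -
    have "(\<lambda>r. indicator {..<node (Suc n)} r :: ennreal) \<in> borel_measurable unit_lborel"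
      by (rule measurable_restrict_space1) measurable
    then show ?thesis unfolding g_def by measurable
  qed
  have mono: "incseq g"
  proof (rule incseq_SucI, rule le_funI)
    fix n r
    have "node (Suc n) \<le> node (Suc (Suc n))"
      unfolding node_def by (intro diff_left_mono divide_left_mono) auto
    then show "g n r \<le> g (Suc n) r" unfolding g_def by (auto simp: indicator_def)
  qed
  have "(SUP n. g n r) = f r" if "r \<in> space unit_lborel" for r
  proof (rule antisym)
    show "(SUP n. g n r) \<le> f r" by (rule SUP_least) (auto simp: g_def indicator_def)
    have "r < 1" using that by (simp add: space_unit_lborel)
    then obtain n where n: "inverse (real (Suc n)) < 1 - r" using reals_Archimedean[of "1 - r"] by auto
    have "1 / real (Suc (Suc n)) \<le> 1 / real (Suc n)" by (intro divide_left_mono) auto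
    then have "r < node (Suc n)" using n unfolding node_def by (simp only: inverse_eq_divide)
    then have "f r = g n r" by (simp add: g_def)
    also have "\<dots> \<le> (SUP n. g n r)" by (rule SUP_upper) simp
    finally show "f r \<le> (SUP n. g n r)" .
  qed
  then have "(\<integral>\<^sup>+ r. f r \<partial>unit_lborel) = (\<integral>\<^sup>+ r. (SUP n. g n r) \<partial>unit_lborel)"
    by (intro nn_integral_cong) simp
  also have "\<dots> = (SUP n. integral\<^sup>N unit_lborel (g n))"
    by (rule nn_integral_monotone_convergence_SUP[OF mono gm])
  also have "\<dots> \<le> B"
  proof (rule SUP_least)
    fix n
    have "0 < node (Suc n)" "node (Suc n) < 1" by (auto simp: node_def)
    then show "integral\<^sup>N unit_lborel (g n) \<le> B" unfolding g_def by (rule le)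
  qed
  finally show ?thesis .
qed

lemma powr_add_le:
  fixes a b p :: real
  assumes "0 \<le> a" "0 \<le> b" "0 \<le> p"
  shows "(a + b) powr p \<le> 2 powr p * (a powr p + b powr p)"
proof -
  have "(a + b) powr p \<le> (2 * max a b) powr p" using assms by (intro powr_mono2) auto
  also have "\<dots> = 2 powr p * max a b powr p" using assms by (simp add: powr_mult)
  also have "max a b powr p \<le> a powr p + b powr p" by (simp add: max_def)
  finally show ?thesis by simp
qed

section \<open>The tail integral against Hardy norms\<close>

context Dhat_weight
begin

lemma Hp_integrand_measurable:
  assumes "\<mu> \<in> Mplus"
  shows "(\<lambda>r. measure_tail \<mu> r * \<Phi> \<beta> r) \<in> borel_measurable unit_lborel"
    "measure_tail \<mu> \<in> borel_measurable unit_lborel" "\<Phi> \<beta> \<in> borel_measurable unit_lborel"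
proof -
  have [measurable]: "measure_tail \<mu> \<in> borel_measurable (restrict_space borel {0<..<1})"
    by (rule antimono_on_borel_measurable) (auto intro!: measure_tail_antimono[OF assms])
  have [measurable]: "tail \<in> borel_measurable (restrict_space borel {0<..<1})"
    by (rule antimono_on_borel_measurable) (auto intro!: weight_tail_antimono)
  have [measurable]: "(\<lambda>r::real. (1 - r) powr (- \<beta> - 1)) \<in> borel_measurable (restrict_space borel {0<..<1})"
    by (rule measurable_restrict_space1) measurable
  show ks: "\<Phi> \<beta> \<in> borel_measurable unit_lborel"
    unfolding measurable_restrict_lborel kernel_size_def[abs_def] by measurable
  show mt: "measure_tail \<mu> \<in> borel_measurable unit_lborel"
    unfolding measurable_restrict_lborel by measurable
  show "(\<lambda>r. measure_tail \<mu> r * \<Phi> \<beta> r) \<in> borel_measurable unit_lborel"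
    using mt ks by measurable
qed

lemma Hp_quantity_eq:
  "Hp_quantity p \<beta> \<omega> \<mu> = (\<integral>\<^sup>+ r. ennreal ((measure_tail \<mu> r * \<Phi> \<beta> r) powr p) \<partial>unit_lborel)
    + ennreal (measure_tail \<mu> 0 powr p)"
proof -
  have "(\<integral>\<^sup>+ r\<in>{0..<1}. ennreal ((measure_tail \<mu> r / (tail r * (1 - r) powr (\<beta> + 1))) powr p) \<partial>lborel)
      = (\<integral>\<^sup>+ r. ennreal ((measure_tail \<mu> r * \<Phi> \<beta> r) powr p) * indicator {0<..<1} r \<partial>lborel)"
  proof (rule nn_integral_cong_AE)
    have eq: "measure_tail \<mu> r / (tail r * (1 - r) powr (\<beta> + 1)) = measure_tail \<mu> r * \<Phi> \<beta> r" for r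
    proof -
      have "- \<beta> - 1 = - (\<beta> + 1)" by simp
      then have "(1 - r) powr (- \<beta> - 1) = 1 / (1 - r) powr (\<beta> + 1)" by (simp only: powr_minus_divide)
      then show ?thesis by (simp add: kernel_size_def)
    qed
    show "AE r in lborel. ennreal ((measure_tail \<mu> r / (tail r * (1 - r) powr (\<beta> + 1))) powr p) * indicator {0..<1} r
        = ennreal ((measure_tail \<mu> r * \<Phi> \<beta> r) powr p) * indicator {0<..<1} r"
      unfolding eq using AE_lborel_singleton[of 0] by eventually_elim (auto simp: indicator_def)
  qed
  then show ?thesis by (simp add: Hp_quantity_def nn_integral_unit_lborel)
qed

text \<open>Only the part of \<mu> on \<open>t \<ge> r\<close> is kept. There
  \<open>t * (\<rho> * r)\<close> lies between \<open>r ^ 3\<close> and \<open>r\<close>, because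
  \<open>r \<le> \<rho>\<close>; its distance to 1 is comparable to \<open>1 - r\<close>, and by
  doubling \<open>kernel_size\<close> is comparable at the two points. At the centre
  \<open>kernel_size\<close> is evaluated at 0 for every \<open>t\<close>, which yields the total
  mass.\<close>

lemma test_fun_radial_lower:
  assumes \<beta>: "0 \<le> \<beta>"
  obtains C where "C > 0"
    "\<And>\<mu> \<rho> r. \<mu> \<in> Mplus \<Longrightarrow> 0 < \<rho> \<Longrightarrow> \<rho> < 1 \<Longrightarrow> 0 < r \<Longrightarrow> r \<le> \<rho> \<Longrightarrow>
      measure_tail \<mu> r * \<Phi> \<beta> r \<le> C * cmod (Cop \<mu> \<omega> (test_fun \<beta>) (of_real (\<rho> * r)))"
    "\<And>\<mu>. \<mu> \<in> Mplus \<Longrightarrow> measure_tail \<mu> 0 \<le> C * cmod (Cop \<mu> \<omega> (test_fun \<beta>) 0)"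
proof -
  obtain C1 where C1: "C1 > 0"
    "\<And>\<mu> \<beta> x. \<mu> \<in> Mplus \<Longrightarrow> 0 \<le> x \<Longrightarrow> x < 1 \<Longrightarrow>
      (\<integral>\<^sup>+ t. ennreal (\<Phi> \<beta> (t * x)) \<partial>\<mu>) \<le> ennreal (C1 * cmod (Cop \<mu> \<omega> (test_fun \<beta>) (of_real x)))"
    using kernel_size_le_Cop by blast
  obtain D b where D: "D \<ge> 1" "b \<ge> 0"
    "\<And>r t. 0 \<le> r \<Longrightarrow> r \<le> t \<Longrightarrow> t < 1 \<Longrightarrow>
       tail r \<le> D * ((1 - r) / (1 - t)) powr b * tail t"
    using weight_tail_power_doubling by blast
  define c where "c = 3 powr (\<beta> + 1) * (D * 3 powr b)"
  have c: "c > 0" using D by (simp add: c_def)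
  \<comment> \<open>A factor 3 in the distance to 1 costs \<open>D * 3 powr b\<close> in the tails
    and \<open>3 powr (\<beta> + 1)\<close> in the power; \<open>c\<close> is their product.\<close>
  have ks: "\<Phi> \<beta> r \<le> c * \<Phi> \<beta> y"
    if "0 < r" "r < 1" "0 \<le> y" "y \<le> r" "1 - y \<le> 3 * (1 - r)" for r y
  proof -
    have y1: "y < 1" using that by simp
    note wr = weight_tail_pos[OF less_imp_le[OF that(1)] that(2)]
    note wy = weight_tail_pos[OF that(3) y1]
    have "((1 - y) / (1 - r)) powr b \<le> 3 powr b"
      using that D by (intro powr_mono2) (auto simp: field_simps)
    then have "D * ((1 - y) / (1 - r)) powr b * tail r \<le> D * 3 powr b * tail r"
      using D wr by (intro mult_right_mono mult_left_mono) auto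
    with D(3)[OF that(3,4,2)] have "tail y \<le> D * 3 powr b * tail r" by linarith
    then have 1: "1 / tail r \<le> D * 3 powr b * (1 / tail y)"
      using wr wy by (simp add: field_simps)
    have "(1 - r) powr (- \<beta> - 1) \<le> ((1 - y) / 3) powr (- \<beta> - 1)"
      using that \<beta> y1 by (intro powr_mono2') auto
    also have "\<dots> = 3 powr (\<beta> + 1) * (1 - y) powr (- \<beta> - 1)"
      using y1 by (intro divide_powr_minus) auto
    finally have "(1 - r) powr (- \<beta> - 1) * (1 / tail r)
        \<le> (3 powr (\<beta> + 1) * (1 - y) powr (- \<beta> - 1)) * (D * 3 powr b * (1 / tail y))"
      using 1 wr by (intro mult_mono) auto
    then show ?thesis by (simp add: kernel_size_def c_def mult_ac)
  qed
  define k0 where "k0 = \<Phi> \<beta> 0"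
  have k0: "k0 > 0" unfolding k0_def by (rule kernel_size_pos) auto
  show ?thesis
  proof (rule that[of "c * C1 + C1 / k0"])
    show "0 < c * C1 + C1 / k0" using c C1 k0 by (simp add: add_pos_pos)
  next
    fix \<mu> and \<rho> r :: real
    assume \<mu>: "\<mu> \<in> Mplus" and \<rho>: "0 < \<rho>" "\<rho> < 1" and r: "0 < r" "r \<le> \<rho>"
    let ?F = "cmod (Cop \<mu> \<omega> (test_fun \<beta>) (of_real (\<rho> * r)))"
    have r1: "r < 1" using r \<rho> by simp
    have \<rho>r: "0 \<le> \<rho> * r" "\<rho> * r < 1" "\<rho> * r \<le> r"
      using mult_in_unit[of \<rho> r] \<rho> r r1 mult_right_mono[of \<rho> 1 r] by auto
    have A: "{r..<1} \<in> sets \<mu>"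
      using r by (subst MplusD(2)[OF \<mu>]) (auto simp: sets_restrict_space_iff)
    have ksp: "0 < \<Phi> \<beta> r" by (rule kernel_size_pos[OF less_imp_le[OF r(1)] r1])
    have "ennreal (\<Phi> \<beta> r * measure_tail \<mu> r) = ennreal (\<Phi> \<beta> r) * emeasure \<mu> {r..<1}"
      using ksp by (simp add: ennreal_mult' measure_tail_emeasure[OF \<mu>])
    also have "\<dots> = (\<integral>\<^sup>+ t. ennreal (\<Phi> \<beta> r) * indicator {r..<1} t \<partial>\<mu>)"
      using A by (rule nn_integral_cmult_indicator[symmetric])
    also have "\<dots> \<le> (\<integral>\<^sup>+ t. ennreal c * ennreal (\<Phi> \<beta> (t * (\<rho> * r))) \<partial>\<mu>)"
    proof (intro nn_integral_mono)
      fix t assume "t \<in> space \<mu>"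
      then have t: "0 \<le> t" "t < 1" by (auto simp: MplusD(3)[OF \<mu>])
      have tt: "0 \<le> t * (\<rho> * r)" "t * (\<rho> * r) < 1"
        using mult_in_unit[OF t \<rho>r(1) less_imp_le[OF \<rho>r(2)]] by auto
      show "ennreal (\<Phi> \<beta> r) * indicator {r..<1} t \<le> ennreal c * ennreal (\<Phi> \<beta> (t * (\<rho> * r)))"
      proof (cases "r \<le> t")
        case True
        have le: "t * (\<rho> * r) \<le> r"
          using mult_left_le_one_le[of "\<rho> * r" t] t \<rho>r by linarith
        have "r * (r * r) \<le> t * (\<rho> * r)" using True r \<rho> by (intro mult_mono) auto
        moreover have "1 - r * (r * r) \<le> 3 * (1 - r)"
        proof -
          \<comment> \<open>The product equals \<open>3 * (1 - r) - (1 - r ^ 3)\<close>.\<close>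
          have "0 \<le> (1 - r) * (1 - r) * (2 + r)" using r r1 by simp
          then show ?thesis by (simp add: algebra_simps)
        qed
        ultimately have "1 - t * (\<rho> * r) \<le> 3 * (1 - r)" by linarith
        from ks[OF r(1) r1 tt(1) le this]
        have "ennreal (\<Phi> \<beta> r) \<le> ennreal (c * \<Phi> \<beta> (t * (\<rho> * r)))" by (rule ennreal_leI)
        also have "\<dots> = ennreal c * ennreal (\<Phi> \<beta> (t * (\<rho> * r)))"
          using c kernel_size_pos[OF tt, of \<beta>] by (intro ennreal_mult) auto
        finally show ?thesis using True t by simp
      qed simp
    qed
    also have "\<dots> = ennreal c * (\<integral>\<^sup>+ t. ennreal (\<Phi> \<beta> (t * (\<rho> * r))) \<partial>\<mu>)"
      using kernel_size_measurable[OF \<mu> \<rho>r(1) less_imp_le[OF \<rho>r(2)]] by (intro nn_integral_cmult) measurable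
    also have "\<dots> \<le> ennreal c * ennreal (C1 * ?F)"
      by (intro mult_left_mono C1(2)[OF \<mu> \<rho>r(1,2)]) auto
    also have "\<dots> = ennreal (c * (C1 * ?F))"
      using c C1 by (intro ennreal_mult[symmetric]) auto
    finally have "\<Phi> \<beta> r * measure_tail \<mu> r \<le> c * (C1 * ?F)"
      using c C1 by (subst (asm) ennreal_le_iff) auto
    also have "\<dots> \<le> (c * C1 + C1 / k0) * ?F"
      using C1 k0 by (simp add: distrib_right)
    finally show "measure_tail \<mu> r * \<Phi> \<beta> r \<le> (c * C1 + C1 / k0) * ?F"
      by (simp only: mult.commute)
  next
    fix \<mu> assume \<mu>: "\<mu> \<in> Mplus"
    let ?F = "cmod (Cop \<mu> \<omega> (test_fun \<beta>) 0)"
    have "ennreal (k0 * measure_tail \<mu> 0) = (\<integral>\<^sup>+ t. ennreal (\<Phi> \<beta> (t * 0)) \<partial>\<mu>)"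
      using k0 finite_measure.emeasure_eq_measure[OF MplusD(1)[OF \<mu>]]
      by (simp add: k0_def[symmetric] measure_tail_0[OF \<mu>] ennreal_mult')
    also have "\<dots> \<le> ennreal (C1 * ?F)"
      using C1(2)[OF \<mu>, of 0] by simp
    finally have "k0 * measure_tail \<mu> 0 \<le> C1 * ?F"
      using C1 by (subst (asm) ennreal_le_iff) auto
    then have "measure_tail \<mu> 0 \<le> (C1 / k0) * ?F" using k0 by (simp add: field_simps)
    also have "\<dots> \<le> (c * C1 + C1 / k0) * ?F" using c C1 by (intro mult_right_mono) auto
    finally show "measure_tail \<mu> 0 \<le> (c * C1 + C1 / k0) * ?F" .
  qed
qed

lemma emeasure_unit_lborel: "emeasure unit_lborel {0<..<1} = 1"
  by (simp add: emeasure_restrict_space)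

text \<open>For \<open>t \<ge> 1 / 2\<close> the integrand is comparable to the left-hand side divided by \<open>1 - t\<close> on
  \<open>[2 * t - 1, t]\<close>; the summand \<open>1\<close> only serves the range \<open>t < 1 / 2\<close>.\<close>

lemma arc_kernel_spread:
  assumes \<beta>: "0 \<le> \<beta>"
  obtains C where "C > 0"
    "\<And>t d. 0 \<le> t \<Longrightarrow> t < 1 \<Longrightarrow> 0 < d \<Longrightarrow> d \<le> 1 \<Longrightarrow>
      ennreal ((1 - t) powr (- \<beta>) / tail t * (1 / (1 - t + d))) \<le>
      (\<integral>\<^sup>+ r. ennreal (C * (1 / (1 - r + d))) * ((if r \<le> t then ennreal (\<Phi> \<beta> r) else 0) + 1) \<partial>unit_lborel)"
proof -
  obtain D where D: "D > 1" "\<And>r. 0 \<le> r \<Longrightarrow> r < 1 \<Longrightarrow> tail r \<le> D * tail ((1 + r) / 2)"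
    using weight_tail_doubling by blast
  define w where "w = tail (1 / 2)"
  have w: "w > 0" unfolding w_def by (rule weight_tail_pos) auto
  \<comment> \<open>The first summand serves \<open>t \<ge> 1 / 2\<close>: a factor 2 from the angle
    kernel, \<open>2 powr (\<beta> + 1)\<close> from the powers of \<open>1 - r\<close>, and
    \<open>D\<close> from the tails. The second serves \<open>t < 1 / 2\<close>, where the left-hand
    side is bounded and the angle kernel on the right is at least 1/2.\<close>
  define C where "C = 2 * 2 powr (\<beta> + 1) * D + 2 * ((1 / 2) powr (- \<beta>) / w * 2)"
  have C: "2 * 2 powr (\<beta> + 1) * D \<le> C" "2 * ((1 / 2) powr (- \<beta>) / w * 2) \<le> C"
    using D w by (auto simp: C_def)
  have C0: "C > 0" using C(1) D by (smt (verit) mult_pos_pos powr_gt_zero)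
  show ?thesis
  proof (rule that[OF C0])
    fix t d :: real assume t: "0 \<le> t" "t < 1" and d: "0 < d" "d \<le> 1"
    let ?f = "\<lambda>r. ennreal (C * (1 / (1 - r + d))) * ((if r \<le> t then ennreal (\<Phi> \<beta> r) else 0) + 1)"
    note wt = weight_tail_pos[OF t]
    show "ennreal ((1 - t) powr (- \<beta>) / tail t * (1 / (1 - t + d))) \<le> (\<integral>\<^sup>+ r. ?f r \<partial>unit_lborel)"
    proof (cases "t < 1 / 2")
      case True
      have "(1 - t) powr (- \<beta>) / tail t * (1 / (1 - t + d)) \<le> ((1 / 2) powr (- \<beta>) / w) * 2"
      proof (intro mult_mono frac_le)
        show "(1 - t) powr (- \<beta>) \<le> (1 / 2) powr (- \<beta>)" using True \<beta> by (intro powr_mono2') auto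
        show "w \<le> tail t" unfolding w_def using True t by (intro weight_tail_antimono) auto
        show "1 / (1 - t + d) \<le> 2" using True d by (simp add: field_simps)
      qed (use w d t in auto)
      also have "\<dots> \<le> C * (1 / 2)" using C(2) by simp
      finally have "ennreal ((1 - t) powr (- \<beta>) / tail t * (1 / (1 - t + d))) \<le> ennreal (C * (1 / 2))"
        by (rule ennreal_leI)
      also have "\<dots> = (\<integral>\<^sup>+ r. ennreal (C * (1 / 2)) \<partial>unit_lborel)"
        using emeasure_unit_lborel by simp
      also have "\<dots> \<le> (\<integral>\<^sup>+ r. ?f r \<partial>unit_lborel)"
      proof (intro nn_integral_mono)
        fix r assume "r \<in> space unit_lborel"
        then have r: "0 < r" "r < 1" by (auto simp: space_unit_lborel)
        have "1 / 2 \<le> 1 / (1 - r + d)" using r d by (intro divide_left_mono) auto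
        then have "ennreal (C * (1 / 2)) * 1 \<le> ennreal (C * (1 / (1 - r + d))) *
            ((if r \<le> t then ennreal (\<Phi> \<beta> r) else 0) + 1)"
          using C0 by (intro mult_mono ennreal_leI mult_left_mono) auto
        then show "ennreal (C * (1 / 2)) \<le> ?f r" by simp
      qed
      finally show ?thesis .
    next
      case False
      \<comment> \<open>The left-hand side spread evenly over an interval of length
        \<open>1 - t\<close>; the case distinction ensures that this interval lies in
        \<open>[0, 1]\<close>.\<close>
      define e where "e = (1 - t) powr (- \<beta>) / tail t * (1 / (1 - t + d)) * (1 / (1 - t))"
      have e: "0 \<le> e" using t d wt by (simp add: e_def)
      have "ennreal ((1 - t) powr (- \<beta>) / tail t * (1 / (1 - t + d))) = ennreal (e * (1 - t))"
        using t by (simp add: e_def)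
      also have "\<dots> = ennreal e * ennreal (1 - t)" using e t by (intro ennreal_mult) auto
      also have "ennreal (1 - t) = emeasure lborel {2 * t - 1<..<t}" using t by simp
      also have "ennreal e * emeasure lborel {2 * t - 1<..<t} = (\<integral>\<^sup>+ r. ennreal e * indicator {2 * t - 1<..<t} r \<partial>lborel)"
        by (rule nn_integral_cmult_indicator[symmetric]) simp
      also have "\<dots> \<le> (\<integral>\<^sup>+ r. ?f r * indicator {0<..<1} r \<partial>lborel)"
      proof (intro nn_integral_mono)
        fix r :: real
        show "ennreal e * indicator {2 * t - 1<..<t} r \<le> ?f r * indicator {0<..<1} r"
        proof (cases "2 * t - 1 < r \<and> r < t")
          case True
          then have r: "0 < r" "r < 1" "r < t" "1 - r \<le> 2 * (1 - t)" using False t by auto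
          note wr = weight_tail_pos[OF less_imp_le[OF r(1)] r(2)]
          have "tail r \<le> tail (2 * t - 1)"
            using True False by (intro weight_tail_antimono) auto
          also have "\<dots> \<le> D * tail t" using D(2)[of "2 * t - 1"] False t by simp
          finally have 1: "1 / tail t \<le> D * (1 / tail r)"
            using wr wt by (simp add: field_simps)
          have "(1 - t) powr (- \<beta> - 1) \<le> ((1 - r) / 2) powr (- \<beta> - 1)"
            using r t \<beta> by (intro powr_mono2') auto
          also have "\<dots> = 2 powr (\<beta> + 1) * (1 - r) powr (- \<beta> - 1)"
            using r by (intro divide_powr_minus) auto
          finally have 2: "(1 - t) powr (- \<beta> - 1) \<le> 2 powr (\<beta> + 1) * (1 - r) powr (- \<beta> - 1)" .
          have 3: "1 / (1 - t + d) \<le> 2 * (1 / (1 - r + d))"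
            using r t d by (simp add: field_simps)
          have "e = (1 - t) powr (- \<beta> - 1) * (1 / tail t) * (1 / (1 - t + d))"
            using t by (simp add: e_def powr_diff)
          also have "\<dots> \<le> (2 powr (\<beta> + 1) * (1 - r) powr (- \<beta> - 1)) * (D * (1 / tail r)) * (2 * (1 / (1 - r + d)))"
            using 1 2 3 wt wr D t d by (intro mult_mono) auto
          also have "\<dots> = (2 * 2 powr (\<beta> + 1) * D) * ((1 / (1 - r + d)) * \<Phi> \<beta> r)"
            by (simp add: kernel_size_def mult_ac)
          also have "\<dots> \<le> C * ((1 / (1 - r + d)) * \<Phi> \<beta> r)"
            using C(1) kernel_size_pos[OF less_imp_le[OF r(1)] r(2), of \<beta>] r d by (intro mult_right_mono) auto
          finally have "ennreal e \<le> ennreal ((C * (1 / (1 - r + d))) * \<Phi> \<beta> r)"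
            by (intro ennreal_leI) (simp only: mult.assoc)
          also have "\<dots> = ennreal (C * (1 / (1 - r + d))) * ennreal (\<Phi> \<beta> r)"
            using C0 kernel_size_pos[OF less_imp_le[OF r(1)] r(2), of \<beta>] r d by (intro ennreal_mult) auto
          also have "\<dots> \<le> ?f r"
            using r by (intro mult_left_mono) auto
          finally show ?thesis using True r by simp
        qed auto
      qed
      also have "\<dots> = (\<integral>\<^sup>+ r. ?f r \<partial>unit_lborel)" by (simp only: nn_integral_unit_lborel)
      finally show ?thesis .
    qed
  qed
qed

text \<open>Here the tail of \<mu> appears: for fixed \<open>r\<close> the set of \<open>t\<close>
  with \<open>r \<le> t\<close> has measure \<open>measure_tail \<mu> r\<close>, and the summand 1
  contributes the total mass. The bound does not depend on \<rho>, so it passes to the supremum in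
  the Hardy norm.\<close>

lemma Cop_arc_bound:
  assumes \<beta>: "0 \<le> \<beta>"
  obtains C where "C > 0"
    "\<And>\<mu> f \<rho> \<tau>. \<mu> \<in> Mplus \<Longrightarrow> f \<in> analytic_space (X_norm \<beta>) \<Longrightarrow> 0 \<le> \<rho> \<Longrightarrow> \<rho> < 1 \<Longrightarrow> 0 < \<tau> \<Longrightarrow> \<tau> < 1 \<Longrightarrow>
      ennreal (cmod (Cop \<mu> \<omega> f (of_real \<rho> * cis (2 * pi * \<tau>)))) \<le>
      (\<integral>\<^sup>+ r. ennreal (1 / (1 - r + arc_dist \<tau>)) *
        ennreal (C * enn2real (X_norm \<beta> f) * (measure_tail \<mu> r * \<Phi> \<beta> r + measure_tail \<mu> 0)) \<partial>unit_lborel)"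
proof -
  obtain C2 where C2: "C2 > 0"
    "\<And>\<mu> \<beta> f r \<tau>. \<mu> \<in> Mplus \<Longrightarrow> f \<in> analytic_space (X_norm \<beta>) \<Longrightarrow> 0 \<le> r \<Longrightarrow> r < 1 \<Longrightarrow> 0 < \<tau> \<Longrightarrow> \<tau> < 1 \<Longrightarrow>
      ennreal (cmod (Cop \<mu> \<omega> f (of_real r * cis (2 * pi * \<tau>)))) \<le>
        (\<integral>\<^sup>+ t. ennreal (C2 * enn2real (X_norm \<beta> f) *
          ((1 - t * r) powr (- \<beta>) / tail (t * r)) * (1 / (1 - t * r + arc_dist \<tau>))) \<partial>\<mu>)"
    using Cop_norm_le_arc_kernel by blast
  obtain C5 where C5: "C5 > 0"
    "\<And>t d. 0 \<le> t \<Longrightarrow> t < 1 \<Longrightarrow> 0 < d \<Longrightarrow> d \<le> 1 \<Longrightarrow>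
      ennreal ((1 - t) powr (- \<beta>) / tail t * (1 / (1 - t + d))) \<le>
      (\<integral>\<^sup>+ r. ennreal (C5 * (1 / (1 - r + d))) * ((if r \<le> t then ennreal (\<Phi> \<beta> r) else 0) + 1) \<partial>unit_lborel)"
    using arc_kernel_spread[OF \<beta>] by blast
  show ?thesis
  proof (rule that[of "C2 * C5"])
    show "0 < C2 * C5" using C2 C5 by simp
    fix \<mu> f and \<rho> \<tau> :: real
    assume \<mu>: "\<mu> \<in> Mplus" and f: "f \<in> analytic_space (X_norm \<beta>)" and \<rho>: "0 \<le> \<rho>" "\<rho> < 1" and \<tau>: "0 < \<tau>" "\<tau> < 1"
    define N where "N = enn2real (X_norm \<beta> f)"
    have N: "0 \<le> N" by (simp add: N_def)
    define d where "d = arc_dist \<tau>"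
    have d: "0 < d" "d \<le> 1" using arc_dist_pos[OF \<tau>] \<tau> by (auto simp: d_def arc_dist_def)
    have sp: "0 \<le> t" "t < 1" if "t \<in> space \<mu>" for t using that by (auto simp: MplusD(3)[OF \<mu>])
    interpret pair_sigma_finite unit_lborel \<mu>
      using sigma_finite_unit_lborel Mplus_sigma_finite[OF \<mu>] by (simp add: pair_sigma_finite_def)
    have idU: "(\<lambda>x. x) \<in> borel_measurable unit_lborel" by (rule measurable_restrict_space1) measurable
    have id\<mu>: "(\<lambda>x. x) \<in> borel_measurable \<mu>" by (rule Mplus_measurable_borel[OF \<mu>]) measurable
    have [measurable]: "\<Phi> \<beta> \<in> borel_measurable unit_lborel" "measure_tail \<mu> \<in> borel_measurable unit_lborel"
      by (rule Hp_integrand_measurable[OF \<mu>])+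
    let ?k = "\<lambda>r t. ennreal (C5 * (1 / (1 - r + d))) * ((if r \<le> t then ennreal (\<Phi> \<beta> r) else 0) + 1)"
    have [measurable]: "(\<lambda>p. ennreal (C5 * (1 / (1 - fst p + d)))) \<in> borel_measurable (unit_lborel \<Otimes>\<^sub>M \<mu>)"
      by (rule measurable_compose[OF measurable_fst]) (rule measurable_restrict_space1, measurable)
    have [measurable]: "(\<lambda>p. fst p :: real) \<in> borel_measurable (unit_lborel \<Otimes>\<^sub>M \<mu>)"
      "(\<lambda>p. snd p :: real) \<in> borel_measurable (unit_lborel \<Otimes>\<^sub>M \<mu>)"
      using measurable_compose[OF measurable_fst idU] measurable_compose[OF measurable_snd id\<mu>] by auto
    have [measurable]: "(\<lambda>p. \<Phi> \<beta> (fst p)) \<in> borel_measurable (unit_lborel \<Otimes>\<^sub>M \<mu>)"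
      by (rule measurable_compose[OF measurable_fst]) measurable
    have km: "case_prod ?k \<in> borel_measurable (unit_lborel \<Otimes>\<^sub>M \<mu>)"
      unfolding case_prod_beta by measurable
    have "ennreal (cmod (Cop \<mu> \<omega> f (of_real \<rho> * cis (2 * pi * \<tau>)))) \<le>
        (\<integral>\<^sup>+ t. ennreal (C2 * N * ((1 - t * \<rho>) powr (- \<beta>) / tail (t * \<rho>)) * (1 / (1 - t * \<rho> + d))) \<partial>\<mu>)"
      unfolding N_def d_def by (rule C2(2)[OF \<mu> f \<rho> \<tau>])
    also have "\<dots> \<le> (\<integral>\<^sup>+ t. \<integral>\<^sup>+ r. ennreal (C2 * N) * ?k r t \<partial>unit_lborel \<partial>\<mu>)"
    proof (intro nn_integral_mono)
      fix t assume "t \<in> space \<mu>"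
      note t = sp[OF this]
      note t\<rho> = mult_in_unit[OF t \<rho>(1) less_imp_le[OF \<rho>(2)]]
      \<comment> \<open>All three factors can only grow when \<open>t * \<rho>\<close> is replaced
        by \<open>t\<close>; this makes the bound uniform in \<rho>.\<close>
      have "((1 - t * \<rho>) powr (- \<beta>) / tail (t * \<rho>)) * (1 / (1 - t * \<rho> + d))
          \<le> ((1 - t) powr (- \<beta>) / tail t) * (1 / (1 - t + d))"
      proof (intro mult_mono frac_le)
        show "(1 - t * \<rho>) powr (- \<beta>) \<le> (1 - t) powr (- \<beta>)" using t t\<rho> \<beta> by (intro powr_mono2') auto
        show "tail t \<le> tail (t * \<rho>)" using t\<rho> by (intro weight_tail_antimono) auto
      qed (use t t\<rho> d weight_tail_pos[OF t] in auto)
      then have "(C2 * N) * (((1 - t * \<rho>) powr (- \<beta>) / tail (t * \<rho>)) * (1 / (1 - t * \<rho> + d)))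
          \<le> (C2 * N) * (((1 - t) powr (- \<beta>) / tail t) * (1 / (1 - t + d)))"
        using C2 N by (intro mult_left_mono) auto
      then have "ennreal (C2 * N * ((1 - t * \<rho>) powr (- \<beta>) / tail (t * \<rho>)) * (1 / (1 - t * \<rho> + d)))
          \<le> ennreal ((C2 * N) * (((1 - t) powr (- \<beta>) / tail t) * (1 / (1 - t + d))))"
        by (intro ennreal_leI) (simp only: mult.assoc)
      also have "\<dots> = ennreal (C2 * N) * ennreal (((1 - t) powr (- \<beta>) / tail t) * (1 / (1 - t + d)))"
        using C2 N t d weight_tail_pos[OF t] by (intro ennreal_mult) auto
      also have "\<dots> \<le> ennreal (C2 * N) * (\<integral>\<^sup>+ r. ?k r t \<partial>unit_lborel)"
        by (intro mult_left_mono C5(2) t d) auto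
      also have "\<dots> = (\<integral>\<^sup>+ r. ennreal (C2 * N) * ?k r t \<partial>unit_lborel)"
      proof (rule nn_integral_cmult[symmetric])
        show "(\<lambda>r. ?k r t) \<in> borel_measurable unit_lborel"
          using measurable_Pair1[OF km \<open>t \<in> space \<mu>\<close>] by simp
      qed
      finally show "ennreal (C2 * N * ((1 - t * \<rho>) powr (- \<beta>) / tail (t * \<rho>)) * (1 / (1 - t * \<rho> + d)))
          \<le> (\<integral>\<^sup>+ r. ennreal (C2 * N) * ?k r t \<partial>unit_lborel)" .
    qed
    also have "\<dots> = (\<integral>\<^sup>+ r. \<integral>\<^sup>+ t. ennreal (C2 * N) * ?k r t \<partial>\<mu> \<partial>unit_lborel)"
      by (rule Fubini') (use km in \<open>simp add: case_prod_beta\<close>)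
    also have "\<dots> = (\<integral>\<^sup>+ r. ennreal (1 / (1 - r + d)) *
        ennreal (C2 * C5 * N * (measure_tail \<mu> r * \<Phi> \<beta> r + measure_tail \<mu> 0)) \<partial>unit_lborel)"
    proof (intro nn_integral_cong)
      fix r assume "r \<in> space unit_lborel"
      then have r: "0 < r" "r < 1" by (auto simp: space_unit_lborel)
      have A: "{r..<1} \<in> sets \<mu>"
        using r by (subst MplusD(2)[OF \<mu>]) (auto simp: sets_restrict_space_iff)
      have ksp: "0 < \<Phi> \<beta> r" by (rule kernel_size_pos[OF less_imp_le[OF r(1)] r(2)])
      have mt: "0 \<le> measure_tail \<mu> s" for s by (simp add: measure_tail_def)
      have "(\<integral>\<^sup>+ t. ennreal (C2 * N) * ?k r t \<partial>\<mu>)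
          = (\<integral>\<^sup>+ t. (ennreal (C2 * N) * ennreal (C5 * (1 / (1 - r + d)))) * (ennreal (\<Phi> \<beta> r) * indicator {r..<1} t + 1) \<partial>\<mu>)"
        using sp by (intro nn_integral_cong) (auto simp: mult.assoc indicator_def)
      also have "\<dots> = (ennreal (C2 * N) * ennreal (C5 * (1 / (1 - r + d)))) *
          (\<integral>\<^sup>+ t. ennreal (\<Phi> \<beta> r) * indicator {r..<1} t + 1 \<partial>\<mu>)"
        by (rule nn_integral_cmult) (use A in auto)
      also have "(\<integral>\<^sup>+ t. ennreal (\<Phi> \<beta> r) * indicator {r..<1} t + 1 \<partial>\<mu>)
          = ennreal (\<Phi> \<beta> r) * emeasure \<mu> {r..<1} + emeasure \<mu> (space \<mu>)"
        using A by (subst nn_integral_add) (auto simp: nn_integral_cmult_indicator)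
      also have "\<dots> = ennreal (measure_tail \<mu> r * \<Phi> \<beta> r + measure_tail \<mu> 0)"
      proof -
        have "emeasure \<mu> (space \<mu>) = ennreal (measure_tail \<mu> 0)"
          using measure_tail_emeasure[OF \<mu>, of 0] by (simp add: MplusD(3)[OF \<mu>])
        moreover have "ennreal (\<Phi> \<beta> r) * emeasure \<mu> {r..<1} = ennreal (measure_tail \<mu> r * \<Phi> \<beta> r)"
          unfolding measure_tail_emeasure[OF \<mu>, symmetric] using ksp mt
          by (simp add: ennreal_mult mult.commute)
        ultimately show ?thesis using ksp mt by simp
      qed
      also have "ennreal (C2 * N) * ennreal (C5 * (1 / (1 - r + d))) * ennreal (measure_tail \<mu> r * \<Phi> \<beta> r + measure_tail \<mu> 0)
          = ennreal ((C2 * N) * (C5 * (1 / (1 - r + d))) * (measure_tail \<mu> r * \<Phi> \<beta> r + measure_tail \<mu> 0))"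
      proof -
        have "ennreal a * ennreal b * ennreal c = ennreal (a * b * c)" if "0 \<le> a" "0 \<le> b" "0 \<le> c" for a b c
          using that by (simp add: ennreal_mult)
        then show ?thesis
          by this (use C2 C5 N r d ksp mt in auto)
      qed
      also have "(C2 * N) * (C5 * (1 / (1 - r + d))) * (measure_tail \<mu> r * \<Phi> \<beta> r + measure_tail \<mu> 0)
          = (1 / (1 - r + d)) * (C2 * C5 * N * (measure_tail \<mu> r * \<Phi> \<beta> r + measure_tail \<mu> 0))"
        by (simp only: mult_ac)
      also have "ennreal \<dots> = ennreal (1 / (1 - r + d)) * ennreal (C2 * C5 * N * (measure_tail \<mu> r * \<Phi> \<beta> r + measure_tail \<mu> 0))"
        using C2 C5 N r d ksp mt by (intro ennreal_mult) auto
      finally show "(\<integral>\<^sup>+ t. ennreal (C2 * N) * ?k r t \<partial>\<mu>) = \<dots>" .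
    qed
    finally show "ennreal (cmod (Cop \<mu> \<omega> f (of_real \<rho> * cis (2 * pi * \<tau>)))) \<le>
      (\<integral>\<^sup>+ r. ennreal (1 / (1 - r + arc_dist \<tau>)) *
        ennreal (C2 * C5 * enn2real (X_norm \<beta> f) * (measure_tail \<mu> r * \<Phi> \<beta> r + measure_tail \<mu> 0)) \<partial>unit_lborel)"
      by (simp only: N_def d_def)
  qed
qed

text \<open>The two Hilbert-type inequalities run in opposite directions: from the radius to the
  circle for sufficiency, from the circle to the radius for necessity.\<close>

lemma Cop_X_to_Hp:
  assumes p: "1 < p" and \<beta>: "0 \<le> \<beta>"
  shows "(\<forall>\<mu>\<in>Mplus. bounded_op (X_norm \<beta>) (Hp_norm p) (Cop \<mu> \<omega>) \<longleftrightarrow> Hp_quantity p \<beta> \<omega> \<mu> < \<infinity>)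
     \<and> comparable_on {\<mu>\<in>Mplus. bounded_op (X_norm \<beta>) (Hp_norm p) (Cop \<mu> \<omega>)}
         (\<lambda>\<mu>. op_norm (X_norm \<beta>) (Hp_norm p) (Cop \<mu> \<omega>))
         (\<lambda>\<mu>. enn2real (Hp_quantity p \<beta> \<omega> \<mu>) powr (1 / p))"
proof -
  obtain A where A: "A > 0"
    "\<And>G g. (\<And>\<tau>. 0 < \<tau> \<Longrightarrow> \<tau> < 1 \<Longrightarrow> 0 \<le> G \<tau>) \<Longrightarrow> (\<And>r. 0 < r \<Longrightarrow> r < 1 \<Longrightarrow> 0 \<le> g r) \<Longrightarrow>
      g \<in> borel_measurable unit_lborel \<Longrightarrow>
      (\<And>\<tau>. 0 < \<tau> \<Longrightarrow> \<tau> < 1 \<Longrightarrow> ennreal (G \<tau>) \<le> (\<integral>\<^sup>+ r. ennreal (1 / (1 - r + arc_dist \<tau>)) * ennreal (g r) \<partial>unit_lborel)) \<Longrightarrow>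
      (\<integral>\<^sup>+ \<tau>. ennreal (G \<tau> powr p) \<partial>unit_lborel) \<le> ennreal A * (\<integral>\<^sup>+ r. ennreal (g r powr p) \<partial>unit_lborel)"
    "\<And>G g. (\<And>r. 0 < r \<Longrightarrow> r < 1 \<Longrightarrow> 0 \<le> G r) \<Longrightarrow> (\<And>\<tau>. 0 < \<tau> \<Longrightarrow> \<tau> < 1 \<Longrightarrow> 0 \<le> g \<tau>) \<Longrightarrow>
      g \<in> borel_measurable unit_lborel \<Longrightarrow>
      (\<And>r. 0 < r \<Longrightarrow> r < 1 \<Longrightarrow> ennreal (G r) \<le> (\<integral>\<^sup>+ \<tau>. ennreal (1 / (1 - r + arc_dist \<tau>)) * ennreal (g \<tau>) \<partial>unit_lborel)) \<Longrightarrow>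
      (\<integral>\<^sup>+ r. ennreal (G r powr p) \<partial>unit_lborel) \<le> ennreal A * (\<integral>\<^sup>+ \<tau>. ennreal (g \<tau> powr p) \<partial>unit_lborel)"
    using hilbert_inequality_arc[OF p] by blast
  obtain C where C: "C > 0"
    "\<And>\<mu> \<rho> r. \<mu> \<in> Mplus \<Longrightarrow> 0 < \<rho> \<Longrightarrow> \<rho> < 1 \<Longrightarrow> 0 < r \<Longrightarrow> r \<le> \<rho> \<Longrightarrow>
      measure_tail \<mu> r * \<Phi> \<beta> r \<le> C * cmod (Cop \<mu> \<omega> (test_fun \<beta>) (of_real (\<rho> * r)))"
    "\<And>\<mu>. \<mu> \<in> Mplus \<Longrightarrow> measure_tail \<mu> 0 \<le> C * cmod (Cop \<mu> \<omega> (test_fun \<beta>) 0)"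
    using test_fun_radial_lower[OF \<beta>] by blast
  obtain E where E: "E > 0"
    "\<And>\<mu> f \<rho> \<tau>. \<mu> \<in> Mplus \<Longrightarrow> f \<in> analytic_space (X_norm \<beta>) \<Longrightarrow> 0 \<le> \<rho> \<Longrightarrow> \<rho> < 1 \<Longrightarrow> 0 < \<tau> \<Longrightarrow> \<tau> < 1 \<Longrightarrow>
      ennreal (cmod (Cop \<mu> \<omega> f (of_real \<rho> * cis (2 * pi * \<tau>)))) \<le>
      (\<integral>\<^sup>+ r. ennreal (1 / (1 - r + arc_dist \<tau>)) *
        ennreal (E * enn2real (X_norm \<beta> f) * (measure_tail \<mu> r * \<Phi> \<beta> r + measure_tail \<mu> 0)) \<partial>unit_lborel)"
    using Cop_arc_bound[OF \<beta>] by blast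
  have mt: "0 \<le> measure_tail \<mu> s" for \<mu> s by (simp add: measure_tail_def)
  \<comment> \<open>One summand for the integral in \<open>Hp_quantity\<close>, with the 3 of the
    chord estimate, and one for the total mass.\<close>
  define B where "B = A * (3 * C) powr p + C powr p"
  have B: "B > 0" using A C by (simp add: B_def add_pos_pos)
  show ?thesis
  proof (rule ratio_characterization[of "A powr (1 / p) * E * 2" "B powr (1 / p)"])
    show "0 < A powr (1 / p) * E * 2" "0 < B powr (1 / p)" using A E B by auto
  next
    fix \<mu> assume \<mu>: "\<mu> \<in> Mplus" and fin: "Hp_quantity p \<beta> \<omega> \<mu> < \<infinity>"
    define H where "H = enn2real (Hp_quantity p \<beta> \<omega> \<mu>)"
    have H0: "0 \<le> H" by (simp add: H_def)
    have H: "ennreal H = Hp_quantity p \<beta> \<omega> \<mu>" using fin by (simp add: H_def)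
    define h where "h r = measure_tail \<mu> r * \<Phi> \<beta> r" for r
    have h0: "0 \<le> h r" if "0 < r" "r < 1" for r
      using that kernel_size_pos[of r \<beta>] mt[of \<mu> r] by (simp add: h_def)
    have hm [measurable]: "h \<in> borel_measurable unit_lborel"
      unfolding h_def[abs_def] by (rule Hp_integrand_measurable[OF \<mu>])
    define c where "c = A powr (1 / p) * E * 2"
    have c: "c > 0" using A E by (simp add: c_def)
    have "op_bound (X_norm \<beta>) (Hp_norm p) (Cop \<mu> \<omega>) (c * H powr (1 / p))"
    proof (rule op_bound_Cop[OF \<mu>])
      show "0 \<le> c * H powr (1 / p)" using c by simp
      fix f assume f: "f \<in> analytic_space (X_norm \<beta>)"
      let ?F = "Cop \<mu> \<omega> f"
      have Fhol: "?F holomorphic_on ball 0 1"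
        using f by (intro Cop_holomorphic[OF \<mu>]) (simp add: analytic_space_def)
      define N where "N = enn2real (X_norm \<beta> f)"
      have N0: "0 \<le> N" by (simp add: N_def)
      define g where "g r = E * N * (h r + measure_tail \<mu> 0)" for r
      have g0: "0 \<le> g r" if "0 < r" "r < 1" for r
        using h0[OF that] E N0 mt[of \<mu> 0] by (simp add: g_def)
      have gm: "g \<in> borel_measurable unit_lborel" unfolding g_def[abs_def] by measurable
      have gint: "(\<integral>\<^sup>+ r. ennreal (g r powr p) \<partial>unit_lborel) \<le> ennreal ((E * N * 2) powr p * H)"
      proof -
        have "(\<integral>\<^sup>+ r. ennreal (g r powr p) \<partial>unit_lborel) \<le>
            (\<integral>\<^sup>+ r. ennreal ((E * N * 2) powr p) * (ennreal (h r powr p) + ennreal (measure_tail \<mu> 0 powr p)) \<partial>unit_lborel)"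
        proof (intro nn_integral_mono)
          fix r assume "r \<in> space unit_lborel"
          then have r: "0 < r" "r < 1" by (auto simp: space_unit_lborel)
          have "g r powr p = (E * N) powr p * (h r + measure_tail \<mu> 0) powr p"
            unfolding g_def by (rule powr_mult)
          also have "\<dots> \<le> (E * N) powr p * (2 powr p * (h r powr p + measure_tail \<mu> 0 powr p))"
            using p h0[OF r] mt[of \<mu> 0] by (intro mult_left_mono powr_add_le) auto
          also have "\<dots> = (E * N * 2) powr p * (h r powr p + measure_tail \<mu> 0 powr p)"
            using E N0 by (simp add: powr_mult)
          finally show "ennreal (g r powr p) \<le>
              ennreal ((E * N * 2) powr p) * (ennreal (h r powr p) + ennreal (measure_tail \<mu> 0 powr p))"
            by (simp add: ennreal_leI flip: ennreal_mult ennreal_plus)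
        qed
        also have "\<dots> = ennreal ((E * N * 2) powr p) * (\<integral>\<^sup>+ r. ennreal (h r powr p) + ennreal (measure_tail \<mu> 0 powr p) \<partial>unit_lborel)"
          by (rule nn_integral_cmult) measurable
        also have "(\<integral>\<^sup>+ r. ennreal (h r powr p) + ennreal (measure_tail \<mu> 0 powr p) \<partial>unit_lborel)
            = (\<integral>\<^sup>+ r. ennreal (h r powr p) \<partial>unit_lborel) + ennreal (measure_tail \<mu> 0 powr p)"
          by (subst nn_integral_add) (simp_all add: emeasure_unit_lborel)
        also have "\<dots> = ennreal H" unfolding H h_def by (rule Hp_quantity_eq[symmetric])
        also have "ennreal ((E * N * 2) powr p) * ennreal H = ennreal ((E * N * 2) powr p * H)"
          using H0 by (intro ennreal_mult[symmetric]) auto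
        finally show ?thesis .
      qed
      have "Hp_norm p ?F \<le> ennreal (c * H powr (1 / p) * N)"
        unfolding Hp_norm_def
      proof (rule SUP_least)
        fix \<rho> :: real assume "\<rho> \<in> {0..<1}"
        then have \<rho>: "0 \<le> \<rho>" "\<rho> < 1" by auto
        have "ennreal (Mp p \<rho> ?F powr p) = (\<integral>\<^sup>+ \<tau>. ennreal (cmod (?F (of_real \<rho> * cis (2 * pi * \<tau>))) powr p) \<partial>unit_lborel)"
          using p by (intro Mp_powr_holomorphic[OF Fhol \<rho>]) auto
        also have "\<dots> \<le> ennreal A * (\<integral>\<^sup>+ r. ennreal (g r powr p) \<partial>unit_lborel)"
        proof (rule A(2)[OF _ g0 gm])
          fix \<tau> :: real assume \<tau>: "0 < \<tau>" "\<tau> < 1"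
          show "ennreal (cmod (?F (of_real \<rho> * cis (2 * pi * \<tau>)))) \<le>
              (\<integral>\<^sup>+ r. ennreal (1 / (1 - r + arc_dist \<tau>)) * ennreal (g r) \<partial>unit_lborel)"
            using E(2)[OF \<mu> f \<rho> \<tau>] by (simp only: g_def h_def N_def)
        qed auto
        also have "\<dots> \<le> ennreal A * ennreal ((E * N * 2) powr p * H)"
          by (intro mult_left_mono gint) auto
        also have "\<dots> = ennreal (A * ((E * N * 2) powr p * H))"
          using A H0 by (intro ennreal_mult[symmetric]) auto
        finally have "Mp p \<rho> ?F powr p \<le> A * ((E * N * 2) powr p * H)"
          using A H0 by (subst (asm) ennreal_le_iff) auto
        also have "\<dots> = (A powr (1 / p) * (E * N * 2) * H powr (1 / p)) powr p"
          using A E N0 H0 p by (simp add: powr_mult powr_powr)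
        finally have pw: "Mp p \<rho> ?F powr p \<le> (A powr (1 / p) * (E * N * 2) * H powr (1 / p)) powr p" .
        have "Mp p \<rho> ?F \<le> A powr (1 / p) * (E * N * 2) * H powr (1 / p)"
          by (rule powr_cancel_le[OF _ _ pw]) (use p E N0 in auto)
        also have "\<dots> = c * H powr (1 / p) * N" by (simp add: c_def)
        finally show "ennreal (Mp p \<rho> ?F) \<le> ennreal (c * H powr (1 / p) * N)" by (rule ennreal_leI)
      qed
      then show "Hp_norm p ?F \<le> ennreal (c * H powr (1 / p) * enn2real (X_norm \<beta> f))"
        by (simp only: N_def)
    qed
    then show "op_bound (X_norm \<beta>) (Hp_norm p) (Cop \<mu> \<omega>) (A powr (1 / p) * E * 2 * enn2real (Hp_quantity p \<beta> \<omega> \<mu>) powr (1 / p))"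
      by (simp only: c_def H_def)
  next
    fix \<mu> K assume \<mu>: "\<mu> \<in> Mplus" and ob: "op_bound (X_norm \<beta>) (Hp_norm p) (Cop \<mu> \<omega>) K"
    let ?F = "Cop \<mu> \<omega> (test_fun \<beta>)"
    note F = op_bound_test_fun[OF \<beta> ob]
    note K = F(1) and Kn = F(3) and Fhol = F(4)
    have MpK: "ennreal (Mp p \<rho> ?F powr p) \<le> ennreal (K powr p)" if "0 \<le> \<rho>" "\<rho> < 1" for \<rho>
    proof -
      have "ennreal (Mp p \<rho> ?F) \<le> Hp_norm p ?F" unfolding Hp_norm_def using that by (intro SUP_upper) auto
      also note Kn
      finally have "Mp p \<rho> ?F \<le> K" using K by (subst (asm) ennreal_le_iff) auto
      then show ?thesis using p by (intro ennreal_leI powr_mono2 Mp_nonneg) auto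
    qed
    define h where "h r = measure_tail \<mu> r * \<Phi> \<beta> r" for r
    have h0: "0 \<le> h r" if "0 < r" "r < 1" for r
      using that kernel_size_pos[of r \<beta>] mt[of \<mu> r] by (simp add: h_def)
    have hm [measurable]: "h \<in> borel_measurable unit_lborel"
      unfolding h_def[abs_def] by (rule Hp_integrand_measurable[OF \<mu>])
    have hint: "(\<integral>\<^sup>+ r. ennreal (h r powr p) \<partial>unit_lborel) \<le> ennreal (A * ((3 * C) powr p * K powr p))"
    proof (rule nn_integral_le_of_truncations)
      fix \<rho> :: real assume \<rho>: "0 < \<rho>" "\<rho> < 1"
      let ?a = "\<lambda>\<tau>. cmod (?F (of_real \<rho> * cis (2 * pi * \<tau>)))"
      \<comment> \<open>The truncation makes the pointwise lower bound hold for every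
        \<open>r\<close>, trivially from \<rho> on.\<close>
      define G where "G r = (if r < \<rho> then h r else 0)" for r
      have am [measurable]: "?a \<in> borel_measurable unit_lborel"
        using holomorphic_circle_measurable[OF Fhol less_imp_le[OF \<rho>(1)] \<rho>(2)]
        by (intro measurable_restrict_space1) measurable
      have "(\<integral>\<^sup>+ r. ennreal (h r powr p) * indicator {..<\<rho>} r \<partial>unit_lborel) = (\<integral>\<^sup>+ r. ennreal (G r powr p) \<partial>unit_lborel)"
        by (intro nn_integral_cong) (auto simp: G_def indicator_def)
      also have "\<dots> \<le> ennreal A * (\<integral>\<^sup>+ \<tau>. ennreal ((C * (3 * ?a \<tau>)) powr p) \<partial>unit_lborel)"
      proof (rule A(3))
        show "(\<lambda>\<tau>. C * (3 * ?a \<tau>)) \<in> borel_measurable unit_lborel" by measurable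
        show "0 \<le> G r" if "0 < r" "r < 1" for r using h0[OF that] by (simp add: G_def)
        show "0 \<le> C * (3 * ?a \<tau>)" for \<tau> using C by simp
        fix r :: real assume r: "0 < r" "r < 1"
        show "ennreal (G r) \<le> (\<integral>\<^sup>+ \<tau>. ennreal (1 / (1 - r + arc_dist \<tau>)) * ennreal (C * (3 * ?a \<tau>)) \<partial>unit_lborel)"
        proof (cases "r < \<rho>")
          case True
          have [measurable]: "(\<lambda>\<tau>. ennreal (1 / (1 - r + arc_dist \<tau>))) \<in> borel_measurable unit_lborel"
            by (rule measurable_restrict_space1) measurable
          have "G r \<le> C * cmod (?F (of_real (\<rho> * r)))"
            using C(2)[OF \<mu> \<rho> r(1)] True by (simp add: G_def h_def)
          then have "ennreal (G r) \<le> ennreal C * ennreal (cmod (?F (of_real (\<rho> * r))))"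
            using C by (simp add: ennreal_leI flip: ennreal_mult)
          also have "\<dots> \<le> ennreal C * (\<integral>\<^sup>+ \<tau>. ennreal (1 / (1 - r + arc_dist \<tau>)) * ennreal (3 * ?a \<tau>) \<partial>unit_lborel)"
            using r by (intro mult_left_mono cauchy_arc_bound[OF Fhol \<rho>]) auto
          also have "\<dots> = (\<integral>\<^sup>+ \<tau>. ennreal C * (ennreal (1 / (1 - r + arc_dist \<tau>)) * ennreal (3 * ?a \<tau>)) \<partial>unit_lborel)"
            by (rule nn_integral_cmult[symmetric]) measurable
          also have "\<dots> = (\<integral>\<^sup>+ \<tau>. ennreal (1 / (1 - r + arc_dist \<tau>)) * ennreal (C * (3 * ?a \<tau>)) \<partial>unit_lborel)"
          proof (intro nn_integral_cong)
            fix \<tau>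
            have "ennreal (C * (3 * ?a \<tau>)) = ennreal C * ennreal (3 * ?a \<tau>)"
              using C by (intro ennreal_mult) auto
            then show "ennreal C * (ennreal (1 / (1 - r + arc_dist \<tau>)) * ennreal (3 * ?a \<tau>))
                = ennreal (1 / (1 - r + arc_dist \<tau>)) * ennreal (C * (3 * ?a \<tau>))"
              by (simp only: mult_ac)
          qed
          finally show ?thesis .
        qed (simp add: G_def)
      qed
      also have "(\<integral>\<^sup>+ \<tau>. ennreal ((C * (3 * ?a \<tau>)) powr p) \<partial>unit_lborel)
          = (\<integral>\<^sup>+ \<tau>. ennreal ((3 * C) powr p) * ennreal (?a \<tau> powr p) \<partial>unit_lborel)"
      proof (intro nn_integral_cong)
        fix \<tau>
        have "(C * (3 * ?a \<tau>)) powr p = ((3 * C) * ?a \<tau>) powr p" by (simp only: mult_ac)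
        also have "\<dots> = (3 * C) powr p * ?a \<tau> powr p" by (rule powr_mult)
        finally show "ennreal ((C * (3 * ?a \<tau>)) powr p) = ennreal ((3 * C) powr p) * ennreal (?a \<tau> powr p)"
          by (simp add: ennreal_mult)
      qed
      also have "\<dots> = ennreal ((3 * C) powr p) * (\<integral>\<^sup>+ \<tau>. ennreal (?a \<tau> powr p) \<partial>unit_lborel)"
        by (rule nn_integral_cmult) measurable
      also have "(\<integral>\<^sup>+ \<tau>. ennreal (?a \<tau> powr p) \<partial>unit_lborel) = ennreal (Mp p \<rho> ?F powr p)"
        using p \<rho> by (intro Mp_powr_holomorphic[OF Fhol, symmetric]) auto
      also have "ennreal A * (ennreal ((3 * C) powr p) * ennreal (Mp p \<rho> ?F powr p))
          \<le> ennreal A * (ennreal ((3 * C) powr p) * ennreal (K powr p))"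
        using \<rho> by (intro mult_left_mono MpK) auto
      also have "\<dots> = ennreal (A * ((3 * C) powr p * K powr p))"
        using A by (simp add: ennreal_mult)
      finally show "(\<integral>\<^sup>+ r. ennreal (h r powr p) * indicator {..<\<rho>} r \<partial>unit_lborel) \<le> ennreal (A * ((3 * C) powr p * K powr p))" .
    qed measurable
    have "ennreal (cmod (?F 0) powr p) = ennreal (Mp p 0 ?F powr p)"
      using p by (subst Mp_powr_holomorphic[OF Fhol]) (auto simp: emeasure_unit_lborel)
    also have "\<dots> \<le> ennreal (K powr p)" by (rule MpK) auto
    finally have F0: "cmod (?F 0) powr p \<le> K powr p" by (subst (asm) ennreal_le_iff) auto
    have "measure_tail \<mu> 0 powr p \<le> (C * cmod (?F 0)) powr p"
      using C(3)[OF \<mu>] mt[of \<mu> 0] p by (intro powr_mono2) auto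
    also have "\<dots> = C powr p * cmod (?F 0) powr p" by (rule powr_mult)
    also have "\<dots> \<le> C powr p * K powr p" using F0 by (intro mult_left_mono) auto
    finally have m0: "measure_tail \<mu> 0 powr p \<le> C powr p * K powr p" .
    have "Hp_quantity p \<beta> \<omega> \<mu> = (\<integral>\<^sup>+ r. ennreal (h r powr p) \<partial>unit_lborel) + ennreal (measure_tail \<mu> 0 powr p)"
      unfolding h_def by (rule Hp_quantity_eq)
    also have "\<dots> \<le> ennreal (A * ((3 * C) powr p * K powr p)) + ennreal (C powr p * K powr p)"
      by (intro add_mono hint ennreal_leI m0)
    also have "\<dots> = ennreal (A * ((3 * C) powr p * K powr p) + C powr p * K powr p)"
      using A by (intro ennreal_plus[symmetric]) auto
    also have "A * ((3 * C) powr p * K powr p) + C powr p * K powr p = B * K powr p"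
      by (simp add: B_def distrib_right)
    finally have HB: "Hp_quantity p \<beta> \<omega> \<mu> \<le> ennreal (B * K powr p)" .
    then have "enn2real (Hp_quantity p \<beta> \<omega> \<mu>) \<le> B * K powr p"
      using B by (intro enn2real_leI) auto
    then have "enn2real (Hp_quantity p \<beta> \<omega> \<mu>) powr (1 / p) \<le> (B * K powr p) powr (1 / p)"
      using p by (intro powr_mono2) auto
    also have "\<dots> = B powr (1 / p) * K" using B K p by (simp add: powr_mult powr_powr)
    finally have "enn2real (Hp_quantity p \<beta> \<omega> \<mu>) powr (1 / p) \<le> B powr (1 / p) * K" .
    moreover have "Hp_quantity p \<beta> \<omega> \<mu> < \<infinity>"
      using HB by (rule le_less_trans) simp
    ultimately show "Hp_quantity p \<beta> \<omega> \<mu> < \<infinity> \<and> enn2real (Hp_quantity p \<beta> \<omega> \<mu>) powr (1 / p) \<le> B powr (1 / p) * K"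
      by blast
  qed
qed

end

theorem theorem3:
  fixes p \<gamma> \<beta> :: real and \<omega> :: "complex \<Rightarrow> real"
  assumes "1 < p" and "0 < \<gamma>" and "0 \<le> \<beta>" and "\<omega> \<in> Dhat"
  shows
    "((\<forall>\<mu>\<in>Mplus. bounded_op (X_norm \<beta>) (Hp_norm p) (Cop \<mu> \<omega>) \<longleftrightarrow> Hp_quantity p \<beta> \<omega> \<mu> < \<infinity>)
     \<and> comparable_on {\<mu>\<in>Mplus. bounded_op (X_norm \<beta>) (Hp_norm p) (Cop \<mu> \<omega>)}
         (\<lambda>\<mu>. op_norm (X_norm \<beta>) (Hp_norm p) (Cop \<mu> \<omega>))
         (\<lambda>\<mu>. enn2real (Hp_quantity p \<beta> \<omega> \<mu>) powr (1 / p)))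
     \<and>
     ((\<forall>\<mu>\<in>Mplus. bounded_op (X_norm \<beta>) (X_norm \<gamma>) (Cop \<mu> \<omega>)
         \<longleftrightarrow> bdd_above (range (moment_ratio (\<gamma> - \<beta> - 1) \<omega> \<mu>)))
     \<and> comparable_on {\<mu>\<in>Mplus. bounded_op (X_norm \<beta>) (X_norm \<gamma>) (Cop \<mu> \<omega>)}
         (\<lambda>\<mu>. op_norm (X_norm \<beta>) (X_norm \<gamma>) (Cop \<mu> \<omega>))
         (\<lambda>\<mu>. SUP n. moment_ratio (\<gamma> - \<beta> - 1) \<omega> \<mu> n))
     \<and>
     ((\<forall>\<mu>\<in>Mplus. bounded_op (X_norm \<beta>) (Hp_weighted_norm p \<gamma>) (Cop \<mu> \<omega>)
         \<longleftrightarrow> bdd_above (range (moment_ratio (\<gamma> - \<beta> + 1 / p - 1) \<omega> \<mu>)))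
     \<and> comparable_on {\<mu>\<in>Mplus. bounded_op (X_norm \<beta>) (Hp_weighted_norm p \<gamma>) (Cop \<mu> \<omega>)}
         (\<lambda>\<mu>. op_norm (X_norm \<beta>) (Hp_weighted_norm p \<gamma>) (Cop \<mu> \<omega>))
         (\<lambda>\<mu>. SUP n. moment_ratio (\<gamma> - \<beta> + 1 / p - 1) \<omega> \<mu> n))"
proof -
  interpret Dhat_weight \<omega> by (rule Dhat_weight.intro[OF assms(4)])
  show ?thesis
    by (rule conjI[OF Cop_X_to_Hp[OF assms(1,3)] conjI[OF Cop_X_to_X[OF assms(3,2)]
          Cop_X_to_Hp_weighted[OF assms(1,3,2)]]])
qed

end
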